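(* Let $p$ be a prime, $n$ a natural number and $G=\mathbb{Z}^n\ltimes \mathrm{UT}_n(\mathbb{Z}[1/p])$. Let $\mu$ be a probability measure on $G$ that has finite first moment with respect to word length and such that the group generated by $\operatorname{supp}\mu$ is non-abelian, and suppose that its displacement matrix $D$ is non-zero and column consistent. Let $\Gamma$ be the set of $n\times n$ upper unitriangular matrices $M$ whose entries $M_{ij}$ ($i<j$) lie in $\mathbb{R}$ if $D_{ij}<0$ and in $\mathbb{Q}_p$ if $D_{ij}>0$, with the action of $G$ given by $(x,f)\cdot b=f\,XbX^{-1}$, $X=\operatorname{diag}(p^{x_1},\dots,p^{x_n})$. Let $\varphi^{(\infty)}$ be the almost surely defined $\Gamma$-valued random variable with entries $\varphi^{(\infty)}_{ij}=\lim_{m\to\infty}\varphi^{(m)}_{ij}$ (limit in $\mathbb{R}$ or $\mathbb{Q}_p$ according to the sign of $D_{ij}$), where $(y^{(m)},\varphi^{(m)})$ is the path of the right random walk associated with $\mu$, and let $\nu$ be the law of $\varphi^{(\infty)}$. Then $\Gamma$ is a second countable $G$-space, $\nu$ is $\mu$-stationary, and $(\Gamma,\nu)$ is a $\mu$-boundary of $(G,\mu)$ with boundary map $\varphi^{(\infty)}$.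
   Context: $\mathrm{UT}_n(R)$ is the group of upper unitriangular $n\times n$ matrices over $R$. The product in $G$ is $(x,f)(y,g)=(x+y,\,f\,XgX^{-1})$, where $X=\operatorname{diag}(p^{x_1},\dots,p^{x_n})$. $G$ is a finitely generated discrete group; word length $|\cdot|$ is taken with respect to a finite generating set, and finite first moment means $\int_G|g|\,d\mu(g)<\infty$. $\Gamma$ carries the product topology. For $1\le i\le n$, $\mu_i$ is the pushforward of $\mu$ under $(x,f)\mapsto x_i$, $m_1(\mu_i)=\int_{\mathbb{Z}} z\,d\mu_i(z)$, and the displacement matrix $D$ has entries $D_{ij}=m_1(\mu_i)-m_1(\mu_j)$ for $i<j$. $D$ is non-zero if every entry $D_{ij}$ with $i<j$ is non-zero, and column consistent if, for each $j$, all entries $D_{ij}$ with $i<j$ have the same sign. The right random walk: $(x^{(k)},f^{(k)})_{k\ge1}$ are independent with common law $\mu$, and $R_m=(y^{(m)},\varphi^{(m)})=(x^{(1)},f^{(1)})\cdots(x^{(m)},f^{(m)})$. A $G$-space is a topological space $B$ on which $G$ acts with $G\times B\to B$ continuous. A measure $\nu$ on $B$ is $\mu$-stationary if $\mu*\nu=\nu$. If $B$ is a second countable $G$-space with $\mu$-stationary probability measure $\nu$, then $(B,\nu)$ is a $\mu$-boundary with boundary map $\mathbf{bnd}$ (a random variable on path space with values in $B$) if $R_m(\omega)\cdot\nu$ converges in the weak* topology to the point mass $\delta_{\mathbf{bnd}(\omega)}$ for almost every path $\omega$. *)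

theory Defs
  imports
    "HOL-Probability.Probability"
    "HOL-Algebra.Group_Action"
    "HOL-Algebra.Generated_Groups"
    "Jordan_Normal_Form.Matrix"
    "Berlekamp_Zassenhaus.Finite_Field"
begin

unbundle no vec_syntax

section \<open>The field of p-adic numbers\<close>

subsection \<open>The p-adic absolute value on the rationals\<close>

definition padic_abs :: "nat \<Rightarrow> rat \<Rightarrow> real" where
  "padic_abs p q = (if q = 0 then 0 else
     real p powi (int (multiplicity (int p) (snd (quotient_of q)))
                  - int (multiplicity (int p) (fst (quotient_of q)))))"

lemma padic_abs_0 [simp]: "padic_abs p 0 = 0"
  by (simp add: padic_abs_def)

lemma padic_abs_nonneg [simp]: "padic_abs p q \<ge> 0"
  by (simp add: padic_abs_def)

lemma padic_abs_frac:
  assumes p: "prime p" and a: "a \<noteq> 0" and b: "b \<noteq> 0"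
  shows "padic_abs p (of_int a / of_int b) =
    real p powi (int (multiplicity (int p) b) - int (multiplicity (int p) a))"
proof -
  have p': "prime_elem (int p)" using p by simp
  obtain c d where cd: "quotient_of (of_int a / of_int b) = (c, d)" by fastforce
  have d: "d > 0" using cd by (rule quotient_of_denom_pos)
  have eq: "(of_int a / of_int b :: rat) = of_int c / of_int d"
    using cd by (rule quotient_of_div)
  have "(of_int (a * d) :: rat) = of_int (c * b)"
    using eq b d by (simp add: field_simps)
  hence ad: "a * d = c * b" by (simp only: of_int_eq_iff)
  have c: "c \<noteq> 0" using ad a d by auto
  have "multiplicity (int p) a + multiplicity (int p) d =
        multiplicity (int p) c + multiplicity (int p) b"
    using arg_cong [OF ad, of "multiplicity (int p)"] a b c d p'
    by (simp add: prime_elem_multiplicity_mult_distrib)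
  hence "int (multiplicity (int p) d) - int (multiplicity (int p) c) =
         int (multiplicity (int p) b) - int (multiplicity (int p) a)" by linarith
  thus ?thesis using cd a b by (simp add: padic_abs_def)
qed

lemma rat_frac_cases:
  fixes q :: rat
  obtains a b where "b \<noteq> 0" "q = of_int a / of_int b"
  by (metis quotient_of_div quotient_of_denom_pos less_irrefl surj_pair)

lemma padic_abs_eq_0_iff [simp]: "prime p \<Longrightarrow> padic_abs p q = 0 \<longleftrightarrow> q = 0"
  by (auto simp: padic_abs_def prime_gt_0_nat)

lemma padic_abs_1 [simp]: "padic_abs p 1 = 1"
  by (simp add: padic_abs_def)

lemma padic_abs_minus [simp]: "padic_abs p (- q) = padic_abs p q"
proof -
  have "multiplicity (int p) (- a) = multiplicity (int p) a" for a
    using multiplicity_times_unit_right [of "- 1" "int p" a] by simp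
  thus ?thesis by (auto simp: padic_abs_def rat_uminus_code split: prod.splits)
qed

lemma padic_abs_diff_commute: "padic_abs p (x - y) = padic_abs p (y - x)"
  by (metis padic_abs_minus minus_diff_eq)

lemma padic_abs_mult:
  assumes p: "prime p"
  shows "padic_abs p (x * y) = padic_abs p x * padic_abs p y"
proof (cases "x = 0 \<or> y = 0")
  case False
  obtain a b where b: "b \<noteq> 0" and x: "x = of_int a / of_int b" by (rule rat_frac_cases)
  obtain c d where d: "d \<noteq> 0" and y: "y = of_int c / of_int d" by (rule rat_frac_cases)
  have a: "a \<noteq> 0" and c: "c \<noteq> 0" using False x y by auto
  have p': "prime_elem (int p)" using p by simp
  have p0: "real p \<noteq> 0" using p by (simp add: prime_gt_0_nat)
  have "x * y = of_int (a * c) / of_int (b * d)" using x y by simp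
  hence "padic_abs p (x * y) =
      real p powi (int (multiplicity (int p) (b * d)) - int (multiplicity (int p) (a * c)))"
    using a b c d p by (simp only: padic_abs_frac mult_eq_0_iff simp_thms)
  also have "\<dots> = real p powi ((int (multiplicity (int p) b) - int (multiplicity (int p) a)) +
                              (int (multiplicity (int p) d) - int (multiplicity (int p) c)))"
    using a b c d p' by (simp add: prime_elem_multiplicity_mult_distrib algebra_simps)
  also have "\<dots> = padic_abs p x * padic_abs p y"
    unfolding x y padic_abs_frac [OF p a b] padic_abs_frac [OF p c d]
    by (rule power_int_add) (use p0 in simp)
  finally show ?thesis .
qed auto

lemma padic_abs_inverse:
  assumes p: "prime p"
  shows "padic_abs p (inverse x) = inverse (padic_abs p x)"
proof (cases "x = 0")
  case False
  have "padic_abs p (inverse x) * padic_abs p x = 1"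
    using False by (simp add: padic_abs_mult [OF p, symmetric])
  thus ?thesis by (metis inverse_unique mult.commute)
qed simp

lemma padic_abs_ultrametric:
  assumes p: "prime p"
  shows "padic_abs p (x + y) \<le> max (padic_abs p x) (padic_abs p y)"
proof (cases "x = 0 \<or> y = 0 \<or> x + y = 0")
  case False
  obtain a0 b0 where b0: "b0 \<noteq> 0" and x0: "x = of_int a0 / of_int b0" by (rule rat_frac_cases)
  obtain c0 d0 where d0: "d0 \<noteq> 0" and y0: "y = of_int c0 / of_int d0" by (rule rat_frac_cases)
  define a c b where "a = a0 * d0" and "c = c0 * b0" and "b = b0 * d0"
  have b: "b \<noteq> 0" using b0 d0 by (simp add: b_def)
  have x: "x = of_int a / of_int b" and y: "y = of_int c / of_int b"
    using b0 d0 by (simp_all add: x0 y0 a_def b_def c_def)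
  have xy: "x + y = of_int (a + c) / of_int b" by (simp add: x y add_divide_distrib)
  have a: "a \<noteq> 0" and c: "c \<noteq> 0" and ac: "a + c \<noteq> 0" using False x y xy by auto
  let ?m = "multiplicity (int p)"
  have "int p ^ min (?m a) (?m c) dvd a + c"
    by (intro dvd_add multiplicity_dvd') auto
  hence "min (?m a) (?m c) \<le> ?m (a + c)"
    using ac p by (intro multiplicity_geI) (auto simp: prime_nat_iff)
  hence "real p powi (int (?m b) - int (?m (a + c))) \<le>
         real p powi (int (?m b) - int (min (?m a) (?m c)))"
    using p by (intro power_int_increasing) (auto simp: prime_ge_Suc_0_nat)
  also have "\<dots> \<le> max (padic_abs p x) (padic_abs p y)"
    unfolding x y padic_abs_frac [OF p a b] padic_abs_frac [OF p c b]
    by (cases "?m a \<le> ?m c") (auto simp: min_def)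
  finally show ?thesis unfolding xy padic_abs_frac [OF p ac b] .
qed (auto simp: max_def)

lemma padic_abs_triangle:
  assumes p: "prime p"
  shows "padic_abs p (x + y) \<le> padic_abs p x + padic_abs p y"
  using padic_abs_ultrametric [OF p, of x y] padic_abs_nonneg [of p x] padic_abs_nonneg [of p y]
  by linarith

lemma padic_abs_triangle_diff:
  assumes p: "prime p"
  shows "\<bar>padic_abs p x - padic_abs p y\<bar> \<le> padic_abs p (x - y)"
  using padic_abs_triangle [OF p, of "x - y" y] padic_abs_triangle [OF p, of "y - x" x]
  by (simp add: padic_abs_diff_commute [of p y x])

subsection \<open>Cauchy sequences and null sequences\<close>

definition padic_cauchy :: "nat \<Rightarrow> (nat \<Rightarrow> rat) \<Rightarrow> bool" where
  "padic_cauchy p X \<longleftrightarrow> (\<forall>r>0. \<exists>k. \<forall>m\<ge>k. \<forall>n\<ge>k. padic_abs p (X m - X n) < r)"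

definition padic_null :: "nat \<Rightarrow> (nat \<Rightarrow> rat) \<Rightarrow> bool" where
  "padic_null p X \<longleftrightarrow> (\<lambda>n. padic_abs p (X n)) \<longlonglongrightarrow> 0"

lemma padic_cauchyD:
  "padic_cauchy p X \<Longrightarrow> 0 < r \<Longrightarrow> \<exists>k. \<forall>m\<ge>k. \<forall>n\<ge>k. padic_abs p (X m - X n) < r"
  by (simp add: padic_cauchy_def)

lemma padic_cauchy_const [simp]: "padic_cauchy p (\<lambda>n. c)"
  by (simp add: padic_cauchy_def)

lemma padic_null_const [simp]: "prime p \<Longrightarrow> padic_null p (\<lambda>n. c) \<longleftrightarrow> c = 0"
  by (simp add: padic_null_def LIMSEQ_const_iff)

lemma padic_null_zero [simp]: "padic_null p (\<lambda>n. 0)"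
  by (simp add: padic_null_def)

lemma padic_null_minus: "padic_null p X \<Longrightarrow> padic_null p (\<lambda>n. - X n)"
  by (simp add: padic_null_def)

lemma padic_null_le:
  assumes Z: "Z \<longlonglongrightarrow> 0" and le: "eventually (\<lambda>n. padic_abs p (X n) \<le> Z n) sequentially"
  shows "padic_null p X"
  unfolding padic_null_def
  by (rule tendsto_sandwich [OF _ le tendsto_const Z]) simp

lemma padic_null_add:
  assumes p: "prime p" and "padic_null p X" "padic_null p Y"
  shows "padic_null p (\<lambda>n. X n + Y n)"
proof (rule padic_null_le)
  show "(\<lambda>n. padic_abs p (X n) + padic_abs p (Y n)) \<longlonglongrightarrow> 0"
    using tendsto_add assms(2,3) unfolding padic_null_def by fastforce
qed (simp add: padic_abs_triangle [OF p])

lemma padic_null_diff: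
  assumes p: "prime p" and "padic_null p X" "padic_null p Y"
  shows "padic_null p (\<lambda>n. X n - Y n)"
  using padic_null_add [OF p assms(2) padic_null_minus [OF assms(3)]] by simp

lemma padic_cauchy_minus:
  assumes "padic_cauchy p X" shows "padic_cauchy p (\<lambda>n. - X n)"
proof -
  have "padic_abs p (- X m - - X n) = padic_abs p (X m - X n)" for m n
    by (metis minus_diff_minus padic_abs_minus)
  thus ?thesis using assms by (simp add: padic_cauchy_def)
qed

lemma padic_cauchy_add:
  assumes p: "prime p" and X: "padic_cauchy p X" and Y: "padic_cauchy p Y"
  shows "padic_cauchy p (\<lambda>n. X n + Y n)"
  unfolding padic_cauchy_def
proof (intro allI impI)
  fix r :: real assume r: "r > 0"
  obtain k where k: "\<forall>m\<ge>k. \<forall>n\<ge>k. padic_abs p (X m - X n) < r" using padic_cauchyD [OF X r] ..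
  obtain l where l: "\<forall>m\<ge>l. \<forall>n\<ge>l. padic_abs p (Y m - Y n) < r" using padic_cauchyD [OF Y r] ..
  have "padic_abs p ((X m + Y m) - (X n + Y n)) < r" if "m \<ge> max k l" "n \<ge> max k l" for m n
    unfolding add_diff_add
    using padic_abs_ultrametric [OF p, of "X m - X n" "Y m - Y n"] k l that
    by (meson le_less_trans max.boundedE max_less_iff_conj)
  thus "\<exists>k. \<forall>m\<ge>k. \<forall>n\<ge>k. padic_abs p ((X m + Y m) - (X n + Y n)) < r" by blast
qed

lemma padic_cauchy_abs_convergent:
  assumes p: "prime p" and X: "padic_cauchy p X"
  shows "convergent (\<lambda>n. padic_abs p (X n))"
proof -
  have "Cauchy (\<lambda>n. padic_abs p (X n))"
    unfolding Cauchy_def dist_real_def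
    using padic_cauchyD [OF X] padic_abs_triangle_diff [OF p] by (meson le_less_trans)
  thus ?thesis by (rule Cauchy_convergent)
qed

lemma padic_cauchy_bounded:
  assumes p: "prime p" and X: "padic_cauchy p X"
  shows "\<exists>b>0. \<forall>n. padic_abs p (X n) \<le> b"
proof -
  have "Bseq (\<lambda>n. padic_abs p (X n))"
    by (rule convergent_imp_Bseq [OF padic_cauchy_abs_convergent [OF p X]])
  thus ?thesis by (auto simp: Bseq_def)
qed

lemma padic_null_mult_bounded:
  assumes p: "prime p" and X: "\<exists>b>0. \<forall>n. padic_abs p (X n) \<le> b" and Y: "padic_null p Y"
  shows "padic_null p (\<lambda>n. X n * Y n)"
proof -
  obtain b where b: "b > 0" "\<And>n. padic_abs p (X n) \<le> b" using X by blast
  show ?thesis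
  proof (rule padic_null_le)
    show "(\<lambda>n. b * padic_abs p (Y n)) \<longlonglongrightarrow> 0"
      using tendsto_mult_right_zero Y unfolding padic_null_def by blast
    show "eventually (\<lambda>n. padic_abs p (X n * Y n) \<le> b * padic_abs p (Y n)) sequentially"
      using b by (simp add: padic_abs_mult [OF p] mult_right_mono)
  qed
qed

lemma padic_cauchy_mult:
  assumes p: "prime p" and X: "padic_cauchy p X" and Y: "padic_cauchy p Y"
  shows "padic_cauchy p (\<lambda>n. X n * Y n)"
  unfolding padic_cauchy_def
proof (intro allI impI)
  fix r :: real assume r: "r > 0"
  obtain a where a: "a > 0" "\<And>n. padic_abs p (X n) \<le> a" using padic_cauchy_bounded [OF p X] by blast
  obtain b where b: "b > 0" "\<And>n. padic_abs p (Y n) \<le> b" using padic_cauchy_bounded [OF p Y] by blast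
  obtain k where k: "\<And>m n. m \<ge> k \<Longrightarrow> n \<ge> k \<Longrightarrow> padic_abs p (X m - X n) < r / b"
    using padic_cauchyD [OF X, of "r / b"] r b by auto
  obtain l where l: "\<And>m n. m \<ge> l \<Longrightarrow> n \<ge> l \<Longrightarrow> padic_abs p (Y m - Y n) < r / a"
    using padic_cauchyD [OF Y, of "r / a"] r a by auto
  have "padic_abs p (X m * Y m - X n * Y n) < r" if mn: "m \<ge> max k l" "n \<ge> max k l" for m n
  proof -
    have "padic_abs p (X m * (Y m - Y n)) \<le> a * padic_abs p (Y m - Y n)"
      using a by (simp add: padic_abs_mult [OF p] mult_right_mono)
    also have "\<dots> < r" using l [of m n] mn a by (simp add: pos_less_divide_eq mult.commute)
    finally have 1: "padic_abs p (X m * (Y m - Y n)) < r" .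
    have "padic_abs p ((X m - X n) * Y n) \<le> padic_abs p (X m - X n) * b"
      using b by (simp add: padic_abs_mult [OF p] mult_left_mono)
    also have "\<dots> < r" using k [of m n] mn b by (simp add: pos_less_divide_eq)
    finally have 2: "padic_abs p ((X m - X n) * Y n) < r" .
    show ?thesis
      unfolding mult_diff_mult
      using padic_abs_ultrametric [OF p, of "X m * (Y m - Y n)" "(X m - X n) * Y n"] 1 2 by linarith
  qed
  thus "\<exists>k. \<forall>m\<ge>k. \<forall>n\<ge>k. padic_abs p (X m * Y m - X n * Y n) < r" by blast
qed

lemma padic_cauchy_not_null:
  assumes p: "prime p" and X: "padic_cauchy p X" and nz: "\<not> padic_null p X"
  shows "\<exists>b>0. \<exists>k. \<forall>n\<ge>k. b < padic_abs p (X n)"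
proof -
  obtain L where L: "(\<lambda>n. padic_abs p (X n)) \<longlonglongrightarrow> L"
    using padic_cauchy_abs_convergent [OF p X] by (auto simp: convergent_def)
  have "L \<ge> 0" by (rule LIMSEQ_le_const [OF L]) simp
  moreover have "L \<noteq> 0" using L nz by (auto simp: padic_null_def)
  ultimately have L0: "L > 0" by simp
  have "eventually (\<lambda>n. L / 2 < padic_abs p (X n)) sequentially"
    by (rule order_tendstoD(1) [OF L]) (use L0 in simp)
  moreover have "L / 2 > 0" using L0 by simp
  ultimately show ?thesis unfolding eventually_sequentially by blast
qed

lemma padic_abs_diff_inverse:
  assumes p: "prime p" and b: "0 < b" "b < padic_abs p x" and c: "0 < c" "c < padic_abs p y"
  shows "padic_abs p (inverse x - inverse y) \<le> padic_abs p (x - y) / (b * c)"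
proof -
  have nz: "x \<noteq> 0" "y \<noteq> 0" using b c by auto
  have "padic_abs p (inverse x - inverse y) =
        padic_abs p (x - y) / (padic_abs p x * padic_abs p y)"
    unfolding inverse_diff_inverse [OF nz] padic_abs_minus padic_abs_mult [OF p]
      padic_abs_inverse [OF p]
    by (simp add: divide_inverse)
  also have "\<dots> \<le> padic_abs p (x - y) / (b * c)"
    using b c by (intro divide_left_mono mult_mono mult_pos_pos) auto
  finally show ?thesis .
qed

lemma padic_cauchy_inverse:
  assumes p: "prime p" and X: "padic_cauchy p X" and nz: "\<not> padic_null p X"
  shows "padic_cauchy p (\<lambda>n. inverse (X n))"
  unfolding padic_cauchy_def
proof (intro allI impI)
  fix r :: real assume r: "r > 0"
  obtain b i where b: "0 < b" and i: "\<And>n. n \<ge> i \<Longrightarrow> b < padic_abs p (X n)"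
    using padic_cauchy_not_null [OF p X nz] by blast
  obtain k where k: "\<And>m n. m \<ge> k \<Longrightarrow> n \<ge> k \<Longrightarrow> padic_abs p (X m - X n) < r * (b * b)"
    using padic_cauchyD [OF X, of "r * (b * b)"] r b by auto
  have "padic_abs p (inverse (X m) - inverse (X n)) < r" if "m \<ge> max i k" "n \<ge> max i k" for m n
  proof -
    have "padic_abs p (inverse (X m) - inverse (X n)) \<le> padic_abs p (X m - X n) / (b * b)"
      using that i b by (intro padic_abs_diff_inverse [OF p]) auto
    also have "\<dots> < r" using k [of m n] that b by (simp add: pos_divide_less_eq)
    finally show ?thesis .
  qed
  thus "\<exists>k. \<forall>m\<ge>k. \<forall>n\<ge>k. padic_abs p (inverse (X m) - inverse (X n)) < r" by blast
qed

lemma padic_null_diff_inverse: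
  assumes p: "prime p"
    and X: "padic_cauchy p X" "\<not> padic_null p X"
    and Y: "padic_cauchy p Y" "\<not> padic_null p Y"
    and XY: "padic_null p (\<lambda>n. X n - Y n)"
  shows "padic_null p (\<lambda>n. inverse (X n) - inverse (Y n))"
proof -
  obtain b i where b: "0 < b" and i: "\<And>n. n \<ge> i \<Longrightarrow> b < padic_abs p (X n)"
    using padic_cauchy_not_null [OF p X] by blast
  obtain c j where c: "0 < c" and j: "\<And>n. n \<ge> j \<Longrightarrow> c < padic_abs p (Y n)"
    using padic_cauchy_not_null [OF p Y] by blast
  show ?thesis
  proof (rule padic_null_le)
    show "(\<lambda>n. padic_abs p (X n - Y n) / (b * c)) \<longlonglongrightarrow> 0"
      using XY unfolding padic_null_def by (rule tendsto_divide_zero)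
    show "eventually (\<lambda>n. padic_abs p (inverse (X n) - inverse (Y n))
            \<le> padic_abs p (X n - Y n) / (b * c)) sequentially"
      using eventually_ge_at_top [of "max i j"]
      by eventually_elim (use b c i j in \<open>auto intro!: padic_abs_diff_inverse [OF p]\<close>)
  qed
qed

subsection \<open>The completion\<close>

text \<open>
  The prime is carried by the cardinality of the type parameter, so that the p-adic numbers for
  \<open>p = CARD('p)\<close> form a type. They are constructed as the completion of the rationals for the p-adic
  absolute value: the ring of Cauchy sequences modulo the ideal of null sequences.
\<close>

typedef (overloaded) ('p::prime_card) padic_seq = "{X. padic_cauchy CARD('p) X}"
  by (rule exI [of _ "\<lambda>_. 0"]) simp

setup_lifting type_definition_padic_seq

instantiation padic_seq :: (prime_card) comm_ring_1
begin

lift_definition zero_padic_seq :: "'a padic_seq" is "\<lambda>_. 0" by simp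
lift_definition one_padic_seq :: "'a padic_seq" is "\<lambda>_. 1" by simp
lift_definition plus_padic_seq :: "'a padic_seq \<Rightarrow> 'a padic_seq \<Rightarrow> 'a padic_seq"
  is "\<lambda>X Y n. X n + Y n" by (rule padic_cauchy_add [OF prime_card])
lift_definition uminus_padic_seq :: "'a padic_seq \<Rightarrow> 'a padic_seq"
  is "\<lambda>X n. - X n" by (rule padic_cauchy_minus)
lift_definition minus_padic_seq :: "'a padic_seq \<Rightarrow> 'a padic_seq \<Rightarrow> 'a padic_seq"
  is "\<lambda>X Y n. X n - Y n"
  using padic_cauchy_add [OF prime_card _ padic_cauchy_minus] by fastforce
lift_definition times_padic_seq :: "'a padic_seq \<Rightarrow> 'a padic_seq \<Rightarrow> 'a padic_seq"
  is "\<lambda>X Y n. X n * Y n" by (rule padic_cauchy_mult [OF prime_card])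

instance
  by standard (transfer; simp add: fun_eq_iff algebra_simps)+

end

lift_definition null_seq :: "'p::prime_card padic_seq \<Rightarrow> bool" is "padic_null CARD('p)" .

lemma null_seq_0 [simp]: "null_seq 0"
  by transfer simp

lemma null_seq_add: "null_seq X \<Longrightarrow> null_seq Y \<Longrightarrow> null_seq (X + Y)"
  by transfer (rule padic_null_add [OF prime_card])

lemma null_seq_minus: "null_seq X \<Longrightarrow> null_seq (- X)"
  by transfer (rule padic_null_minus)

lemma null_seq_mult: "null_seq Y \<Longrightarrow> null_seq (X * Y)"
  by transfer (intro padic_null_mult_bounded padic_cauchy_bounded prime_card)

lift_definition const_seq :: "rat \<Rightarrow> 'p::prime_card padic_seq" is "\<lambda>q _. q" by simp

lemma null_const_seq [simp]: "null_seq (const_seq q :: 'p::prime_card padic_seq) \<longleftrightarrow> q = 0"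
  by transfer (simp add: prime_card)

lift_definition inverse_seq :: "'p::prime_card padic_seq \<Rightarrow> 'p padic_seq"
  is "\<lambda>X. if padic_null CARD('p) X then (\<lambda>_. 0) else (\<lambda>n. inverse (X n))"
  by (simp add: padic_cauchy_inverse [OF prime_card])

lemma null_seq_cong: "null_seq (X - Y) \<Longrightarrow> null_seq X \<longleftrightarrow> null_seq Y"
  using null_seq_add [of "X - Y" Y] null_seq_add [of "- (X - Y)" X] null_seq_minus [of "X - Y"]
  by auto

lemma null_seq_diff_inverse:
  "\<not> null_seq X \<Longrightarrow> \<not> null_seq Y \<Longrightarrow> null_seq (X - Y) \<Longrightarrow> null_seq (inverse_seq X - inverse_seq Y)"
proof transfer
  fix X Y assume "padic_cauchy CARD('a) X" "padic_cauchy CARD('a) Y"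
    and nz: "\<not> padic_null CARD('a) X" "\<not> padic_null CARD('a) Y"
    and "padic_null CARD('a) (\<lambda>n. X n - Y n)"
  hence "padic_null CARD('a) (\<lambda>n. inverse (X n) - inverse (Y n))"
    by (intro padic_null_diff_inverse [OF prime_card])
  thus "padic_null CARD('a)
      (\<lambda>n. (if padic_null CARD('a) X then (\<lambda>_. 0) else (\<lambda>n. inverse (X n))) n -
           (if padic_null CARD('a) Y then (\<lambda>_. 0) else (\<lambda>n. inverse (Y n))) n)"
    unfolding if_not_P [OF nz(1)] if_not_P [OF nz(2)] .
qed

lemma inverse_seq_null: "null_seq X \<Longrightarrow> inverse_seq X = 0"
  by transfer simp

lemma null_seq_inverse_mult: "\<not> null_seq X \<Longrightarrow> null_seq (inverse_seq X * X - 1)"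
proof transfer
  fix X assume X: "padic_cauchy CARD('a) X" and nz: "\<not> padic_null CARD('a) X"
  obtain b k where b: "0 < b" and k: "\<And>n. n \<ge> k \<Longrightarrow> b < padic_abs CARD('a) (X n)"
    using padic_cauchy_not_null [OF prime_card X nz] by blast
  have ev: "\<forall>\<^sub>F n in sequentially. padic_abs CARD('a) (inverse (X n) * X n - 1) = 0"
    using eventually_ge_at_top [of k]
  proof eventually_elim
    case (elim n)
    hence "X n \<noteq> 0" using k [of n] b by auto
    thus ?case by simp
  qed
  have "padic_null CARD('a) (\<lambda>n. inverse (X n) * X n - 1)"
    unfolding padic_null_def by (rule tendsto_eventually [OF ev])
  thus "padic_null CARD('a)
      (\<lambda>n. (if padic_null CARD('a) X then (\<lambda>_. 0) else (\<lambda>n. inverse (X n))) n * X n - 1)"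
    using nz by simp
qed

lift_definition abs_seq :: "'p::prime_card padic_seq \<Rightarrow> real"
  is "\<lambda>X. lim (\<lambda>n. padic_abs CARD('p) (X n))" .

lemma abs_seq_LIMSEQ:
  "padic_cauchy CARD('p::prime_card) X \<Longrightarrow>
    (\<lambda>n. padic_abs CARD('p) (X n)) \<longlonglongrightarrow> lim (\<lambda>n. padic_abs CARD('p) (X n))"
  by (rule convergent_LIMSEQ_iff [THEN iffD1, OF padic_cauchy_abs_convergent [OF prime_card]])

lemma abs_seq_cong: "null_seq (X - Y) \<Longrightarrow> abs_seq X = abs_seq Y"
proof transfer
  fix X Y assume X: "padic_cauchy CARD('a) X" and Y: "padic_cauchy CARD('a) Y"
    and XY: "padic_null CARD('a) (\<lambda>n. X n - Y n)"
  have "\<forall>\<^sub>F n in sequentially. norm (padic_abs CARD('a) (X n) - padic_abs CARD('a) (Y n))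
      \<le> padic_abs CARD('a) (X n - Y n)"
    unfolding real_norm_def
    by (rule always_eventually, rule allI, rule padic_abs_triangle_diff [OF prime_card])
  hence "(\<lambda>n. padic_abs CARD('a) (X n) - padic_abs CARD('a) (Y n)) \<longlonglongrightarrow> 0"
    by (rule Lim_null_comparison [OF _ XY [unfolded padic_null_def]])
  moreover have "(\<lambda>n. padic_abs CARD('a) (X n) - padic_abs CARD('a) (Y n)) \<longlonglongrightarrow>
      lim (\<lambda>n. padic_abs CARD('a) (X n)) - lim (\<lambda>n. padic_abs CARD('a) (Y n))"
    by (rule tendsto_diff [OF abs_seq_LIMSEQ [OF X] abs_seq_LIMSEQ [OF Y]])
  ultimately have "lim (\<lambda>n. padic_abs CARD('a) (X n)) - lim (\<lambda>n. padic_abs CARD('a) (Y n)) = 0"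
    by (rule LIMSEQ_unique [rotated])
  thus "lim (\<lambda>n. padic_abs CARD('a) (X n)) = lim (\<lambda>n. padic_abs CARD('a) (Y n))" by simp
qed

lemma abs_seq_eq_0_iff: "abs_seq X = 0 \<longleftrightarrow> null_seq X"
proof transfer
  fix X assume X: "padic_cauchy CARD('a) X"
  show "lim (\<lambda>n. padic_abs CARD('a) (X n)) = 0 \<longleftrightarrow> padic_null CARD('a) X"
    unfolding padic_null_def using abs_seq_LIMSEQ [OF X] limI by metis
qed

lemma abs_seq_minus: "abs_seq (- X) = abs_seq X"
  by transfer simp

lemma abs_seq_triangle: "abs_seq (X + Y) \<le> abs_seq X + abs_seq Y"
proof transfer
  fix X Y assume X: "padic_cauchy CARD('a) X" and Y: "padic_cauchy CARD('a) Y"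
  show "lim (\<lambda>n. padic_abs CARD('a) (X n + Y n)) \<le>
      lim (\<lambda>n. padic_abs CARD('a) (X n)) + lim (\<lambda>n. padic_abs CARD('a) (Y n))"
  proof (rule LIMSEQ_le)
    show "(\<lambda>n. padic_abs CARD('a) (X n + Y n)) \<longlonglongrightarrow>
        lim (\<lambda>n. padic_abs CARD('a) (X n + Y n))"
      by (rule abs_seq_LIMSEQ [OF padic_cauchy_add [OF prime_card X Y]])
    show "(\<lambda>n. padic_abs CARD('a) (X n) + padic_abs CARD('a) (Y n)) \<longlonglongrightarrow>
        lim (\<lambda>n. padic_abs CARD('a) (X n)) + lim (\<lambda>n. padic_abs CARD('a) (Y n))"
      by (rule tendsto_add [OF abs_seq_LIMSEQ [OF X] abs_seq_LIMSEQ [OF Y]])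
    show "\<exists>N. \<forall>n\<ge>N. padic_abs CARD('a) (X n + Y n) \<le>
        padic_abs CARD('a) (X n) + padic_abs CARD('a) (Y n)"
      by (rule exI, rule allI, rule impI, rule padic_abs_triangle [OF prime_card])
  qed
qed

quotient_type 'p padic = "'p::prime_card padic_seq" / "\<lambda>X Y. null_seq (X - Y)"
proof (rule equivpI)
  show "reflp (\<lambda>X Y :: 'p padic_seq. null_seq (X - Y))"
    by (simp add: reflp_def)
  show "symp (\<lambda>X Y :: 'p padic_seq. null_seq (X - Y))"
    by (metis sympI null_seq_minus minus_diff_eq)
  show "transp (\<lambda>X Y :: 'p padic_seq. null_seq (X - Y))"
    by (rule transpI) (metis null_seq_add diff_add_cancel add_diff_eq)
qed

instantiation padic :: (prime_card) field
begin

lift_definition zero_padic :: "'a padic" is 0 .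
lift_definition one_padic :: "'a padic" is 1 .
lift_definition plus_padic :: "'a padic \<Rightarrow> 'a padic \<Rightarrow> 'a padic" is "(+)"
  unfolding add_diff_add by (rule null_seq_add)
lift_definition uminus_padic :: "'a padic \<Rightarrow> 'a padic" is uminus
  unfolding minus_diff_minus by (rule null_seq_minus)
lift_definition times_padic :: "'a padic \<Rightarrow> 'a padic \<Rightarrow> 'a padic" is "(*)"
  unfolding mult_diff_mult by (metis null_seq_add null_seq_mult mult.commute)
lift_definition inverse_padic :: "'a padic \<Rightarrow> 'a padic" is inverse_seq
proof -
  fix X Y :: "'a padic_seq" assume XY: "null_seq (X - Y)"
  show "null_seq (inverse_seq X - inverse_seq Y)"
  proof (cases "null_seq X")
    case True
    thus ?thesis using null_seq_cong [OF XY] by (simp add: inverse_seq_null)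
  next
    case False
    thus ?thesis using null_seq_cong [OF XY] XY by (intro null_seq_diff_inverse) auto
  qed
qed

definition minus_padic :: "'a padic \<Rightarrow> 'a padic \<Rightarrow> 'a padic" where "minus_padic x y = x + - y"
definition divide_padic :: "'a padic \<Rightarrow> 'a padic \<Rightarrow> 'a padic" where "divide_padic x y = x * inverse y"

instance
proof
  fix a b c :: "'a padic"
  show "a + b + c = a + (b + c)" by transfer (simp add: algebra_simps)
  show "a + b = b + a" by transfer (simp add: algebra_simps)
  show "0 + a = a" by transfer simp
  show "- a + a = 0" by transfer simp
  show "a - b = a + - b" by (simp add: minus_padic_def)
  show "a * b * c = a * (b * c)" by transfer (simp add: algebra_simps)
  show "a * b = b * a" by transfer (simp add: algebra_simps)
  show "1 * a = a" by transfer simp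
  show "(a + b) * c = a * c + b * c" by transfer (simp add: algebra_simps)
  have "\<not> null_seq (const_seq (- 1) :: 'a padic_seq)" by simp
  moreover have "const_seq (- 1) = (0 - 1 :: 'a padic_seq)" by transfer simp
  ultimately have "\<not> null_seq (0 - 1 :: 'a padic_seq)" by simp
  thus "(0::'a padic) \<noteq> 1" by transfer
  show "a \<noteq> 0 \<Longrightarrow> inverse a * a = 1" by transfer (simp add: null_seq_inverse_mult)
  show "a div b = a * inverse b" by (simp add: divide_padic_def)
  show "inverse (0::'a padic) = 0" by transfer (simp add: inverse_seq_null)
qed

end

lemma of_nat_padic: "of_nat n = (abs_padic (const_seq (of_nat n)) :: 'p::prime_card padic)"
proof (induction n)
  case 0
  have "const_seq 0 = (0 :: 'p padic_seq)" by transfer simp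
  thus ?case by (simp add: zero_padic_def)
next
  case (Suc n)
  have "const_seq (of_nat (Suc n)) = (1 + const_seq (of_nat n) :: 'p padic_seq)"
    by transfer simp
  thus ?case using Suc by (simp add: one_padic_def plus_padic.abs_eq)
qed

instance padic :: (prime_card) field_char_0
proof
  show "inj (of_nat :: nat \<Rightarrow> 'a padic)"
  proof (rule injI)
    fix m n assume "of_nat m = (of_nat n :: 'a padic)"
    hence "null_seq (const_seq (of_nat m) - const_seq (of_nat n) :: 'a padic_seq)"
      by (simp add: of_nat_padic padic.abs_eq_iff)
    moreover have "const_seq (of_nat m) - const_seq (of_nat n) =
        (const_seq (of_nat m - of_nat n) :: 'a padic_seq)" by transfer simp
    ultimately show "m = n" by simp
  qed
qed

text \<open>The metric is that of the p-adic absolute value, extended to the completion by continuity.\<close>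

instantiation padic :: (prime_card) metric_space
begin

lift_definition dist_padic :: "'a padic \<Rightarrow> 'a padic \<Rightarrow> real" is "\<lambda>X Y. abs_seq (X - Y)"
proof (rule abs_seq_cong)
  fix X X' Y Y' :: "'a padic_seq"
  assume "null_seq (X - X')" "null_seq (Y - Y')"
  hence "null_seq ((X - X') + - (Y - Y'))" by (intro null_seq_add null_seq_minus)
  thus "null_seq (X - Y - (X' - Y'))" by (simp add: algebra_simps)
qed

definition uniformity_padic :: "('a padic \<times> 'a padic) filter" where
  "uniformity_padic = (INF e\<in>{0 <..}. principal {(x, y). dist x y < e})"

definition open_padic :: "'a padic set \<Rightarrow> bool" where
  "open_padic U \<longleftrightarrow> (\<forall>x\<in>U. \<forall>\<^sub>F (x', y) in uniformity. x' = x \<longrightarrow> y \<in> U)"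

instance
proof
  fix x y z :: "'a padic"
  show "dist x y = 0 \<longleftrightarrow> x = y" by transfer (rule abs_seq_eq_0_iff)
  show "dist x y \<le> dist x z + dist y z"
  proof transfer
    fix X Y Z :: "'a padic_seq"
    show "abs_seq (X - Y) \<le> abs_seq (X - Z) + abs_seq (Y - Z)"
      using abs_seq_triangle [of "X - Z" "- (Y - Z)"] unfolding abs_seq_minus by simp
  qed
qed (rule uniformity_padic_def open_padic_def)+

end

lemma dist_of_rat_padic:
  "dist (of_rat x) (of_rat y :: 'p::prime_card padic) = padic_abs CARD('p) (x - y)"
proof -
  have const_mult: "const_seq (a * b) = (const_seq a * const_seq b :: 'p padic_seq)"
    and const_diff: "const_seq (a - b) = (const_seq a - const_seq b :: 'p padic_seq)" for a b
    by (transfer; simp)+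
  have hom: "abs_padic (const_seq (a * b)) = (abs_padic (const_seq a) * abs_padic (const_seq b) :: 'p padic)"
    for a b by (simp add: const_mult times_padic.abs_eq)
  have of_int: "abs_padic (const_seq (of_int a)) = (of_int a :: 'p padic)" for a
  proof (cases a rule: int_cases2)
    case (nonneg n)
    thus ?thesis by (simp add: of_nat_padic)
  next
    case (nonpos n)
    have "const_seq (- of_nat n) = (- const_seq (of_nat n) :: 'p padic_seq)" by transfer simp
    thus ?thesis using nonpos by (simp add: of_nat_padic uminus_padic.abs_eq)
  qed
  have of_rat: "of_rat q = (abs_padic (const_seq q) :: 'p padic)" for q
  proof -
    obtain a b where b: "b \<noteq> 0" and q: "q = of_int a / of_int b" by (rule rat_frac_cases)
    have "abs_padic (const_seq q) * of_int b = (of_int a :: 'p padic)"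
      unfolding q of_int [symmetric] hom [symmetric] using b by simp
    hence "abs_padic (const_seq q) = (of_int a / of_int b :: 'p padic)"
      using b by (simp add: nonzero_eq_divide_eq)
    thus ?thesis by (simp add: q of_rat_divide)
  qed
  have "abs_seq (const_seq (x - y) :: 'p padic_seq) = padic_abs CARD('p) (x - y)"
    by transfer simp
  thus ?thesis unfolding of_rat dist_padic.abs_eq const_diff .
qed

section \<open>The group\<close>

definition Z_inv :: "nat \<Rightarrow> rat set" where
  "Z_inv p = {of_int a / of_nat p ^ k | a k. True}"

definition UT :: "nat \<Rightarrow> rat set \<Rightarrow> rat mat set" where
  "UT n R = {A \<in> carrier_mat n n.
     upper_triangular A \<and> (\<forall>i<n. A $$ (i, i) = 1) \<and> elements_mat A \<subseteq> R}"

definition scaling_mat :: "nat \<Rightarrow> nat \<Rightarrow> int vec \<Rightarrow> 'a::field_char_0 mat" where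
  "scaling_mat p n x = mat_diag n (\<lambda>i. of_nat p powi (x $ i))"

lemma scaling_mat_inverse:
  assumes "p \<noteq> 0" "x \<in> carrier_vec n"
  shows "scaling_mat p n x * scaling_mat p n (- x) = (1\<^sub>m n :: 'a::field_char_0 mat)"
  unfolding scaling_mat_def mat_diag_diag using assms
  by (intro eq_matI) (auto simp: mat_diag_def simp flip: power_int_add)

text \<open>In view of \<open>scaling_mat_inverse\<close>, the matrix \<open>X\<inverse>\<close> is written \<open>scaling_mat p n (- x)\<close>.\<close>

definition ZUT :: "nat \<Rightarrow> nat \<Rightarrow> (int vec \<times> rat mat) monoid" where
  "ZUT p n = \<lparr>
     carrier = carrier_vec n \<times> UT n (Z_inv p),
     mult = (\<lambda>(x, f) (y, g). (x + y, f * (scaling_mat p n x * g * scaling_mat p n (- x)))),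
     one = (0\<^sub>v n, 1\<^sub>m n)\<rparr>"

definition word_length :: "('g, 'm) monoid_scheme \<Rightarrow> 'g set \<Rightarrow> 'g \<Rightarrow> nat" where
  "word_length G S g = (LEAST k. \<exists>ws. length ws = k \<and> set ws \<subseteq> S \<union> m_inv G ` S \<and>
     foldr (mult G) ws (one G) = g)"

section \<open>Random walks and boundaries\<close>

definition supp :: "'g measure \<Rightarrow> 'g set" where
  "supp \<mu> = {g \<in> space \<mu>. emeasure \<mu> {g} \<noteq> 0}"

text \<open>
  A point of the path space is the sequence of increments of the walk: these are independent with
  common law \<open>\<mu>\<close>. The first increment has index \<open>0\<close>.
\<close>

definition path_space :: "'g measure \<Rightarrow> (nat \<Rightarrow> 'g) measure" where
  "path_space \<mu> = (\<Pi>\<^sub>M k\<in>UNIV. \<mu>)"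

primrec walk :: "('g, 'm) monoid_scheme \<Rightarrow> (nat \<Rightarrow> 'g) \<Rightarrow> nat \<Rightarrow> 'g" where
  "walk G \<omega> 0 = \<one>\<^bsub>G\<^esub>"
| "walk G \<omega> (Suc m) = walk G \<omega> m \<otimes>\<^bsub>G\<^esub> \<omega> m"

definition borel_of :: "'b topology \<Rightarrow> 'b measure" where
  "borel_of T = sigma (topspace T) {U. openin T U}"

definition G_space :: "('g, 'm) monoid_scheme \<Rightarrow> 'b topology \<Rightarrow> ('g \<Rightarrow> 'b \<Rightarrow> 'b) \<Rightarrow> bool" where
  "G_space G T act \<longleftrightarrow> group_action G (topspace T) act \<and>
     continuous_map (prod_topology (discrete_topology (carrier G)) T) T (\<lambda>(g, b). act g b)"

definition convolution :: "'g measure \<Rightarrow> ('g \<Rightarrow> 'b \<Rightarrow> 'b) \<Rightarrow> 'b measure \<Rightarrow> 'b measure" where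
  "convolution \<mu> act \<nu> = distr (\<mu> \<Otimes>\<^sub>M \<nu>) \<nu> (\<lambda>(g, b). act g b)"

definition stationary :: "'g measure \<Rightarrow> ('g \<Rightarrow> 'b \<Rightarrow> 'b) \<Rightarrow> 'b measure \<Rightarrow> bool" where
  "stationary \<mu> act \<nu> \<longleftrightarrow> convolution \<mu> act \<nu> = \<nu>"

definition weak_star_limit :: "'b topology \<Rightarrow> (nat \<Rightarrow> 'b measure) \<Rightarrow> 'b measure \<Rightarrow> bool" where
  "weak_star_limit T N L \<longleftrightarrow>
     (\<forall>h :: 'b \<Rightarrow> real. continuous_map T euclideanreal h \<and> bounded (h ` topspace T) \<longrightarrow>
        (\<lambda>m. \<integral>b. h b \<partial>N m) \<longlonglongrightarrow> (\<integral>b. h b \<partial>L))"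

definition is_boundary ::
  "('g, 'm) monoid_scheme \<Rightarrow> 'g measure \<Rightarrow> 'b topology \<Rightarrow> ('g \<Rightarrow> 'b \<Rightarrow> 'b) \<Rightarrow>
   'b measure \<Rightarrow> ((nat \<Rightarrow> 'g) \<Rightarrow> 'b) \<Rightarrow> bool" where
  "is_boundary G \<mu> T act \<nu> bnd \<longleftrightarrow>
     second_countable T \<and> G_space G T act \<and>
     prob_space \<nu> \<and> sets \<nu> = sets (borel_of T) \<and> stationary \<mu> act \<nu> \<and>
     bnd \<in> path_space \<mu> \<rightarrow>\<^sub>M borel_of T \<and>
     (AE \<omega> in path_space \<mu>.
        weak_star_limit T (\<lambda>m. distr \<nu> (borel_of T) (act (walk G \<omega> m)))
          (return (borel_of T) (bnd \<omega>)))"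

section \<open>Displacement\<close>

definition coordinate_law :: "(int vec \<times> rat mat) measure \<Rightarrow> nat \<Rightarrow> int measure" where
  "coordinate_law \<mu> i = distr \<mu> (count_space UNIV) (\<lambda>(x, f). x $ i)"

definition m1 :: "int measure \<Rightarrow> real" where
  "m1 N = (\<integral>z. of_int z \<partial>N)"

text \<open>Only the entries with \<open>i < j\<close> are part of the displacement matrix.\<close>

definition displacement :: "(int vec \<times> rat mat) measure \<Rightarrow> nat \<Rightarrow> nat \<Rightarrow> real" where
  "displacement \<mu> i j = m1 (coordinate_law \<mu> i) - m1 (coordinate_law \<mu> j)"

definition nonzero_displacement :: "nat \<Rightarrow> (nat \<Rightarrow> nat \<Rightarrow> real) \<Rightarrow> bool" where
  "nonzero_displacement n D \<longleftrightarrow> (\<forall>i j. i < j \<and> j < n \<longrightarrow> D i j \<noteq> 0)"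

definition column_consistent :: "nat \<Rightarrow> (nat \<Rightarrow> nat \<Rightarrow> real) \<Rightarrow> bool" where
  "column_consistent n D \<longleftrightarrow> (\<forall>j<n. \<forall>i<j. \<forall>i'<j. sgn (D i j) = sgn (D i' j))"

section \<open>The space of matrices with real and p-adic entries\<close>

text \<open>
  The entries above the diagonal are tagged with the field they belong to; the constructor
  \<open>Rat_Entry\<close> serves for the entries \<open>0\<close> and \<open>1\<close> of a unitriangular matrix, which lie in both fields.
\<close>

datatype (dead 'p::prime_card) entry =
  Rat_Entry rat | Real_Entry real | Padic_Entry "'p padic"

instantiation entry :: (prime_card) topological_space
begin

text \<open>The topology of the disjoint union of the discrete rationals, the reals and the p-adic numbers.\<close>

definition open_entry :: "'a entry set \<Rightarrow> bool" where
  "open_entry U \<longleftrightarrow> open (Real_Entry -` U) \<and> open (Padic_Entry -` U)"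

instance
  by standard (auto simp: open_entry_def vimage_Union)

end

fun real_of_entry :: "'p::prime_card entry \<Rightarrow> real" where
  "real_of_entry (Rat_Entry q) = of_rat q"
| "real_of_entry (Real_Entry r) = r"
| "real_of_entry (Padic_Entry a) = 0"

fun padic_of_entry :: "'p::prime_card entry \<Rightarrow> 'p padic" where
  "padic_of_entry (Rat_Entry q) = of_rat q"
| "padic_of_entry (Real_Entry r) = 0"
| "padic_of_entry (Padic_Entry a) = a"

text \<open>
  Matrices are functions of two indices, with \<open>0\<close> outside the \<open>n \<times> n\<close> block, so that the subspace
  topology from the function space is the product topology.
\<close>

definition mixed_UT :: "nat \<Rightarrow> (nat \<Rightarrow> nat \<Rightarrow> real) \<Rightarrow> (nat \<Rightarrow> nat \<Rightarrow> 'p::prime_card entry) set" where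
  "mixed_UT n D = {M. \<forall>i j.
     if i < j \<and> j < n
     then (D i j < 0 \<longrightarrow> M i j \<in> range Real_Entry) \<and> (D i j > 0 \<longrightarrow> M i j \<in> range Padic_Entry)
     else M i j = Rat_Entry (if i = j \<and> j < n then 1 else 0)}"

text \<open>
  The \<open>(i, j)\<close> entry of \<open>f X b X\<inverse>\<close> is computed in the field attached to \<open>(i, j)\<close>. It involves only
  the entries \<open>b k j\<close> with \<open>k \<le> j\<close>; when \<open>D\<close> is column consistent these lie in the same field, and
  the value \<open>0\<close> given to entries of the other field plays no role.
\<close>

definition mixed_act ::
  "nat \<Rightarrow> nat \<Rightarrow> (nat \<Rightarrow> nat \<Rightarrow> real) \<Rightarrow> int vec \<times> rat mat \<Rightarrow>
   (nat \<Rightarrow> nat \<Rightarrow> 'p::prime_card entry) \<Rightarrow> (nat \<Rightarrow> nat \<Rightarrow> 'p entry)" where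
  "mixed_act p n D = (\<lambda>(x, f). \<lambda>b \<in> mixed_UT n D. \<lambda>i j.
     if i < j \<and> j < n then
       if D i j < 0
       then Real_Entry ((map_mat of_rat f * (scaling_mat p n x *
              Matrix.mat n n (\<lambda>(k, l). real_of_entry (b k l)) * scaling_mat p n (- x))) $$ (i, j))
       else Padic_Entry ((map_mat of_rat f * (scaling_mat p n x *
              Matrix.mat n n (\<lambda>(k, l). padic_of_entry (b k l)) * scaling_mat p n (- x))) $$ (i, j))
     else b i j)"

text \<open>The limit \<open>\<phi>\<^sup>\<infinity>\<close>; on the null set where an entry diverges, \<open>lim\<close> makes it a fixed constant.\<close>

definition walk_limit ::
  "nat \<Rightarrow> nat \<Rightarrow> (nat \<Rightarrow> nat \<Rightarrow> real) \<Rightarrow> (nat \<Rightarrow> int vec \<times> rat mat) \<Rightarrow>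
   (nat \<Rightarrow> nat \<Rightarrow> 'p::prime_card entry)" where
  "walk_limit p n D \<omega> = (\<lambda>i j.
     if i < j \<and> j < n then
       if D i j < 0
       then Real_Entry (lim (\<lambda>m. of_rat (snd (walk (ZUT p n) \<omega> m) $$ (i, j))))
       else Padic_Entry (lim (\<lambda>m. of_rat (snd (walk (ZUT p n) \<omega> m) $$ (i, j))))
     else Rat_Entry (if i = j \<and> j < n then 1 else 0))"

end

(*
In the field of column j the diagonal matrix X acts on the entry (k, j) by the factor
p^(x_k - x_j), whose absolute value has negative mean logarithm for every k < j; column consistency
is what makes this field the same for all k < j. The walk is a product of the triangular matrices
f X, and by the law of large numbers the entries of such a product grow no faster than its diagonal
entries, up to subexponential factors. Hence p^(y_k - y_j) phi_ik tends to 0 exponentially fast for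
k < j. This gives both the convergence of phi_ij, whose increments are combinations of these
numbers, and R_m b -> phi^(infinity) for every point b, so that R_m nu converges by
dominated convergence. Stationarity follows from phi^(infinity)(g w) = g phi^(infinity)(w).

Only a one-sided law of large numbers is needed: for independent variables with negative mean the
partial sums are almost surely bounded above.
*)
theory Submission
  imports Defs
begin

text \<open>For k < j the column k may belong to the other field, and in the field of column j the
  numbers phi_ik then need not converge or even stay bounded. What survives is the exponential rate:
  in absolute value, phi_ik p^(y_k) grows no faster than the largest p^(y_l) with l < j, and this is
  still beaten by p^(y_j). So growth rates, and not limits, are carried through the induction over
  k.

  All of this concerns absolute values of rational numbers. Probability is therefore confined to
  three almost sure facts about a path: its increments lie in the group, its coordinates have linear
  drift, and the entries of its increments are subexponential. The last one comes from the first
  moment, because entries are at most exponential in the word length. On such a path every estimate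
  is deterministic and is proved once for an arbitrary absolute value; the reals and the p-adic
  numbers differ only in the sign of ln |p|.\<close>

unbundle no vec_syntax

section \<open>Valued fields\<close>

text \<open>The common ground of the reals and the p-adic numbers, with \<open>dist x 0\<close> as
  multiplicative absolute value. Completeness is asked of rational sequences, because the entries of
  the walk are rational and the p-adic construction supplies precisely such limits.\<close>

class valued_field = field_char_0 + metric_space +
  assumes dist_add_right: "dist (x + z) (y + z) = dist x y"
    and dist_mult_right: "dist (x * z) (y * z) = dist x y * dist z 0"
    and Cauchy_of_rat_convergent:
      "Cauchy (\<lambda>n. of_rat (q n)) \<Longrightarrow> convergent (\<lambda>n. of_rat (q n))"
begin

lemma dist_diff_0: "dist (x - y) 0 = dist x y"
  using dist_add_right [of "x - y" y 0] by simp

lemma dist_mult_0: "dist (x * y) 0 = dist x 0 * dist y 0"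
  using dist_mult_right [of x y 0] by simp

lemma dist_1_0: "dist 1 0 = 1"
proof -
  have "dist 1 0 * dist 1 0 = dist 1 0" using dist_mult_0 [of 1 1] by simp
  thus ?thesis by simp
qed

lemma dist_add_add: "dist (a + b) (c + d) \<le> dist a c + dist b d"
  using dist_triangle [of "a + b" "c + d" "c + b"] dist_add_right [of a b c]
    dist_add_right [of b c d] by (simp add: add.commute)

lemma dist_add_0: "dist (a + b) 0 \<le> dist a 0 + dist b 0"
  using dist_add_add [of a b 0 0] by simp

\<comment> \<open>This opens up \<open>tendsto_add\<close> and \<open>tendsto_sum\<close>; products
  occur in limits with one constant factor, as in \<open>tendsto_mult_const\<close>.\<close>
subclass topological_comm_monoid_add
proof
  fix a b :: 'a
  show "((\<lambda>x. fst x + snd x) \<longlongrightarrow> a + b) (nhds a \<times>\<^sub>F nhds b)"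
  proof (rule tendstoI)
    fix e :: real assume e: "e > 0"
    have "\<forall>\<^sub>F x in nhds a \<times>\<^sub>F nhds b. dist (fst x) a < e / 2 \<and> dist (snd x) b < e / 2"
      using e by (intro eventually_prodI) (auto simp: eventually_nhds_metric intro: exI [of _ "e / 2"])
    thus "\<forall>\<^sub>F x in nhds a \<times>\<^sub>F nhds b. dist (fst x + snd x) (a + b) < e"
    proof eventually_elim
      case (elim x)
      thus ?case using dist_add_add [of "fst x" "snd x" a b] by linarith
    qed
  qed
qed

end

lemma tendsto_mult_const:
  fixes f :: "'b \<Rightarrow> 'a::valued_field"
  assumes "(f \<longlongrightarrow> l) F"
  shows "((\<lambda>x. c * f x) \<longlongrightarrow> c * l) F"
proof -
  have "((\<lambda>x. dist (f x) l * dist c 0) \<longlongrightarrow> 0) F"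
    by (intro tendsto_mult_left_zero tendsto_dist_iff [THEN iffD1] assms)
  hence "((\<lambda>x. dist (f x * c) (l * c)) \<longlongrightarrow> 0) F"
    by (simp only: dist_mult_right)
  thus ?thesis
    unfolding mult.commute [of c] by (rule tendsto_dist_iff [THEN iffD2])
qed

section \<open>The reals and the p-adic numbers as valued fields\<close>

instance real :: valued_field
proof
  fix x y z :: real
  show "dist (x + z) (y + z) = dist x y" by (simp add: dist_real_def)
  show "dist (x * z) (y * z) = dist x y * dist z 0"
    unfolding dist_real_def diff_zero left_diff_distrib [symmetric] by (rule abs_mult)
next
  fix q :: "nat \<Rightarrow> rat"
  show "Cauchy (\<lambda>n. of_rat (q n) :: real) \<Longrightarrow> convergent (\<lambda>n. of_rat (q n) :: real)"
    by (rule Cauchy_convergent)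
qed

lemma abs_seq_mult: "abs_seq (X * Y) = abs_seq X * abs_seq (Y :: 'p::prime_card padic_seq)"
proof transfer
  fix X Y assume X: "padic_cauchy CARD('p) X" and Y: "padic_cauchy CARD('p) Y"
  show "lim (\<lambda>n. padic_abs CARD('p) (X n * Y n)) =
      lim (\<lambda>n. padic_abs CARD('p) (X n)) * lim (\<lambda>n. padic_abs CARD('p) (Y n))"
    unfolding padic_abs_mult [OF prime_card]
    by (intro limI tendsto_mult abs_seq_LIMSEQ X Y)
qed

text \<open>Gives access to distances from a rational to an arbitrary class, whereas
  \<open>dist_of_rat_padic\<close> covers pairs of rationals.\<close>

lemma of_rat_padic: "of_rat q = (abs_padic (const_seq q) :: 'p::prime_card padic)"
proof -
  have mult: "abs_padic (const_seq (a * b)) = (abs_padic (const_seq a) * abs_padic (const_seq b) :: 'p padic)"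
    for a b
  proof -
    have "const_seq (a * b) = (const_seq a * const_seq b :: 'p padic_seq)" by transfer simp
    thus ?thesis by (simp add: times_padic.abs_eq)
  qed
  have minus: "abs_padic (const_seq (- a)) = (- abs_padic (const_seq a) :: 'p padic)" for a
  proof -
    have "const_seq (- a) = (- const_seq a :: 'p padic_seq)" by transfer simp
    thus ?thesis by (simp add: uminus_padic.abs_eq)
  qed
  have int: "abs_padic (const_seq (of_int a)) = (of_int a :: 'p padic)" for a
    by (cases a rule: int_cases2) (simp_all add: of_nat_padic minus)
  obtain a b where b: "b \<noteq> 0" and q: "q = of_int a / of_int b" by (rule rat_frac_cases)
  have "abs_padic (const_seq q) * of_int b = (of_int a :: 'p padic)"
    unfolding q int [symmetric] mult [symmetric] using b by simp
  hence "abs_padic (const_seq q) = (of_int a / of_int b :: 'p padic)"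
    using b by (simp only: nonzero_eq_divide_eq of_int_eq_0_iff not_False_eq_True)
  also have "\<dots> = of_rat q" by (simp add: q of_rat_divide)
  finally show ?thesis ..
qed

text \<open>The distance from \<open>X m\<close> to the class of \<open>X\<close> is the limit over
  n of |X m - X n|, which is small once m is past the Cauchy index. Both the completeness for
  rational sequences and the density of the rationals follow from this.\<close>

lemma LIMSEQ_abs_padic:
  assumes X: "padic_cauchy CARD('p::prime_card) X"
  shows "(\<lambda>n. of_rat (X n)) \<longlonglongrightarrow> (abs_padic (Abs_padic_seq X) :: 'p padic)"
proof (rule metric_LIMSEQ_I)
  fix r :: real assume r: "r > 0"
  \<comment> \<open>Half of r, because the strict bound becomes a weak one in the limit.\<close>
  obtain k where k: "\<And>m n. m \<ge> k \<Longrightarrow> n \<ge> k \<Longrightarrow> padic_abs CARD('p) (X m - X n) < r / 2"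
    using padic_cauchyD [OF X, of "r / 2"] r by auto
  have eq: "dist (of_rat (X m)) (abs_padic (Abs_padic_seq X) :: 'p padic) =
      lim (\<lambda>n. padic_abs CARD('p) (X m - X n))" for m
    unfolding of_rat_padic dist_padic.abs_eq abs_seq.rep_eq minus_padic_seq.rep_eq
      const_seq.rep_eq using X by (simp add: Abs_padic_seq_inverse)
  have "dist (of_rat (X m)) (abs_padic (Abs_padic_seq X) :: 'p padic) < r" if m: "m \<ge> k" for m
  proof -
    have "padic_cauchy CARD('p) (\<lambda>n. X m - X n)"
      using padic_cauchy_add [OF prime_card padic_cauchy_const padic_cauchy_minus [OF X]] by simp
    hence "(\<lambda>n. padic_abs CARD('p) (X m - X n)) \<longlonglongrightarrow>
        lim (\<lambda>n. padic_abs CARD('p) (X m - X n))"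
      by (rule abs_seq_LIMSEQ)
    hence "lim (\<lambda>n. padic_abs CARD('p) (X m - X n)) \<le> r / 2"
      by (rule LIMSEQ_le_const2) (use k m in \<open>force intro: less_imp_le\<close>)
    thus ?thesis using r eq by simp
  qed
  thus "\<exists>k. \<forall>m\<ge>k. dist (of_rat (X m)) (abs_padic (Abs_padic_seq X) :: 'p padic) < r" by blast
qed

instance padic :: (prime_card) valued_field
proof
  fix x y z :: "'a padic"
  show "dist (x + z) (y + z) = dist x y"
    by transfer (simp add: algebra_simps)
  show "dist (x * z) (y * z) = dist x y * dist z 0"
    by transfer (simp add: abs_seq_mult flip: left_diff_distrib)
next
  fix q :: "nat \<Rightarrow> rat"
  assume "Cauchy (\<lambda>n. of_rat (q n) :: 'a padic)"
  hence "padic_cauchy CARD('a) q"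
    unfolding Cauchy_def padic_cauchy_def dist_of_rat_padic by simp
  thus "convergent (\<lambda>n. of_rat (q n) :: 'a padic)"
    using LIMSEQ_abs_padic by (auto simp: convergent_def)
qed

lemma of_rat_dense_padic:
  assumes "e > 0"
  shows "\<exists>q. dist (of_rat q) (x :: 'p::prime_card padic) < e"
proof -
  have "\<exists>s. x = abs_padic s" by (induction x rule: padic.abs_induct) blast
  then obtain s where x: "x = abs_padic s" ..
  have "padic_cauchy CARD('p) (Rep_padic_seq s)" using Rep_padic_seq [of s] by simp
  from LIMSEQ_abs_padic [OF this] have "(\<lambda>n. of_rat (Rep_padic_seq s n)) \<longlonglongrightarrow> x"
    by (simp add: Rep_padic_seq_inverse x)
  from metric_LIMSEQ_D [OF this assms] show ?thesis by blast
qed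

instance padic :: (prime_card) second_countable_topology
proof
  define B :: "'a padic set set" where
    "B = (\<lambda>(q, k). ball (of_rat q) (1 / real (Suc k))) ` UNIV"
  have "topological_basis B"
  proof (rule topological_basisI)
    show "\<And>U. U \<in> B \<Longrightarrow> open U" by (auto simp: B_def)
  next
    fix U and x :: "'a padic" assume "open U" "x \<in> U"
    then obtain e where e: "e > 0" "ball x e \<subseteq> U" by (auto simp: open_contains_ball)
    obtain k where k: "1 / real (Suc k) < e / 2" using e nat_approx_posE [of "e / 2"] by auto
    obtain q where q: "dist (of_rat q) x < 1 / real (Suc k)"
      using of_rat_dense_padic [of "1 / real (Suc k)" x] by auto
    have "ball (of_rat q) (1 / real (Suc k)) \<subseteq> ball x e"
    proof
      fix y :: "'a padic" assume "y \<in> ball (of_rat q) (1 / real (Suc k))"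
      thus "y \<in> ball x e"
        using dist_triangle [of x y "of_rat q"] q k by (simp add: dist_commute)
    qed
    thus "\<exists>V\<in>B. x \<in> V \<and> V \<subseteq> U"
      using q e by (intro bexI [of _ "ball (of_rat q) (1 / real (Suc k))"]) (auto simp: B_def)
  qed
  moreover have "countable B" unfolding B_def by (intro countable_image) simp
  ultimately show "\<exists>B :: 'a padic set set. countable B \<and> open = generate_topology B"
    using topological_basis_imp_subbasis by blast
qed

section \<open>Topology of the tagged entries and measurability of limits\<close>

lemma continuous_on_Real_Entry [continuous_intros]: "continuous_on A Real_Entry"
  by (rule continuous_on_subset [OF _ subset_UNIV])
    (auto simp: continuous_on_open_vimage open_entry_def)

lemma continuous_on_Padic_Entry [continuous_intros]: "continuous_on A Padic_Entry"
  by (rule continuous_on_subset [OF _ subset_UNIV])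
    (auto simp: continuous_on_open_vimage open_entry_def)

text \<open>Openness is tested on the real and the p-adic component, where the map is the identity
  and a constant; the rational component is discrete.\<close>

lemma continuous_on_real_of_entry: "continuous_on A real_of_entry"
  by (rule continuous_on_subset [OF _ subset_UNIV])
    (auto simp: continuous_on_open_vimage open_entry_def vimage_def)

lemma continuous_on_padic_of_entry: "continuous_on A padic_of_entry"
  by (rule continuous_on_subset [OF _ subset_UNIV])
    (auto simp: continuous_on_open_vimage open_entry_def vimage_def)

instance entry :: (prime_card) second_countable_topology
proof
  obtain R :: "real set set" where R: "countable R" "topological_basis R"
    using ex_countable_basis by blast
  obtain P :: "'a padic set set" where P: "countable P" "topological_basis P"
    using ex_countable_basis by blast
  define B :: "'a entry set set" where
    "B = range (\<lambda>q. {Rat_Entry q}) \<union> (image Real_Entry) ` R \<union> (image Padic_Entry) ` P"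
  have vim: "Real_Entry -` Real_Entry ` U = U" "Padic_Entry -` Real_Entry ` U = {}"
    "Padic_Entry -` Padic_Entry ` V = V" "Real_Entry -` Padic_Entry ` V = {}"
    "Real_Entry -` {Rat_Entry q} = {}" "Padic_Entry -` {Rat_Entry q} = {}"
    for U and V :: "'a padic set" and q by auto
  have "topological_basis B"
  proof (rule topological_basisI)
    show "\<And>U. U \<in> B \<Longrightarrow> open U"
      using topological_basis_open [OF R(2)] topological_basis_open [OF P(2)]
      by (auto simp: B_def open_entry_def vim)
  next
    fix U and x :: "'a entry" assume U: "open U" "x \<in> U"
    show "\<exists>V\<in>B. x \<in> V \<and> V \<subseteq> U"
    proof (cases x)
      case (Rat_Entry q)
      thus ?thesis using U by (intro bexI [of _ "{Rat_Entry q}"]) (auto simp: B_def)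
    next
      case (Real_Entry r)
      then obtain V where "V \<in> R" "r \<in> V" "V \<subseteq> Real_Entry -` U"
        using topological_basisE [OF R(2), of "Real_Entry -` U" r] U by (auto simp: open_entry_def)
      thus ?thesis using Real_Entry by (intro bexI [of _ "Real_Entry ` V"]) (auto simp: B_def)
    next
      case (Padic_Entry a)
      then obtain V where "V \<in> P" "a \<in> V" "V \<subseteq> Padic_Entry -` U"
        using topological_basisE [OF P(2), of "Padic_Entry -` U" a] U by (auto simp: open_entry_def)
      thus ?thesis using Padic_Entry by (intro bexI [of _ "Padic_Entry ` V"]) (auto simp: B_def)
    qed
  qed
  moreover have "countable B" using R P by (auto simp: B_def)
  ultimately show "\<exists>B :: 'a entry set set. countable B \<and> open = generate_topology B"
    using topological_basis_imp_subbasis by blast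
qed

text \<open>For rational sequences convergence is the Cauchy property, which is a measurable event.
  Off this event \<open>lim\<close> is the fixed value \<open>THE x. False\<close>, so the limit is
  measurable on the whole space.\<close>

lemma borel_measurable_lim_of_rat:
  fixes q :: "nat \<Rightarrow> 'b \<Rightarrow> rat"
  assumes [measurable]: "\<And>i. q i \<in> M \<rightarrow>\<^sub>M count_space UNIV"
  shows "(\<lambda>x. lim (\<lambda>i. of_rat (q i x)) :: 'a::{valued_field, second_countable_topology})
    \<in> borel_measurable M"
proof -
  define f :: "nat \<Rightarrow> 'b \<Rightarrow> 'a" where "f i x = of_rat (q i x)" for i x
  have [measurable]: "f i \<in> borel_measurable M" for i
    unfolding f_def by measurable
  define u where "u x = (if Cauchy (\<lambda>i. f i x) then lim (\<lambda>i. f i x) else 0)" for x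
  have "u \<in> borel_measurable M"
  proof (rule borel_measurable_LIMSEQ_metric)
    show "(\<lambda>x. if Cauchy (\<lambda>i. f i x) then f i x else 0) \<in> borel_measurable M" for i
      by measurable
    fix x
    have "convergent (\<lambda>i. f i x)" if "Cauchy (\<lambda>i. f i x)"
      using Cauchy_of_rat_convergent that unfolding f_def .
    thus "(\<lambda>i. if Cauchy (\<lambda>i. f i x) then f i x else 0) \<longlonglongrightarrow> u x"
      by (auto simp: u_def convergent_LIMSEQ_iff)
  qed
  moreover have "lim (\<lambda>i. f i x) = (if Cauchy (\<lambda>i. f i x) then u x else (THE x. False))" for x
  proof (cases "Cauchy (\<lambda>i. f i x)")
    case False
    hence "\<not> (\<lambda>i. f i x) \<longlonglongrightarrow> l" for l using LIMSEQ_imp_Cauchy by blast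
    thus ?thesis using False by (simp add: lim_def)
  qed (simp add: u_def)
  ultimately show ?thesis unfolding f_def [symmetric] by simp
qed

section \<open>The group\<close>

lemma Z_inv_of_int: "of_int a \<in> Z_inv p"
  unfolding Z_inv_def by (rule CollectI, rule exI [of _ a], rule exI [of _ 0]) simp

lemma Z_inv_0 [simp]: "0 \<in> Z_inv p" and Z_inv_1 [simp]: "1 \<in> Z_inv p"
  using Z_inv_of_int [of 0] Z_inv_of_int [of 1] by simp_all

lemma Z_inv_uminus: "a \<in> Z_inv p \<Longrightarrow> - a \<in> Z_inv p"
  unfolding Z_inv_def by (auto, metis of_int_minus minus_divide_left)

lemma Z_inv_add:
  assumes "p \<noteq> 0" "a \<in> Z_inv p" "b \<in> Z_inv p" shows "a + b \<in> Z_inv p"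
proof -
  obtain k l c d where a: "a = of_int c / of_nat p ^ k" and b: "b = of_int d / of_nat p ^ l"
    using assms unfolding Z_inv_def by blast
  have "a + b = of_int (c * int p ^ l + d * int p ^ k) / of_nat p ^ (k + l)"
    using assms(1) by (simp add: a b field_simps power_add)
  thus ?thesis unfolding Z_inv_def by blast
qed

lemma Z_inv_mult:
  assumes "a \<in> Z_inv p" "b \<in> Z_inv p" shows "a * b \<in> Z_inv p"
proof -
  obtain k l c d where a: "a = of_int c / of_nat p ^ k" and b: "b = of_int d / of_nat p ^ l"
    using assms unfolding Z_inv_def by blast
  have "a * b = of_int (c * d) / of_nat p ^ (k + l)"
    by (simp add: a b power_add)
  thus ?thesis unfolding Z_inv_def by blast
qed

lemma Z_inv_sum:
  assumes "p \<noteq> 0" "\<And>k. k \<in> A \<Longrightarrow> f k \<in> Z_inv p" shows "sum f A \<in> Z_inv p"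
  using assms(2) by (induction A rule: infinite_finite_induct) (auto intro!: Z_inv_add [OF assms(1)])

lemma Z_inv_powi: "of_nat p powi z \<in> Z_inv p"
proof (cases z)
  case (nonneg k)
  thus ?thesis using Z_inv_of_int [of "int p ^ k" p] by simp
next
  case (neg k)
  hence "of_nat p powi z = (of_int 1 / of_nat p ^ Suc k :: rat)"
    by (simp add: power_int_minus field_simps flip: power_Suc of_nat_Suc)
  thus ?thesis unfolding Z_inv_def by blast
qed

section \<open>Unitriangular matrices, the action on a single column, and the group law\<close>

lemma UT_iff:
  "A \<in> UT n R \<longleftrightarrow> A \<in> carrier_mat n n \<and> (\<forall>i<n. A $$ (i, i) = 1) \<and>
    (\<forall>i<n. \<forall>j<i. A $$ (i, j) = 0) \<and> (\<forall>i<n. \<forall>j<n. A $$ (i, j) \<in> R)"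
proof -
  have "elements_mat A \<subseteq> R \<longleftrightarrow> (\<forall>i<n. \<forall>j<n. A $$ (i, j) \<in> R)" if "A \<in> carrier_mat n n"
    using that unfolding elements_mat_def by force
  thus ?thesis unfolding UT_def upper_triangular_def by auto
qed

text \<open>Conjugation by X multiplies the entry (k, j) by p^(x_k - x_j), so column j of f X b
  X^(-1) depends on column j of b alone, here called \<open>c\<close>. This is what allows each
  column to be treated in a field of its own; over the rationals the same formula is the group
  multiplication.\<close>

definition col_act ::
  "nat \<Rightarrow> nat \<Rightarrow> int vec \<times> rat mat \<Rightarrow> nat \<Rightarrow> (nat \<Rightarrow> 'a::field_char_0) \<Rightarrow> nat \<Rightarrow> 'a" where
  "col_act p n g j c i =
    (\<Sum>k<n. of_rat (snd g $$ (i, k)) * of_nat p powi (fst g $ k - fst g $ j) * c k)"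

lemma scaling_mat_conj_entry:
  assumes "x \<in> carrier_vec n" "B \<in> carrier_mat n n" "k < n" "j < n" "p \<noteq> 0"
  shows "(scaling_mat p n x * B * scaling_mat p n (- x)) $$ (k, j) =
    of_nat p powi (x $ k - x $ j) * (B $$ (k, j) :: 'a::field_char_0)"
proof -
  have "scaling_mat p n x * B = Matrix.mat n n (\<lambda>(i, j). of_nat p powi (x $ i) * B $$ (i, j))"
    using assms unfolding scaling_mat_def by (simp add: mat_diag_mult_left)
  hence "scaling_mat p n x * B * scaling_mat p n (- x) =
      Matrix.mat n n (\<lambda>(i, j). of_nat p powi (x $ i) * B $$ (i, j) * of_nat p powi ((- x) $ j))"
    unfolding scaling_mat_def by (subst mat_diag_mult_right [of _ n]) (auto intro!: eq_matI)
  thus ?thesis using assms by (simp add: power_int_diff power_int_minus divide_inverse)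
qed

lemma col_act_matrix:
  assumes "x \<in> carrier_vec n" "f \<in> carrier_mat n n" "i < n" "j < n" "p \<noteq> 0"
  shows "(map_mat of_rat f * (scaling_mat p n x * Matrix.mat n n b * scaling_mat p n (- x))) $$ (i, j) =
    col_act p n (x, f) j (\<lambda>k. b (k, j) :: 'a::field_char_0) i"
proof -
  let ?C = "scaling_mat p n x * Matrix.mat n n b * scaling_mat p n (- x)"
  have C: "?C \<in> carrier_mat n n"
    by (rule carrier_matI) (simp_all add: scaling_mat_def mat_diag_def)
  have "(map_mat of_rat f * C) $$ (i, j) = (\<Sum>k<n. of_rat (f $$ (i, k)) * C $$ (k, j))"
    if "C \<in> carrier_mat n n" for C :: "'a mat"
    using assms that by (simp add: scalar_prod_def lessThan_atLeast0)
  hence "(map_mat of_rat f * ?C) $$ (i, j) = (\<Sum>k<n. of_rat (f $$ (i, k)) * ?C $$ (k, j))"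
    using C .
  also have "\<dots> = (\<Sum>k<n. of_rat (f $$ (i, k)) * (of_nat p powi (x $ k - x $ j) * b (k, j)))"
    using assms by (intro sum.cong refl) (subst scaling_mat_conj_entry, auto)
  finally show ?thesis by (simp add: col_act_def mult.assoc)
qed

lemma ZUT_carrier:
  "g \<in> carrier (ZUT p n) \<longleftrightarrow> fst g \<in> carrier_vec n \<and> snd g \<in> UT n (Z_inv p)"
  by (cases g) (simp add: ZUT_def)

lemma ZUT_one: "\<one>\<^bsub>ZUT p n\<^esub> = (0\<^sub>v n, 1\<^sub>m n)"
  by (simp add: ZUT_def)

lemma fst_ZUT_mult: "fst (g \<otimes>\<^bsub>ZUT p n\<^esub> h) = fst g + fst h"
  by (simp add: ZUT_def case_prod_unfold)

lemma snd_ZUT_mult: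
  assumes g: "g \<in> carrier (ZUT p n)" and h: "snd h \<in> carrier_mat n n"
    and ij: "i < n" "j < n" and p: "p \<noteq> 0"
  shows "snd (g \<otimes>\<^bsub>ZUT p n\<^esub> h) $$ (i, j) = col_act p n g j (\<lambda>k. snd h $$ (k, j)) i"
proof -
  have c: "fst g \<in> carrier_vec n" "snd g \<in> carrier_mat n n"
    using g by (auto simp: ZUT_carrier UT_iff)
  have m: "map_mat of_rat (snd g) = snd g" by (intro eq_matI) auto
  have h': "Matrix.mat n n (\<lambda>(i, j). snd h $$ (i, j)) = snd h" using h by (intro eq_matI) auto
  have "snd (g \<otimes>\<^bsub>ZUT p n\<^esub> h) $$ (i, j) =
     (map_mat of_rat (snd g) * (scaling_mat p n (fst g) *
      Matrix.mat n n (\<lambda>(i, j). snd h $$ (i, j)) * scaling_mat p n (- fst g))) $$ (i, j)"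
    unfolding m h' by (simp add: ZUT_def case_prod_unfold)
  also have "\<dots> = col_act p n (fst g, snd g) j (\<lambda>k. snd h $$ (k, j)) i"
    by (subst col_act_matrix [OF c ij p]) simp
  finally show ?thesis by simp
qed

lemma snd_ZUT_mult_carrier:
  "snd g \<in> carrier_mat n n \<Longrightarrow> snd (g \<otimes>\<^bsub>ZUT p n\<^esub> h) \<in> carrier_mat n n"
  by (rule carrier_matI) (simp_all add: ZUT_def case_prod_unfold scaling_mat_def mat_diag_def)

lemma ZUT_eqI:
  assumes "fst g = fst h" "snd g \<in> carrier_mat n n" "snd h \<in> carrier_mat n n"
    "\<And>i j. i < n \<Longrightarrow> j < n \<Longrightarrow> snd g $$ (i, j) = snd h $$ (i, j)"
  shows "g = h"
  using assms by (intro prod_eqI eq_matI) auto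

lemma ZUT_entries:
  assumes "g \<in> carrier (ZUT p n)" "i < n"
  shows "snd g $$ (i, i) = 1" "j < i \<Longrightarrow> snd g $$ (i, j) = 0" "j < n \<Longrightarrow> snd g $$ (i, j) \<in> Z_inv p"
  using assms by (auto simp: ZUT_carrier UT_iff)

lemma col_act_cong:
  "(\<And>k. k < n \<Longrightarrow> c k = d k) \<Longrightarrow> col_act p n g j c i = col_act p n g j d i"
  unfolding col_act_def by (intro sum.cong) auto

lemma col_act_one:
  assumes "i < n" "j < n" shows "col_act p n \<one>\<^bsub>ZUT p n\<^esub> j c i = c i"
proof -
  have "col_act p n \<one>\<^bsub>ZUT p n\<^esub> j c i = (\<Sum>k<n. if k = i then c k else 0)"
    unfolding col_act_def using assms by (intro sum.cong) (auto simp: ZUT_one)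
  thus ?thesis using assms by simp
qed

lemma col_act_diag:
  assumes g: "g \<in> carrier (ZUT p n)" and j: "j < n"
    and c: "c j = 1" "\<And>k. j < k \<Longrightarrow> k < n \<Longrightarrow> c k = 0"
  shows "col_act p n g j c j = 1"
proof -
  have "col_act p n g j c j = (\<Sum>k<n. if k = j then 1 else 0)"
    unfolding col_act_def
  proof (intro sum.cong refl)
    fix k assume "k \<in> {..<n}"
    thus "of_rat (snd g $$ (j, k)) * of_nat p powi (fst g $ k - fst g $ j) * c k = (if k = j then 1 else 0)"
      using ZUT_entries [OF g j] c by (cases k j rule: linorder_cases) auto
  qed
  thus ?thesis using j by simp
qed

lemma col_act_below:
  assumes g: "g \<in> carrier (ZUT p n)" and i: "j < i" "i < n"
    and c: "\<And>k. j < k \<Longrightarrow> k < n \<Longrightarrow> c k = 0"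
  shows "col_act p n g j c i = 0"
  unfolding col_act_def
proof (intro sum.neutral ballI)
  fix k assume "k \<in> {..<n}"
  thus "of_rat (snd g $$ (i, k)) * of_nat p powi (fst g $ k - fst g $ j) * c k = 0"
    using ZUT_entries [OF g i(2)] c i by (cases "k < i") auto
qed

lemma ZUT_mult_closed:
  assumes g: "g \<in> carrier (ZUT p n)" and h: "h \<in> carrier (ZUT p n)" and p: "p \<noteq> 0"
  shows "g \<otimes>\<^bsub>ZUT p n\<^esub> h \<in> carrier (ZUT p n)"
proof -
  have c: "fst g \<in> carrier_vec n" "fst h \<in> carrier_vec n"
    "snd g \<in> carrier_mat n n" "snd h \<in> carrier_mat n n"
    using g h by (auto simp: ZUT_carrier UT_iff)
  note [simp] = snd_ZUT_mult [OF g c(4) _ _ p]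
  show ?thesis
    unfolding ZUT_carrier UT_iff
  proof (intro conjI allI impI)
    show "fst (g \<otimes>\<^bsub>ZUT p n\<^esub> h) \<in> carrier_vec n" using c by (simp add: fst_ZUT_mult)
    show "snd (g \<otimes>\<^bsub>ZUT p n\<^esub> h) \<in> carrier_mat n n" using c by (simp add: snd_ZUT_mult_carrier)
    show "snd (g \<otimes>\<^bsub>ZUT p n\<^esub> h) $$ (i, i) = 1" if "i < n" for i
      using that ZUT_entries [OF h] by (simp add: col_act_diag [OF g])
    show "snd (g \<otimes>\<^bsub>ZUT p n\<^esub> h) $$ (i, j) = 0" if "i < n" "j < i" for i j
      using that ZUT_entries [OF h] by (simp add: col_act_below [OF g])
    show "snd (g \<otimes>\<^bsub>ZUT p n\<^esub> h) $$ (i, j) \<in> Z_inv p" if "i < n" "j < n" for i j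
      using that ZUT_entries [OF g] ZUT_entries [OF h]
      by (auto simp: col_act_def intro!: Z_inv_sum Z_inv_mult Z_inv_powi p)
  qed
qed

lemma of_rat_of_nat_powi: "of_rat (of_nat p powi z) = (of_nat p powi z :: 'a::field_char_0)"
  by (simp add: power_int_def of_rat_power of_rat_inverse)

text \<open>The factors p^(x_l - x_k) and p^(x_k - x_j) telescope to p^(x_l - x_j), after which the
  two sums can be interchanged. Over the rationals this yields associativity in the group, over the
  reals and the p-adic numbers the law of the action.\<close>

lemma col_act_mult:
  assumes g: "g \<in> carrier (ZUT p n)" and h: "h \<in> carrier (ZUT p n)" and p: "p \<noteq> 0"
    and ij: "i < n" "j < n"
  shows "col_act p n (g \<otimes>\<^bsub>ZUT p n\<^esub> h) j c i = col_act p n g j (col_act p n h j c) i"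
proof -
  have c: "fst g \<in> carrier_vec n" "fst h \<in> carrier_vec n" "snd h \<in> carrier_mat n n"
    using g h by (auto simp: ZUT_carrier UT_iff)
  define e where "e i j = (of_nat p powi (fst g $ i - fst g $ j) :: 'a)" for i j
  define e' where "e' i j = (of_nat p powi (fst h $ i - fst h $ j) :: 'a)" for i j
  have e: "e l k * e k j = e l j" for k l
    using p by (simp add: e_def flip: power_int_add)
  have ee': "of_nat p powi (fst (g \<otimes>\<^bsub>ZUT p n\<^esub> h) $ k - fst (g \<otimes>\<^bsub>ZUT p n\<^esub> h) $ j) = e k j * e' k j"
    if "k < n" for k
    using p that ij c
    by (simp add: e_def e'_def fst_ZUT_mult algebra_simps flip: power_int_add)
  have prod: "of_rat (snd (g \<otimes>\<^bsub>ZUT p n\<^esub> h) $$ (i, k)) =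
      (\<Sum>l<n. of_rat (snd g $$ (i, l)) * e l k * of_rat (snd h $$ (l, k)) :: 'a)" if "k < n" for k
    by (simp add: snd_ZUT_mult [OF g c(3) ij(1) that p] col_act_def of_rat_sum of_rat_mult
      of_rat_of_nat_powi e_def)
  have "col_act p n (g \<otimes>\<^bsub>ZUT p n\<^esub> h) j c i =
      (\<Sum>k<n. (\<Sum>l<n. of_rat (snd g $$ (i, l)) * e l k * of_rat (snd h $$ (l, k))) * (e k j * e' k j) * c k)"
    unfolding col_act_def by (intro sum.cong refl) (simp add: prod ee')
  also have "\<dots> = (\<Sum>k<n. \<Sum>l<n. of_rat (snd g $$ (i, l)) * (e l k * e k j) * (of_rat (snd h $$ (l, k)) * e' k j * c k))"
    by (simp add: sum_distrib_right sum_distrib_left mult_ac)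
  also have "\<dots> = (\<Sum>l<n. \<Sum>k<n. of_rat (snd g $$ (i, l)) * e l j * (of_rat (snd h $$ (l, k)) * e' k j * c k))"
    unfolding e by (rule sum.swap)
  also have "\<dots> = col_act p n g j (col_act p n h j c) i"
    by (simp add: col_act_def e_def e'_def sum_distrib_left)
  finally show ?thesis .
qed

text \<open>Solves B A = 1 along row i: as A has ones on the diagonal, the equation at (i, j)
  determines B i j from the earlier entries of the row. There is no division, so the entries stay in
  Z[1/p].\<close>

fun ut_left_inv :: "'a::comm_ring_1 mat \<Rightarrow> nat \<Rightarrow> nat \<Rightarrow> 'a" where
  "ut_left_inv A i j =
    (if j < i then 0 else if j = i then 1 else - (\<Sum>k<j. ut_left_inv A i k * A $$ (k, j)))"

declare ut_left_inv.simps [simp del]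

lemma ut_left_inv_mult:
  assumes A: "A \<in> UT n R" and ij: "i < n" "j < n"
  shows "(\<Sum>k<n. ut_left_inv A i k * A $$ (k, j)) = of_bool (i = j)"
proof -
  have "(\<Sum>k<n. ut_left_inv A i k * A $$ (k, j)) = (\<Sum>k<Suc j. ut_left_inv A i k * A $$ (k, j))"
    using A ij by (intro sum.mono_neutral_right) (auto simp: UT_iff)
  also have "\<dots> = (\<Sum>k<j. ut_left_inv A i k * A $$ (k, j)) + ut_left_inv A i j"
    using A ij by (simp add: UT_iff)
  also have "\<dots> = of_bool (i = j)"
  proof (cases "j \<le> i")
    case True
    have "(\<Sum>k<j. ut_left_inv A i k * A $$ (k, j)) = 0"
      using True by (intro sum.neutral) (auto simp: ut_left_inv.simps)
    thus ?thesis using True by (auto simp: ut_left_inv.simps [of A i j])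
  qed (auto simp: ut_left_inv.simps [of A i j])
  finally show ?thesis .
qed

lemma ut_left_inv_Z_inv:
  assumes "A \<in> UT n (Z_inv p)" "j < n" "p \<noteq> 0"
  shows "ut_left_inv A i j \<in> Z_inv p"
  using assms(2)
proof (induction j rule: less_induct)
  case (less j)
  show ?case
    unfolding ut_left_inv.simps [of A i j]
    using less assms by (auto simp: UT_iff intro!: Z_inv_uminus Z_inv_sum Z_inv_mult)
qed

lemma group_ZUT:
  assumes p: "p \<noteq> 0"
  shows "group (ZUT p n)"
proof (rule groupI)
  fix g h assume "g \<in> carrier (ZUT p n)" "h \<in> carrier (ZUT p n)"
  thus "g \<otimes>\<^bsub>ZUT p n\<^esub> h \<in> carrier (ZUT p n)" by (rule ZUT_mult_closed [OF _ _ p])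
next
  show one: "\<one>\<^bsub>ZUT p n\<^esub> \<in> carrier (ZUT p n)"
    by (auto simp: ZUT_carrier UT_iff ZUT_one)
  fix g assume g: "g \<in> carrier (ZUT p n)"
  have c: "fst g \<in> carrier_vec n" "snd g \<in> carrier_mat n n"
    using g by (auto simp: ZUT_carrier UT_iff)
  show "\<one>\<^bsub>ZUT p n\<^esub> \<otimes>\<^bsub>ZUT p n\<^esub> g = g"
  proof (rule ZUT_eqI)
    show "fst (\<one>\<^bsub>ZUT p n\<^esub> \<otimes>\<^bsub>ZUT p n\<^esub> g) = fst g"
      using c by (simp add: fst_ZUT_mult ZUT_one)
    show "snd (\<one>\<^bsub>ZUT p n\<^esub> \<otimes>\<^bsub>ZUT p n\<^esub> g) \<in> carrier_mat n n"
      by (rule snd_ZUT_mult_carrier) (simp add: ZUT_one)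
  qed (use c in \<open>simp_all add: snd_ZUT_mult [OF one _ _ _ p] col_act_one\<close>)
  show "\<exists>h\<in>carrier (ZUT p n). h \<otimes>\<^bsub>ZUT p n\<^esub> g = \<one>\<^bsub>ZUT p n\<^esub>"
  proof
    \<comment> \<open>The inverse of (x, f) is (-x, X^(-1) f^(-1) X), and this conjugation
      multiplies the entry (i, j) by p^(x_j - x_i).\<close>
    define h where "h = (- fst g,
      Matrix.mat n n (\<lambda>(i, j). of_nat p powi (fst g $ j - fst g $ i) * ut_left_inv (snd g) i j))"
    have UT: "snd g \<in> UT n (Z_inv p)" using g by (simp add: ZUT_carrier)
    show h: "h \<in> carrier (ZUT p n)"
      unfolding ZUT_carrier UT_iff
    proof (intro conjI allI impI)
      show "snd h $$ (i, j) \<in> Z_inv p" if "i < n" "j < n" for i j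
        using that ut_left_inv_Z_inv [OF UT _ p] by (simp add: h_def Z_inv_mult Z_inv_powi)
    qed (use c in \<open>simp_all add: h_def ut_left_inv.simps\<close>)
    show "h \<otimes>\<^bsub>ZUT p n\<^esub> g = \<one>\<^bsub>ZUT p n\<^esub>"
    proof (rule ZUT_eqI)
      show "fst (h \<otimes>\<^bsub>ZUT p n\<^esub> g) = fst \<one>\<^bsub>ZUT p n\<^esub>"
        using c by (simp add: fst_ZUT_mult ZUT_one h_def)
      show "snd (h \<otimes>\<^bsub>ZUT p n\<^esub> g) \<in> carrier_mat n n"
        by (rule snd_ZUT_mult_carrier) (simp add: h_def)
      show "snd \<one>\<^bsub>ZUT p n\<^esub> \<in> carrier_mat n n" by (simp add: ZUT_one)
      fix i j assume ij: "i < n" "j < n"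
      have "snd (h \<otimes>\<^bsub>ZUT p n\<^esub> g) $$ (i, j) =
          (\<Sum>k<n. of_nat p powi (fst g $ k - fst g $ i) * ut_left_inv (snd g) i k *
            of_nat p powi (fst g $ j - fst g $ k) * snd g $$ (k, j))"
        unfolding snd_ZUT_mult [OF h c(2) ij p] col_act_def
        using ij c by (intro sum.cong refl) (simp add: h_def)
      also have "\<dots> = (\<Sum>k<n. (of_nat p powi (fst g $ k - fst g $ i) * of_nat p powi (fst g $ j - fst g $ k)) *
          (ut_left_inv (snd g) i k * snd g $$ (k, j)))"
        by (simp add: mult_ac)
      also have "\<dots> = of_nat p powi (fst g $ j - fst g $ i) *
          (\<Sum>k<n. ut_left_inv (snd g) i k * snd g $$ (k, j))"
        using p by (simp add: sum_distrib_left flip: power_int_add)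
      also have "\<dots> = snd \<one>\<^bsub>ZUT p n\<^esub> $$ (i, j)"
        using ij by (simp add: ut_left_inv_mult [OF UT ij] ZUT_one)
      finally show "snd (h \<otimes>\<^bsub>ZUT p n\<^esub> g) $$ (i, j) = snd \<one>\<^bsub>ZUT p n\<^esub> $$ (i, j)" .
    qed
  qed
next
  fix g h k assume g: "g \<in> carrier (ZUT p n)" and h: "h \<in> carrier (ZUT p n)"
    and k: "k \<in> carrier (ZUT p n)"
  note gh = ZUT_mult_closed [OF g h p] and hk = ZUT_mult_closed [OF h k p]
  have c: "fst g \<in> carrier_vec n" "fst h \<in> carrier_vec n" "fst k \<in> carrier_vec n"
    "snd g \<in> carrier_mat n n" "snd k \<in> carrier_mat n n"
    "snd (h \<otimes>\<^bsub>ZUT p n\<^esub> k) \<in> carrier_mat n n" "snd (g \<otimes>\<^bsub>ZUT p n\<^esub> h) \<in> carrier_mat n n"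
    using g h k gh hk by (auto simp: ZUT_carrier UT_iff)
  show "g \<otimes>\<^bsub>ZUT p n\<^esub> h \<otimes>\<^bsub>ZUT p n\<^esub> k = g \<otimes>\<^bsub>ZUT p n\<^esub> (h \<otimes>\<^bsub>ZUT p n\<^esub> k)"
  proof (rule ZUT_eqI)
    show "fst (g \<otimes>\<^bsub>ZUT p n\<^esub> h \<otimes>\<^bsub>ZUT p n\<^esub> k) = fst (g \<otimes>\<^bsub>ZUT p n\<^esub> (h \<otimes>\<^bsub>ZUT p n\<^esub> k))"
      using c by (simp add: fst_ZUT_mult assoc_add_vec [of _ n])
    show "snd (g \<otimes>\<^bsub>ZUT p n\<^esub> h \<otimes>\<^bsub>ZUT p n\<^esub> k) $$ (i, j) = snd (g \<otimes>\<^bsub>ZUT p n\<^esub> (h \<otimes>\<^bsub>ZUT p n\<^esub> k)) $$ (i, j)"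
      if ij: "i < n" "j < n" for i j
      unfolding snd_ZUT_mult [OF gh c(5) ij p] snd_ZUT_mult [OF g c(6) ij p] col_act_mult [OF g h p ij]
      by (rule col_act_cong) (simp add: snd_ZUT_mult [OF h c(5) _ ij(2) p])
  qed (use c in \<open>simp_all add: snd_ZUT_mult_carrier\<close>)
qed

text \<open>Every element is a word in S and its inverses because S generates, so the set behind the
  \<open>LEAST\<close> is non-empty and some word attains it.\<close>

lemma (in group) word_length_word:
  assumes S: "S \<subseteq> carrier G" "generate G S = carrier G" and g: "g \<in> carrier G"
  obtains ws where "length ws = word_length G S g" "set ws \<subseteq> S \<union> m_inv G ` S"
    "foldr (\<otimes>) ws \<one> = g"
proof -
  have closed: "foldr (\<otimes>) ws \<one> \<in> carrier G" if "set ws \<subseteq> S \<union> m_inv G ` S" for ws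
    using that S(1) by (induction ws) auto
  have app: "foldr (\<otimes>) (us @ vs) \<one> = foldr (\<otimes>) us \<one> \<otimes> foldr (\<otimes>) vs \<one>"
    if "set us \<subseteq> S \<union> m_inv G ` S" "set vs \<subseteq> S \<union> m_inv G ` S" for us vs
    using that
  proof (induction us)
    case (Cons u us)
    have "u \<in> carrier G" using Cons.prems S(1) by auto
    thus ?case using Cons closed by (simp add: m_assoc)
  qed (simp add: closed)
  have "\<exists>ws. set ws \<subseteq> S \<union> m_inv G ` S \<and> foldr (\<otimes>) ws \<one> = g" if "g \<in> generate G S"
    using that
  proof (induction rule: generate.induct)
    case one
    show ?case by (rule exI [of _ "[]"]) simp
  next
    case (incl h)
    thus ?case using S(1) by (intro exI [of _ "[h]"]) auto
  next
    case (inv h)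
    thus ?case using S(1) by (intro exI [of _ "[inv h]"]) auto
  next
    case (eng h1 h2)
    then obtain us vs where "set us \<subseteq> S \<union> m_inv G ` S" "foldr (\<otimes>) us \<one> = h1"
      "set vs \<subseteq> S \<union> m_inv G ` S" "foldr (\<otimes>) vs \<one> = h2" by blast
    thus ?case using app by (intro exI [of _ "us @ vs"]) auto
  qed
  hence "\<exists>k ws. length ws = k \<and> set ws \<subseteq> S \<union> m_inv G ` S \<and> foldr (\<otimes>) ws \<one> = g"
    using g S(2) by auto
  from LeastI_ex [OF this] show ?thesis using that unfolding word_length_def by blast
qed

text \<open>Countability of G lets measurability in a group variable be checked one group element at
  a time.\<close>

lemma (in group) countable_carrier:
  assumes S: "S \<subseteq> carrier G" "generate G S = carrier G" "countable S"
  shows "countable (carrier G)"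
proof (rule countable_subset)
  show "carrier G \<subseteq> (\<lambda>ws. foldr (\<otimes>) ws \<one>) ` lists (S \<union> m_inv G ` S)"
  proof
    fix g assume g: "g \<in> carrier G"
    obtain ws where "length ws = word_length G S g" "set ws \<subseteq> S \<union> m_inv G ` S"
      "foldr (\<otimes>) ws \<one> = g"
      by (rule word_length_word [OF S(1,2) g])
    thus "g \<in> (\<lambda>ws. foldr (\<otimes>) ws \<one>) ` lists (S \<union> m_inv G ` S)" by auto
  qed
  show "countable ((\<lambda>ws. foldr (\<otimes>) ws \<one>) ` lists (S \<union> m_inv G ` S))"
    using S(3) by auto
qed

section \<open>Partial sums of independent variables\<close>

context sequence_space
begin

text \<open>Splits off the first increment, which is then independent of the remaining path.\<close>

lemma integral_case_nat:
  fixes F :: "(nat \<Rightarrow> 'a) \<Rightarrow> real"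
  assumes [measurable]: "F \<in> borel_measurable S"
  shows "integral\<^sup>L S F = (\<integral>z. F (case_nat (fst z) (snd z)) \<partial>(M \<Otimes>\<^sub>M S))"
  by (subst PiM_iter [symmetric], subst integral_distr) (simp_all add: case_prod_unfold)

lemma integrable_component:
  fixes X :: "'a \<Rightarrow> real"
  assumes "integrable M X"
  shows "integrable S (\<lambda>\<omega>. X (\<omega> k))"
proof -
  have "distr S M (\<lambda>\<omega>. \<omega> k) = M" by (rule PiM_component) simp
  hence "integrable (distr S M (\<lambda>\<omega>. \<omega> k)) X" using assms by simp
  thus ?thesis by (rule integrable_distr [rotated]) simp
qed

lemma distr_pair_snd: "distr (M \<Otimes>\<^sub>M S) S snd = S"
proof -
  interpret MS: pair_prob_space M S by unfold_locales
  show ?thesis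
    by (subst MS.distr_pair_swap, subst distr_distr)
      (simp_all add: comp_def case_prod_unfold M.distr_pair_fst)
qed

text \<open>
  With \<open>T n\<close> the maximum of the first \<open>n\<close> partial sums and \<open>A\<close> the shift invariant event that the
  partial sums are unbounded, \<open>T (n + 1) (s # \<omega>) = max 0 (X s + T n \<omega>)\<close> gives
  \<open>0 \<le> E ((T (n + 1) - T n) 1\<^sub>A) = E (max (- T n \<omega>) (X s) 1\<^sub>A)\<close>,
  which tends to \<open>E X P(A)\<close>.
\<close>

lemma AE_partial_sums_bounded:
  fixes X :: "'a \<Rightarrow> real"
  assumes X: "integrable M X" and neg: "integral\<^sup>L M X < 0"
  shows "AE \<omega> in S. \<exists>C::nat. \<forall>m. (\<Sum>k<m. X (\<omega> k)) \<le> real C"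
proof -
  interpret MS: pair_prob_space M S by unfold_locales
  have [measurable]: "X \<in> borel_measurable M" using X by simp
  define W where "W \<omega> m = (\<Sum>k<m. X (\<omega> k))" for \<omega> and m :: nat
  define T where "T n \<omega> = Max (W \<omega> ` {..n})" for n \<omega>
  define Bd where "Bd \<omega> \<longleftrightarrow> (\<exists>C::nat. \<forall>m. W \<omega> m \<le> real C)" for \<omega>
  define I :: "(nat \<Rightarrow> 'a) \<Rightarrow> real" where "I \<omega> = of_bool (\<not> Bd \<omega>)" for \<omega>
  have W_meas [measurable]: "(\<lambda>\<omega>. W \<omega> m) \<in> borel_measurable S" for m
    unfolding W_def by measurable
  have [measurable]: "T n \<in> borel_measurable S" for n
  proof -
    have "(\<lambda>\<omega>. Max ((\<lambda>m. W \<omega> m) ` {..n})) \<in> borel_measurable S"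
      by (rule borel_measurable_Max) auto
    thus ?thesis by (simp add: T_def [abs_def])
  qed
  have Bd_meas [measurable]: "Measurable.pred S Bd" unfolding Bd_def by measurable
  have [measurable]: "I \<in> borel_measurable S" unfolding I_def by measurable
  have W_cons: "W (case_nat s \<omega>) (Suc m) = X s + W \<omega> m" for s \<omega> m
    unfolding W_def by (subst sum.lessThan_Suc_shift) simp
  have W_0: "W \<omega> 0 = 0" for \<omega> by (simp add: W_def)
  have T_cons: "T (Suc n) (case_nat s \<omega>) = max 0 (X s + T n \<omega>)" for n s \<omega>
  proof -
    have "W (case_nat s \<omega>) ` {..Suc n} = insert 0 ((\<lambda>m. W \<omega> m + X s) ` {..n})"
      by (simp add: atMost_Suc_eq_insert_0 image_image W_0 W_cons add.commute)
    thus ?thesis by (simp add: T_def Max_add_commute)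
  qed
  have Bd_cons: "Bd (case_nat s \<omega>) \<longleftrightarrow> Bd \<omega>" for s \<omega>
  proof
    assume "Bd (case_nat s \<omega>)"
    then obtain C :: nat where C: "\<And>m. W (case_nat s \<omega>) m \<le> real C" by (auto simp: Bd_def)
    obtain D :: nat where D: "real C - X s \<le> real D" using real_arch_simple by blast
    have "W \<omega> m \<le> real D" for m using C [of "Suc m"] D by (simp add: W_cons)
    thus "Bd \<omega>" by (auto simp: Bd_def)
  next
    assume "Bd \<omega>"
    then obtain C :: nat where C: "\<And>m. W \<omega> m \<le> real C" by (auto simp: Bd_def)
    \<comment> \<open>The absolute value covers m = 0, where the sum is 0 while
      \<open>real C + X s\<close> may be negative.\<close>
    obtain D :: nat where D: "\<bar>real C + X s\<bar> \<le> real D" using real_arch_simple by blast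
    have "W (case_nat s \<omega>) m \<le> real D" for m
      using C [of "m - 1"] D by (cases m) (simp_all add: W_cons W_0)
    thus "Bd (case_nat s \<omega>)" by (auto simp: Bd_def)
  qed
  have I_cons: "I (case_nat s \<omega>) = I \<omega>" for s \<omega> by (simp add: I_def Bd_cons)
  have I01: "0 \<le> I \<omega>" "I \<omega> \<le> 1" "\<bar>I \<omega>\<bar> = I \<omega>" for \<omega> by (auto simp: I_def)
  have W_le_T: "m \<le> n \<Longrightarrow> W \<omega> m \<le> T n \<omega>" for m n \<omega>
    unfolding T_def by (rule Max_ge) auto
  have T_mono: "T n \<omega> \<le> T (Suc n) \<omega>" for n \<omega>
    unfolding T_def by (rule Max_mono) auto
  have T_nonneg: "0 \<le> T n \<omega>" for n \<omega> using W_le_T [of 0 n \<omega>] by (simp add: W_0)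
  have T_le: "T n \<omega> \<le> (\<Sum>k<n. \<bar>X (\<omega> k)\<bar>)" for n \<omega>
  proof -
    have "T n \<omega> \<in> W \<omega> ` {..n}" unfolding T_def by (rule Max_in) auto
    then obtain m where m: "m \<le> n" "T n \<omega> = W \<omega> m" by auto
    have "W \<omega> m \<le> (\<Sum>k<m. \<bar>X (\<omega> k)\<bar>)" unfolding W_def by (rule sum_mono) simp
    also have "\<dots> \<le> (\<Sum>k<n. \<bar>X (\<omega> k)\<bar>)" by (rule sum_mono2) (use m in auto)
    finally show ?thesis using m by simp
  qed
  have int_T: "integrable S (\<lambda>\<omega>. T n \<omega> * I \<omega>)" for n
  proof (rule Bochner_Integration.integrable_bound)
    show "integrable S (\<lambda>\<omega>. \<Sum>k<n. \<bar>X (\<omega> k)\<bar>)"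
      by (intro Bochner_Integration.integrable_sum integrable_abs integrable_component X)
    show "AE \<omega> in S. norm (T n \<omega> * I \<omega>) \<le> norm (\<Sum>k<n. \<bar>X (\<omega> k)\<bar>)"
    proof (rule AE_I2)
      fix \<omega>
      have "T n \<omega> * I \<omega> \<le> T n \<omega> * 1" using T_nonneg I01 by (intro mult_left_mono)
      thus "norm (T n \<omega> * I \<omega>) \<le> norm (\<Sum>k<n. \<bar>X (\<omega> k)\<bar>)"
        using T_nonneg I01 T_le [of n \<omega>] by (simp add: abs_mult sum_nonneg)
    qed
  qed measurable
  have int_snd: "integrable (M \<Otimes>\<^sub>M S) (\<lambda>z. F (snd z))"
      "integral\<^sup>L S F = (\<integral>z. F (snd z) \<partial>(M \<Otimes>\<^sub>M S))"
    if F: "integrable S F" for F :: "(nat \<Rightarrow> 'a) \<Rightarrow> real"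
  proof -
    have "integrable (distr (M \<Otimes>\<^sub>M S) S snd) F" using F distr_pair_snd by simp
    thus "integrable (M \<Otimes>\<^sub>M S) (\<lambda>z. F (snd z))" by (rule integrable_distr [rotated]) simp
    show "integral\<^sup>L S F = (\<integral>z. F (snd z) \<partial>(M \<Otimes>\<^sub>M S))"
      by (subst distr_pair_snd [symmetric], subst integral_distr) (use F in auto)
  qed
  have int_cons: "integrable (M \<Otimes>\<^sub>M S) (\<lambda>z. F (case_nat (fst z) (snd z)))"
    if F: "integrable S F" for F :: "(nat \<Rightarrow> 'a) \<Rightarrow> real"
  proof -
    have "integrable (distr (M \<Otimes>\<^sub>M S) S (\<lambda>(s, \<omega>). case_nat s \<omega>)) F" using F PiM_iter by simp
    hence "integrable (M \<Otimes>\<^sub>M S) (\<lambda>z. F (case z of (s, \<omega>) \<Rightarrow> case_nat s \<omega>))"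
      by (rule integrable_distr [rotated]) simp
    thus ?thesis by (simp add: case_prod_unfold)
  qed
  have diff_nonneg: "0 \<le> (\<integral>z. max (- T n (snd z)) (X (fst z)) * I (snd z) \<partial>(M \<Otimes>\<^sub>M S))" for n
  proof -
    have "0 \<le> (\<integral>\<omega>. T (Suc n) \<omega> * I \<omega> \<partial>S) - (\<integral>\<omega>. T n \<omega> * I \<omega> \<partial>S)"
      using integral_mono [OF int_T int_T, of n "Suc n"] T_mono I01
      by (simp add: mult_right_mono)
    also have "(\<integral>\<omega>. T (Suc n) \<omega> * I \<omega> \<partial>S) =
        (\<integral>z. max 0 (X (fst z) + T n (snd z)) * I (snd z) \<partial>(M \<Otimes>\<^sub>M S))"
      by (subst integral_case_nat) (simp_all add: T_cons I_cons)
    also have "(\<integral>\<omega>. T n \<omega> * I \<omega> \<partial>S) = (\<integral>z. T n (snd z) * I (snd z) \<partial>(M \<Otimes>\<^sub>M S))"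
      by (rule int_snd [OF int_T])
    also have "(\<integral>z. max 0 (X (fst z) + T n (snd z)) * I (snd z) \<partial>(M \<Otimes>\<^sub>M S)) -
        (\<integral>z. T n (snd z) * I (snd z) \<partial>(M \<Otimes>\<^sub>M S)) =
        (\<integral>z. max 0 (X (fst z) + T n (snd z)) * I (snd z) - T n (snd z) * I (snd z) \<partial>(M \<Otimes>\<^sub>M S))"
      using int_cons [OF int_T, of "Suc n"]
      by (intro Bochner_Integration.integral_diff [symmetric] int_snd int_T)
        (simp add: T_cons I_cons)
    also have "\<dots> = (\<integral>z. max (- T n (snd z)) (X (fst z)) * I (snd z) \<partial>(M \<Otimes>\<^sub>M S))"
      by (intro Bochner_Integration.integral_cong refl)
        (simp add: max_def algebra_simps flip: left_diff_distrib)
    finally show ?thesis .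
  qed
  have distr_fst: "integrable (M \<Otimes>\<^sub>M S) (\<lambda>z. X (fst z))"
  proof -
    have "distr (M \<Otimes>\<^sub>M S) M fst = M" by (rule P.distr_pair_fst)
    hence "integrable (distr (M \<Otimes>\<^sub>M S) M fst) X" using X by simp
    thus ?thesis by (rule integrable_distr [rotated]) simp
  qed
  have "(\<lambda>n. \<integral>z. max (- T n (snd z)) (X (fst z)) * I (snd z) \<partial>(M \<Otimes>\<^sub>M S))
      \<longlonglongrightarrow> (\<integral>z. X (fst z) * I (snd z) \<partial>(M \<Otimes>\<^sub>M S))"
  proof (rule integral_dominated_convergence)
    show "integrable (M \<Otimes>\<^sub>M S) (\<lambda>z. \<bar>X (fst z)\<bar>)" using distr_fst by (rule integrable_abs)
    show "AE z in M \<Otimes>\<^sub>M S. norm (max (- T n (snd z)) (X (fst z)) * I (snd z)) \<le> \<bar>X (fst z)\<bar>" for n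
    proof (rule AE_I2)
      fix z
      have "\<bar>max (- T n (snd z)) (X (fst z))\<bar> * I (snd z) \<le> \<bar>X (fst z)\<bar> * 1"
        using T_nonneg [of n "snd z"] I01 by (intro mult_mono) auto
      thus "norm (max (- T n (snd z)) (X (fst z)) * I (snd z)) \<le> \<bar>X (fst z)\<bar>"
        by (simp add: abs_mult I01)
    qed
    show "AE z in M \<Otimes>\<^sub>M S. (\<lambda>n. max (- T n (snd z)) (X (fst z)) * I (snd z))
        \<longlonglongrightarrow> X (fst z) * I (snd z)"
    proof (rule AE_I2)
      fix z
      show "(\<lambda>n. max (- T n (snd z)) (X (fst z)) * I (snd z)) \<longlonglongrightarrow> X (fst z) * I (snd z)"
      \<comment> \<open>If the partial sums are unbounded, \<open>T n\<close> eventually exceeds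
        minus the first increment and the maximum becomes that increment; otherwise the indicator
        \<open>I\<close> vanishes.\<close>
      proof (cases "Bd (snd z)")
        case False
        obtain C :: nat where C: "- X (fst z) \<le> real C" using real_arch_simple by blast
        obtain m where m: "real C < W (snd z) m" using False by (auto simp: Bd_def not_le)
        have "max (- T n (snd z)) (X (fst z)) = X (fst z)" if "n \<ge> m" for n
          using W_le_T [OF that, of "snd z"] m C by simp
        hence "\<forall>\<^sub>F n in sequentially. max (- T n (snd z)) (X (fst z)) * I (snd z) = X (fst z) * I (snd z)"
          by (auto simp: eventually_sequentially)
        thus ?thesis by (rule tendsto_eventually)
      qed (simp add: I_def)
    qed
  qed measurable
  hence "0 \<le> (\<integral>z. X (fst z) * I (snd z) \<partial>(M \<Otimes>\<^sub>M S))"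
    by (rule LIMSEQ_le_const) (use diff_nonneg in auto)
  \<comment> \<open>The first increment and the event depend on different factors of the product
    measure, so the integral factorizes into E X times the probability of the event.\<close>
  also have "\<dots> = (\<integral>s. (\<integral>\<omega>. X s * I \<omega> \<partial>S) \<partial>M)"
  proof (subst MS.integral_fst' [symmetric])
    show "integrable (M \<Otimes>\<^sub>M S) (\<lambda>z. X (fst z) * I (snd z))"
      by (rule Bochner_Integration.integrable_bound [OF distr_fst])
        (auto simp: I_def)
  qed simp
  also have "\<dots> = integral\<^sup>L M X * integral\<^sup>L S I" by simp
  finally have "integral\<^sup>L S I \<le> 0" using neg by (simp add: zero_le_mult_iff)
  moreover have int_I: "integrable S I"
    by (rule P.integrable_const_bound [of _ 1]) (auto simp: I_def)
  moreover have "0 \<le> integral\<^sup>L S I" by (rule Bochner_Integration.integral_nonneg) (simp add: I01)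
  ultimately have "AE \<omega> in S. I \<omega> = 0"
    using integral_nonneg_eq_0_iff_AE [OF int_I] I01 by auto
  thus ?thesis by eventually_elim (auto simp: I_def Bd_def W_def)
qed

text \<open>\<open>AE_partial_sums_bounded\<close> is applied to \<open>X - q\<close> for all
  rational q above the mean at once, which costs countably many null sets; every real c above the
  mean has such a q below it.\<close>

lemma AE_partial_sums_le:
  fixes X :: "'a \<Rightarrow> real"
  assumes X: "integrable M X"
  shows "AE \<omega> in S. \<forall>c>integral\<^sup>L M X. \<exists>C. \<forall>m. (\<Sum>k<m. X (\<omega> k)) \<le> C + c * real m"
proof -
  have "AE \<omega> in S. integral\<^sup>L M X < of_rat q \<longrightarrow>
      (\<exists>C. \<forall>m. (\<Sum>k<m. X (\<omega> k)) \<le> C + of_rat q * real m)" for q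
  proof (cases "integral\<^sup>L M X < of_rat q")
    case True
    have "AE \<omega> in S. \<exists>C::nat. \<forall>m. (\<Sum>k<m. X (\<omega> k) - of_rat q) \<le> real C"
      by (rule AE_partial_sums_bounded) (use X True in \<open>simp_all add: M.prob_space\<close>)
    thus ?thesis
    proof eventually_elim
      case (elim \<omega>)
      then obtain C :: nat where "\<And>m. (\<Sum>k<m. X (\<omega> k) - of_rat q) \<le> real C" by blast
      hence "\<And>m. (\<Sum>k<m. X (\<omega> k)) \<le> real C + of_rat q * real m"
        by (simp add: sum_subtractf algebra_simps)
      thus ?case by blast
    qed
  qed simp
  hence "AE \<omega> in S. \<forall>q. integral\<^sup>L M X < of_rat q \<longrightarrow>
      (\<exists>C. \<forall>m. (\<Sum>k<m. X (\<omega> k)) \<le> C + of_rat q * real m)"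
    by (simp add: AE_all_countable)
  thus ?thesis
  proof eventually_elim
    case (elim \<omega>)
    show ?case
    proof (intro allI impI)
      fix c assume "c > integral\<^sup>L M X"
      then obtain q where q: "integral\<^sup>L M X < of_rat q" "of_rat q < c" using of_rat_dense by blast
      then obtain C where C: "\<And>m. (\<Sum>k<m. X (\<omega> k)) \<le> C + of_rat q * real m" using elim by blast
      have "(\<Sum>k<m. X (\<omega> k)) \<le> C + c * real m" for m
        using C [of m] mult_right_mono [of "of_rat q" c "real m"] q by simp
      thus "\<exists>C. \<forall>m. (\<Sum>k<m. X (\<omega> k)) \<le> C + c * real m" by blast
    qed
  qed
qed

text \<open>An increment is the difference of consecutive partial sums. Bounding one of them from
  above and the other from below, each with an error of e/2 per step, gives sublinear growth without
  a Borel-Cantelli argument.\<close>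

lemma AE_increments_le:
  fixes X :: "'a \<Rightarrow> real"
  assumes X: "integrable M X"
  shows "AE \<omega> in S. \<forall>e>0. \<exists>C. \<forall>m. X (\<omega> m) \<le> C + e * real m"
proof -
  have "AE \<omega> in S. \<forall>c>integral\<^sup>L M (\<lambda>x. - X x).
      \<exists>C. \<forall>m. (\<Sum>k<m. - X (\<omega> k)) \<le> C + c * real m"
    by (rule AE_partial_sums_le) (use X in simp)
  with AE_partial_sums_le [OF X] show ?thesis
  proof eventually_elim
    case (elim \<omega>)
    show ?case
    proof (intro allI impI)
      fix e :: real assume e: "e > 0"
      define E where "E = integral\<^sup>L M X"
      obtain C where C: "\<And>m. (\<Sum>k<m. X (\<omega> k)) \<le> C + (E + e / 2) * real m"
        using elim(1) e unfolding E_def by (metis less_add_same_cancel1 half_gt_zero)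
      have "integral\<^sup>L M (\<lambda>x. - X x) < - E + e / 2" using e by (simp add: E_def)
      then obtain C' where C': "\<And>m. (\<Sum>k<m. - X (\<omega> k)) \<le> C' + (- E + e / 2) * real m"
        using elim(2) by blast
      \<comment> \<open>The additional \<open>E + e / 2\<close> is the slope of the first bound once
        more, since that sum has \<open>Suc m\<close> terms.\<close>
      have "X (\<omega> m) \<le> C + C' + E + e / 2 + e * real m" for m
      proof -
        have "X (\<omega> m) = (\<Sum>k<Suc m. X (\<omega> k)) + (\<Sum>k<m. - X (\<omega> k))" by (simp add: sum_negf)
        also have "\<dots> \<le> (C + (E + e / 2) * real (Suc m)) + (C' + (- E + e / 2) * real m)"
          by (intro add_mono C C')
        also have "\<dots> = C + C' + E + e / 2 + e * real m" by (simp add: field_simps)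
        finally show ?thesis .
      qed
      thus "\<exists>C. \<forall>m. X (\<omega> m) \<le> C + e * real m" by blast
    qed
  qed
qed

end

section \<open>Growth along a path\<close>

text \<open>The number \<alpha> is an upper bound for the exponential rate. Nonnegativity is
  included so that bounds can be multiplied and their rates added.\<close>

definition exp_bounded :: "real \<Rightarrow> (nat \<Rightarrow> real) \<Rightarrow> bool" where
  "exp_bounded \<alpha> u \<longleftrightarrow> (\<exists>C. \<forall>m. 0 \<le> u m \<and> u m \<le> C * exp (\<alpha> * real m))"

lemma exp_boundedI:
  "(\<And>m. 0 \<le> u m) \<Longrightarrow> (\<And>m. u m \<le> C * exp (\<alpha> * real m)) \<Longrightarrow> exp_bounded \<alpha> u"
  unfolding exp_bounded_def by blast

lemma exp_boundedD:
  assumes "exp_bounded \<alpha> u"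
  shows "\<exists>C\<ge>0. \<forall>m. 0 \<le> u m \<and> u m \<le> C * exp (\<alpha> * real m)"
proof -
  obtain C where C: "\<And>m. 0 \<le> u m" "\<And>m. u m \<le> C * exp (\<alpha> * real m)"
    using assms unfolding exp_bounded_def by blast
  moreover have "0 \<le> C" using C(1) [of 0] C(2) [of 0] by simp
  ultimately show ?thesis by blast
qed

lemma exp_bounded_le:
  assumes "exp_bounded \<alpha> u" "\<And>m. 0 \<le> v m" "\<And>m. v m \<le> u m" "\<alpha> \<le> \<beta>"
  shows "exp_bounded \<beta> v"
proof -
  obtain C where C: "0 \<le> C" "\<And>m. u m \<le> C * exp (\<alpha> * real m)"
    using exp_boundedD [OF assms(1)] by blast
  show ?thesis
  proof (rule exp_boundedI)
    fix m
    have "v m \<le> C * exp (\<alpha> * real m)" using assms(3) C(2) order_trans by blast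
    also have "\<dots> \<le> C * exp (\<beta> * real m)"
      using C(1) assms(4) by (simp add: mult_left_mono mult_right_mono)
    finally show "v m \<le> C * exp (\<beta> * real m)" .
  qed (rule assms(2))
qed

lemma exp_bounded_const: "0 \<le> A \<Longrightarrow> 0 \<le> \<alpha> \<Longrightarrow> exp_bounded \<alpha> (\<lambda>_. A)"
  by (rule exp_boundedI [of _ A]) (simp_all add: mult_le_cancel_left1)

lemma exp_bounded_add:
  assumes "exp_bounded \<alpha> u" "exp_bounded \<alpha> v"
  shows "exp_bounded \<alpha> (\<lambda>m. u m + v m)"
proof -
  obtain C where C: "\<And>m. 0 \<le> u m" "\<And>m. u m \<le> C * exp (\<alpha> * real m)"
    using exp_boundedD [OF assms(1)] by blast
  obtain C' where C': "\<And>m. 0 \<le> v m" "\<And>m. v m \<le> C' * exp (\<alpha> * real m)"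
    using exp_boundedD [OF assms(2)] by blast
  show ?thesis
    by (rule exp_boundedI [of _ "C + C'"]) (use C C' in \<open>auto simp: distrib_right intro: add_mono\<close>)
qed

lemma exp_bounded_sum:
  assumes "finite A" "\<And>l. l \<in> A \<Longrightarrow> exp_bounded \<alpha> (u l)"
  shows "exp_bounded \<alpha> (\<lambda>m. \<Sum>l\<in>A. u l m)"
  using assms
proof (induction A)
  case empty
  show ?case by (rule exp_boundedI [of _ 0]) auto
qed (simp add: exp_bounded_add)

lemma exp_bounded_mult:
  assumes "exp_bounded \<alpha> u" "exp_bounded \<beta> v"
  shows "exp_bounded (\<alpha> + \<beta>) (\<lambda>m. u m * v m)"
proof -
  obtain C where C: "0 \<le> C" "\<And>m. 0 \<le> u m" "\<And>m. u m \<le> C * exp (\<alpha> * real m)"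
    using exp_boundedD [OF assms(1)] by blast
  obtain C' where C': "\<And>m. 0 \<le> v m" "\<And>m. v m \<le> C' * exp (\<beta> * real m)"
    using exp_boundedD [OF assms(2)] by blast
  show ?thesis
  proof (rule exp_boundedI)
    fix m
    have "u m * v m \<le> (C * exp (\<alpha> * real m)) * (C' * exp (\<beta> * real m))"
      using C C' by (intro mult_mono) auto
    moreover have "exp ((\<alpha> + \<beta>) * real m) = exp (\<alpha> * real m) * exp (\<beta> * real m)"
      by (simp add: distrib_right exp_add)
    ultimately show "u m * v m \<le> (C * C') * exp ((\<alpha> + \<beta>) * real m)"
      by (simp add: mult_ac)
  qed (use C C' in simp)
qed

text \<open>A geometric sum with ratio greater than 1 is at most a multiple of the next power. At
  rate 0 the sums may grow linearly, hence the strict inequality.\<close>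

lemma exp_bounded_partial_sums:
  assumes "exp_bounded \<alpha> u" "\<alpha> > 0"
  shows "exp_bounded \<alpha> (\<lambda>m. \<Sum>s<m. u s)"
proof -
  obtain C where C: "0 \<le> C" "\<And>m. 0 \<le> u m" "\<And>m. u m \<le> C * exp (\<alpha> * real m)"
    using exp_boundedD [OF assms(1)] by blast
  define r where "r = exp \<alpha>"
  have r: "r > 1" using assms(2) by (simp add: r_def)
  have exp_r: "exp (\<alpha> * real m) = r ^ m" for m
    by (simp add: r_def mult.commute flip: exp_of_nat_mult)
  show ?thesis
  proof (rule exp_boundedI)
    fix m
    have "(\<Sum>s<m. u s) \<le> (\<Sum>s<m. C * r ^ s)"
      using C(3) by (intro sum_mono) (simp add: exp_r)
    also have "\<dots> = C * ((r ^ m - 1) / (r - 1))"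
      using r by (simp add: sum_distrib_left [symmetric] geometric_sum)
    also have "\<dots> \<le> C * (r ^ m / (r - 1))"
      using r C(1) by (intro mult_left_mono divide_right_mono) auto
    finally show "(\<Sum>s<m. u s) \<le> (C / (r - 1)) * exp (\<alpha> * real m)" by (simp add: exp_r)
  qed (use C(2) in \<open>simp add: sum_nonneg\<close>)
qed

lemma exp_bounded_tendsto_0:
  assumes "exp_bounded \<alpha> u" "\<alpha> < 0"
  shows "u \<longlonglongrightarrow> 0"
proof -
  obtain C where C: "\<And>m. 0 \<le> u m" "\<And>m. u m \<le> C * exp (\<alpha> * real m)"
    using exp_boundedD [OF assms(1)] by blast
  have "(\<lambda>m. C * exp \<alpha> ^ m) \<longlonglongrightarrow> 0"
    by (intro tendsto_mult_right_zero LIMSEQ_realpow_zero) (use assms(2) in auto)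
  moreover have "exp (\<alpha> * real m) = exp \<alpha> ^ m" for m
    by (simp add: mult.commute flip: exp_of_nat_mult)
  ultimately have "(\<lambda>m. C * exp (\<alpha> * real m)) \<longlonglongrightarrow> 0" by simp
  thus ?thesis by (rule tendsto_sandwich [OF _ _ tendsto_const, rotated 2]) (use C in auto)
qed

lemma exp_bounded_Cauchy:
  fixes X :: "nat \<Rightarrow> 'a::metric_space"
  assumes "exp_bounded \<alpha> (\<lambda>m. dist (X (Suc m)) (X m))" "\<alpha> < 0"
  shows "Cauchy X"
proof -
  define d where "d m = dist (X (Suc m)) (X m)" for m
  obtain C where C: "\<And>m. d m \<le> C * exp (\<alpha> * real m)"
    unfolding d_def using exp_boundedD [OF assms(1)] by blast
  have "summable (\<lambda>m. C * exp \<alpha> ^ m)"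
    using assms(2) by (intro summable_mult summable_geometric) simp
  moreover have "norm (d m) \<le> C * exp \<alpha> ^ m" for m
    using C [of m] by (simp add: d_def mult.commute flip: exp_of_nat_mult)
  ultimately have "summable d" by (meson summable_comparison_test')
  hence "Cauchy (\<lambda>n. \<Sum>m<n. d m)" by (simp add: summable_iff_convergent convergent_Cauchy)
  moreover have "dist (X m) (X n) \<le> dist (\<Sum>k<m. d k) (\<Sum>k<n. d k)" for m n
  proof -
    have *: "dist (X m) (X n) \<le> (\<Sum>k<n. d k) - (\<Sum>k<m. d k)" if "m \<le> n" for m n
      using that
    proof (induction n rule: dec_induct)
      case (step n)
      thus ?case
        using dist_triangle [of "X m" "X (Suc n)" "X n"] by (simp add: d_def dist_commute)
    qed simp
    show ?thesis
      using * [of m n] * [of n m] by (cases "m \<le> n") (auto simp: dist_real_def dist_commute)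
  qed
  ultimately show ?thesis unfolding Cauchy_def by (meson le_less_trans)
qed

section \<open>Entries of the walk under an absolute value of the rationals\<close>

text \<open>The term l = j of the product is the old entry, because h has ones on the diagonal.
  Applied to a step of the walk, it expresses the increment of phi_ij through phi_il p^(y_l - y_j)
  with l < j, the recursion behind the growth and the decay estimates.\<close>

lemma mult_entry_diff:
  assumes g: "g \<in> carrier (ZUT p n)" and h: "h \<in> carrier (ZUT p n)" and p: "p \<noteq> 0"
    and ij: "i < n" "j < n"
  shows "snd (g \<otimes>\<^bsub>ZUT p n\<^esub> h) $$ (i, j) - snd g $$ (i, j) =
    (\<Sum>l<j. snd g $$ (i, l) * of_nat p powi (fst g $ l - fst g $ j) * snd h $$ (l, j))"
proof -
  have "snd h \<in> carrier_mat n n" using h by (simp add: ZUT_carrier UT_iff)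
  hence "snd (g \<otimes>\<^bsub>ZUT p n\<^esub> h) $$ (i, j) =
      (\<Sum>l<n. snd g $$ (i, l) * of_nat p powi (fst g $ l - fst g $ j) * snd h $$ (l, j))"
    by (simp add: snd_ZUT_mult [OF g _ ij p] col_act_def)
  also have "\<dots> = (\<Sum>l<Suc j. snd g $$ (i, l) * of_nat p powi (fst g $ l - fst g $ j) * snd h $$ (l, j))"
    using ij ZUT_entries [OF h] by (intro sum.mono_neutral_right) auto
  finally show ?thesis using ZUT_entries [OF h ij(2)] by simp
qed

lemma walk_carrier:
  assumes "\<And>k. \<omega> k \<in> carrier (ZUT p n)" "p \<noteq> 0"
  shows "walk (ZUT p n) \<omega> m \<in> carrier (ZUT p n)"
proof -
  interpret G: group "ZUT p n" by (rule group_ZUT [OF assms(2)])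
  show ?thesis using assms(1) by (induction m) auto
qed

text \<open>The real and the p-adic absolute value restricted to the rationals, both obtained from
  \<open>rat_abs_valued_field\<close>.\<close>

locale rat_abs =
  fixes N :: "rat \<Rightarrow> real"
  assumes nonneg [simp]: "0 \<le> N q"
    and zero [simp]: "N 0 = 0"
    and one [simp]: "N 1 = 1"
    and mult: "N (q * r) = N q * N r"
    and triangle: "N (q + r) \<le> N q + N r"
begin

lemma sum_le: "N (sum f A) \<le> (\<Sum>k\<in>A. N (f k))"
proof (induction A rule: infinite_finite_induct)
  case (insert x F)
  thus ?case using triangle [of "f x" "sum f F"] by simp
qed auto

lemma pos: "q \<noteq> 0 \<Longrightarrow> 0 < N q"
  using mult [of q "inverse q"] nonneg [of q] by (cases "N q = 0") (auto simp: less_le)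

lemma power: "N (q ^ k) = N q ^ k"
  by (induction k) (simp_all add: mult)

lemma inverse: "N (inverse q) = inverse (N q)"
proof (cases "q = 0")
  case False
  hence "N q * N (inverse q) = 1" by (simp flip: mult)
  thus ?thesis by (metis inverse_unique)
qed simp

lemma powi_exp:
  assumes "q \<noteq> 0"
  shows "N (q powi z) = exp (ln (N q) * of_int z)"
proof -
  have N: "N q = exp (ln (N q))" using pos [OF assms] by simp
  have "N (q powi z) = N q powi z" by (simp add: power_int_def power inverse)
  also have "\<dots> = exp (ln (N q)) powi z" using N by simp
  also have "\<dots> = exp (of_int z * ln (N q))" by (rule exp_power_int)
  finally show ?thesis by (simp add: mult.commute)
qed

text \<open>Left multiplication by g enlarges entries at most by a factor depending on g: the
  conjugation contributes powers of p with exponents x_k - x_j, which are at most 2 C in absolute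
  value. Iterated along a word, this gives an exponential bound in the word length.\<close>

lemma snd_mult_bound:
  assumes g: "g \<in> carrier (ZUT p n)" and h: "snd h \<in> carrier_mat n n" and p: "p \<noteq> 0"
    and ij: "i < n" "j < n"
    and A: "\<And>k. k < n \<Longrightarrow> N (snd g $$ (i, k)) \<le> A" and C: "\<And>k. k < n \<Longrightarrow> \<bar>fst g $ k\<bar> \<le> C"
    and B: "\<And>k. k < n \<Longrightarrow> N (snd h $$ (k, j)) \<le> B"
  shows "N (snd (g \<otimes>\<^bsub>ZUT p n\<^esub> h) $$ (i, j)) \<le> (real n * A * exp (2 * \<bar>ln (N (of_nat p))\<bar> * C)) * B"
proof -
  let ?c = "ln (N (of_nat p))"
  have A0: "0 \<le> A" using A [OF ij(1)] nonneg order_trans by blast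
  have "N (snd (g \<otimes>\<^bsub>ZUT p n\<^esub> h) $$ (i, j)) \<le>
      (\<Sum>k<n. N (snd g $$ (i, k) * of_nat p powi (fst g $ k - fst g $ j) * snd h $$ (k, j)))"
    unfolding snd_ZUT_mult [OF g h ij p] col_act_def using sum_le by simp
  also have "\<dots> \<le> (\<Sum>k<n. A * exp (2 * \<bar>?c\<bar> * C) * B)"
  proof (rule sum_mono)
    fix k assume k: "k \<in> {..<n}"
    have "\<bar>fst g $ k - fst g $ j\<bar> \<le> 2 * C"
      using C [of k] C [OF ij(2)] k by auto
    hence "of_int \<bar>fst g $ k - fst g $ j\<bar> \<le> (of_int (2 * C) :: real)"
      by (simp only: of_int_le_iff)
    hence "\<bar>?c\<bar> * \<bar>of_int (fst g $ k - fst g $ j)\<bar> \<le> \<bar>?c\<bar> * (2 * of_int C)"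
      by (intro mult_left_mono) auto
    hence "?c * of_int (fst g $ k - fst g $ j) \<le> 2 * \<bar>?c\<bar> * of_int C"
      by (simp add: abs_mult [symmetric] del: of_int_diff)
    thus "N (snd g $$ (i, k) * of_nat p powi (fst g $ k - fst g $ j) * snd h $$ (k, j)) \<le>
        A * exp (2 * \<bar>?c\<bar> * C) * B"
      unfolding mult using A [of k] B [of k] k A0 p
      by (intro mult_mono) (auto simp: powi_exp)
  qed
  finally show ?thesis by (simp add: mult_ac)
qed

text \<open>Coordinates are additive along a word and entries gain a bounded factor per letter. Thus
  a first moment of the word length controls the coordinates and the logarithms of the
  entries.\<close>

lemma word_length_bounds:
  assumes p: "p \<noteq> 0" and S: "finite S" "S \<subseteq> carrier (ZUT p n)"
    "generate (ZUT p n) S = carrier (ZUT p n)"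
  obtains C K :: real where "K > 0"
    "\<And>g i. g \<in> carrier (ZUT p n) \<Longrightarrow> i < n \<Longrightarrow> \<bar>of_int (fst g $ i)\<bar> \<le> C * real (word_length (ZUT p n) S g)"
    "\<And>g i j. g \<in> carrier (ZUT p n) \<Longrightarrow> i < n \<Longrightarrow> j < n \<Longrightarrow>
      N (snd g $$ (i, j)) \<le> exp (K * real (word_length (ZUT p n) S g))"
proof -
  interpret G: group "ZUT p n" by (rule group_ZUT [OF p])
  define V where "V = S \<union> m_inv (ZUT p n) ` S"
  have V: "finite V" "V \<subseteq> carrier (ZUT p n)" using S by (auto simp: V_def)
  \<comment> \<open>The inserted 0, like the 1 in \<open>A\<close>, keeps the maximum defined when
    there are no generators or n = 0.\<close>
  define C where "C = Max (insert 0 ((\<lambda>(g, i). \<bar>fst g $ i\<bar>) ` (V \<times> {..<n})))"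
  have C: "\<bar>fst g $ i\<bar> \<le> C" if "g \<in> V" "i < n" for g i
    unfolding C_def using that V by (intro Max_ge) auto
  have C0: "0 \<le> C" unfolding C_def using V by (intro Max_ge) auto
  define A where "A = Max (insert 1 ((\<lambda>(g, i, j). N (snd g $$ (i, j))) ` (V \<times> {..<n} \<times> {..<n})))"
  have A: "N (snd g $$ (i, j)) \<le> A" if "g \<in> V" "i < n" "j < n" for g i j
    unfolding A_def using that V by (intro Max_ge) force+
  have A1: "1 \<le> A" unfolding A_def using V by (intro Max_ge) auto
  \<comment> \<open>The factor of \<open>snd_mult_bound\<close>, uniform over the letters. Adding 2
    makes E greater than 1 even for n = 0, so that K = ln E is positive and can be divided by
    later.\<close>
  define E where "E = real n * A * exp (2 * \<bar>ln (N (of_nat p))\<bar> * of_int C) + 2"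
  define K where "K = ln E"
  have "0 \<le> real n * A * exp (2 * \<bar>ln (N (of_nat p))\<bar> * of_int C)" using A1 by simp
  hence E0: "E > 1" by (simp add: E_def)
  have K: "K > 0" using E0 by (simp add: K_def)
  have step: "(\<forall>i<n. \<bar>fst g $ i\<bar> \<le> C * int (length ws)) \<and>
      (\<forall>i<n. \<forall>j<n. N (snd g $$ (i, j)) \<le> E ^ length ws)"
    if "set ws \<subseteq> V" "g = foldr (mult (ZUT p n)) ws \<one>\<^bsub>ZUT p n\<^esub>" for ws g
    using that
  proof (induction ws arbitrary: g)
    case Nil
    thus ?case by (auto simp: ZUT_one)
  next
    case (Cons v ws)
    define h where "h = foldr (mult (ZUT p n)) ws \<one>\<^bsub>ZUT p n\<^esub>"
    have IH: "\<And>i. i < n \<Longrightarrow> \<bar>fst h $ i\<bar> \<le> C * int (length ws)"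
      "\<And>i j. i < n \<Longrightarrow> j < n \<Longrightarrow> N (snd h $$ (i, j)) \<le> E ^ length ws"
      using Cons.IH [of h] Cons.prems by (auto simp: h_def)
    have g: "g = v \<otimes>\<^bsub>ZUT p n\<^esub> h" using Cons.prems by (simp add: h_def)
    have v: "v \<in> V" "v \<in> carrier (ZUT p n)" using Cons.prems V by auto
    have "set ws \<subseteq> carrier (ZUT p n)" using Cons.prems V by auto
    hence h: "h \<in> carrier (ZUT p n)" unfolding h_def by (induction ws) auto
    hence h': "snd h \<in> carrier_mat n n" "fst h \<in> carrier_vec n"
      by (auto simp: ZUT_carrier UT_iff)
    show ?case
    proof (intro conjI allI impI)
      fix i assume i: "i < n"
      have "\<bar>fst g $ i\<bar> \<le> \<bar>fst v $ i\<bar> + \<bar>fst h $ i\<bar>"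
        using i h' by (simp add: g fst_ZUT_mult)
      also have "\<dots> \<le> C + C * int (length ws)" by (intro add_mono C IH v i)
      finally show "\<bar>fst g $ i\<bar> \<le> C * int (length (v # ws))" by (simp add: algebra_simps)
      fix j assume j: "j < n"
      have "N (snd g $$ (i, j)) \<le>
          (real n * A * exp (2 * \<bar>ln (N (of_nat p))\<bar> * of_int C)) * E ^ length ws"
        unfolding g by (rule snd_mult_bound [OF v(2) h'(1) p i j]) (use A C IH v i j in auto)
      also have "\<dots> \<le> E * E ^ length ws"
        using E0 by (intro mult_right_mono) (auto simp: E_def)
      finally show "N (snd g $$ (i, j)) \<le> E ^ length (v # ws)" by simp
    qed
  qed
  have E_exp: "E ^ k = exp (K * real k)" for k
    using E0 by (simp add: K_def mult.commute [of "ln E"] exp_of_nat_mult)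
  have *: "(\<forall>i<n. \<bar>fst g $ i\<bar> \<le> C * int (word_length (ZUT p n) S g)) \<and>
      (\<forall>i<n. \<forall>j<n. N (snd g $$ (i, j)) \<le> E ^ word_length (ZUT p n) S g)"
    if g: "g \<in> carrier (ZUT p n)" for g
  proof -
    obtain ws where "length ws = word_length (ZUT p n) S g" "set ws \<subseteq> S \<union> m_inv (ZUT p n) ` S"
      "foldr (mult (ZUT p n)) ws \<one>\<^bsub>ZUT p n\<^esub> = g"
      by (rule G.word_length_word [OF S(2,3) g])
    thus ?thesis using step [of ws g] by (simp add: V_def)
  qed
  show ?thesis
  proof (rule that [OF K])
    fix g i assume g: "g \<in> carrier (ZUT p n)" and i: "i < n"
    have "of_int \<bar>fst g $ i\<bar> \<le> (of_int (C * int (word_length (ZUT p n) S g)) :: real)"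
      unfolding of_int_le_iff using * [OF g] i by blast
    thus "\<bar>of_int (fst g $ i)\<bar> \<le> of_int C * real (word_length (ZUT p n) S g)" by simp
    fix j assume "j < n"
    thus "N (snd g $$ (i, j)) \<le> exp (K * real (word_length (ZUT p n) S g))"
      using * [OF g] i by (simp add: E_exp)
  qed
qed


text \<open>
  The quantities \<open>N (\<phi>\<^sub>i\<^sub>k) N(p)\<^bsup>y\<^sub>k\<^esup>\<close> are the entries of the product of the triangular
  matrices \<open>f X\<close>; they grow at most like the largest diagonal entry, whose exponent is at most \<open>\<Lambda>\<close>.
\<close>

lemma walk_entry_growth:
  fixes n p :: nat and \<omega> :: "nat \<Rightarrow> int vec \<times> rat mat" and v :: "nat \<Rightarrow> real"
  defines "R \<equiv> walk (ZUT p n) \<omega>" and "c \<equiv> ln (N (of_nat p))"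
  assumes p: "p \<noteq> 0" and \<omega>: "\<And>m. \<omega> m \<in> carrier (ZUT p n)" and j: "j \<le> n"
    and drift: "\<And>i t \<beta>. i < n \<Longrightarrow> t * v i < \<beta> \<Longrightarrow>
      exp_bounded \<beta> (\<lambda>m. exp (t * of_int (fst (R m) $ i)))"
    and entries: "\<And>i k e. i < n \<Longrightarrow> k < n \<Longrightarrow> e > 0 \<Longrightarrow>
      exp_bounded e (\<lambda>m. N (snd (\<omega> m) $$ (i, k)))"
    and \<Lambda>: "\<And>k. k < j \<Longrightarrow> c * v k \<le> \<Lambda>" and i: "i < n"
    and kj: "k < j" and \<alpha>: "\<alpha> > \<Lambda>"
  shows "exp_bounded \<alpha> (\<lambda>m. N (snd (R m) $$ (i, k)) * exp (c * of_int (fst (R m) $ k)))"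
  using kj \<alpha>
proof (induction k arbitrary: \<alpha> rule: less_induct)
  case (less k)
  have Rm: "R m \<in> carrier (ZUT p n)" for m unfolding R_def by (rule walk_carrier [OF \<omega> p])
  define u where "u l m = N (snd (R m) $$ (i, l)) * exp (c * of_int (fst (R m) $ l))" for l m
  define d where "d m = (\<Sum>l<k. u l m * exp (- c * of_int (fst (R m) $ k)) * N (snd (\<omega> m) $$ (l, k)))" for m
  have kn: "k < n" using less.prems j by simp
  have "N (snd (R (Suc m)) $$ (i, k) - snd (R m) $$ (i, k)) \<le> d m" for m
  proof -
    have "N (snd (R (Suc m)) $$ (i, k) - snd (R m) $$ (i, k)) \<le>
       (\<Sum>l<k. N (snd (R m) $$ (i, l) * of_nat p powi (fst (R m) $ l - fst (R m) $ k) * snd (\<omega> m) $$ (l, k)))"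
      using mult_entry_diff [OF Rm \<omega> p i kn] sum_le by (simp add: R_def)
    also have "\<dots> = d m"
      unfolding d_def u_def using p
      by (intro sum.cong refl) (simp add: mult powi_exp c_def algebra_simps flip: exp_add)
    finally show ?thesis .
  qed
  hence step: "N (snd (R (Suc m)) $$ (i, k)) \<le> N (snd (R m) $$ (i, k)) + d m" for m
    using triangle [of "snd (R m) $$ (i, k)" "snd (R (Suc m)) $$ (i, k) - snd (R m) $$ (i, k)"]
    by (smt (verit) add_diff_cancel_left' add_diff_eq)
  \<comment> \<open>The 1 bounds the entries 0 and 1 of the identity, where the walk starts.\<close>
  have phi_le: "N (snd (R m) $$ (i, k)) \<le> 1 + (\<Sum>s<m. d s)" for m
  proof (induction m)
    case 0
    show ?case using i kn by (simp add: R_def ZUT_one)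
  next
    case (Suc m)
    thus ?case using step [of m] by simp
  qed
  \<comment> \<open>The rate \<alpha>' for the earlier columns lies halfway between \<Lambda> and
    \<alpha>. The remaining gap is split into three parts: one for each of the factors exp (- c y_k)
    and exp (c y_k), one for the entries of the increment.\<close>
  define \<alpha>' where "\<alpha>' = (\<alpha> + \<Lambda>) / 2"
  define e where "e = (\<alpha> - \<alpha>') / 3"
  have \<alpha>': "\<alpha>' > \<Lambda>" and e: "e > 0" using less.prems by (auto simp: \<alpha>'_def e_def)
  define \<beta> where "\<beta> = \<alpha>' + (- c * v k + e) + e"
  \<comment> \<open>Positive since c v_k \<le> \<Lambda> < \<alpha>'. Summing the increments
    therefore does not raise the rate.\<close>
  have \<beta>: "\<beta> > 0" using \<Lambda> [of k] less.prems \<alpha>' e by (simp add: \<beta>_def)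
  have "exp_bounded \<beta> d"
    unfolding d_def \<beta>_def
  proof (intro exp_bounded_sum exp_bounded_mult)
    fix l assume l: "l \<in> {..<k}"
    show "exp_bounded \<alpha>' (u l)"
      unfolding u_def by (rule less.IH) (use l less.prems \<alpha>' in auto)
    show "exp_bounded (- c * v k + e) (\<lambda>m. exp (- c * of_int (fst (R m) $ k)))"
      by (rule drift [OF kn]) (use e in simp)
    show "exp_bounded e (\<lambda>m. N (snd (\<omega> m) $$ (l, k)))"
      by (rule entries) (use l kn e in auto)
  qed simp
  hence "exp_bounded \<beta> (\<lambda>m. 1 + (\<Sum>s<m. d s))"
    using \<beta> by (intro exp_bounded_add exp_bounded_const exp_bounded_partial_sums) auto
  hence "exp_bounded \<beta> (\<lambda>m. N (snd (R m) $$ (i, k)))"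
    by (rule exp_bounded_le) (use phi_le in auto)
  hence "exp_bounded (\<beta> + (c * v k + e)) (\<lambda>m. N (snd (R m) $$ (i, k)) * exp (c * of_int (fst (R m) $ k)))"
    by (rule exp_bounded_mult) (rule drift [OF kn], use e in simp)
  moreover have "\<beta> + (c * v k + e) = \<alpha>" by (simp add: \<beta>_def e_def field_simps)
  ultimately show ?case by simp
qed

lemma walk_column_decay:
  fixes n p :: nat and \<omega> :: "nat \<Rightarrow> int vec \<times> rat mat" and v :: "nat \<Rightarrow> real"
  defines "R \<equiv> walk (ZUT p n) \<omega>" and "c \<equiv> ln (N (of_nat p))"
  assumes p: "p \<noteq> 0" and \<omega>: "\<And>m. \<omega> m \<in> carrier (ZUT p n)" and j: "j < n"
    and drift: "\<And>i t \<beta>. i < n \<Longrightarrow> t * v i < \<beta> \<Longrightarrow>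
      exp_bounded \<beta> (\<lambda>m. exp (t * of_int (fst (R m) $ i)))"
    and entries: "\<And>i k e. i < n \<Longrightarrow> k < n \<Longrightarrow> e > 0 \<Longrightarrow>
      exp_bounded e (\<lambda>m. N (snd (\<omega> m) $$ (i, k)))"
    and contr: "\<And>k. k < j \<Longrightarrow> c * v k < c * v j"
  shows "\<exists>\<gamma><0. \<forall>i<n.
    (\<forall>k<j. exp_bounded \<gamma> (\<lambda>m. N (snd (R m) $$ (i, k) * of_nat p powi (fst (R m) $ k - fst (R m) $ j)))) \<and>
    exp_bounded \<gamma> (\<lambda>m. N (snd (R (Suc m)) $$ (i, j) - snd (R m) $$ (i, j)))"
proof -
  have Rm: "R m \<in> carrier (ZUT p n)" for m unfolding R_def by (rule walk_carrier [OF \<omega> p])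
  \<comment> \<open>The inserted value keeps the maximum defined for j = 0 and lies below c
    v_j.\<close>
  define \<Lambda> where "\<Lambda> = Max (insert (c * v j - 1) ((\<lambda>k. c * v k) ` {..<j}))"
  have \<Lambda>: "c * v k \<le> \<Lambda>" if "k < j" for k unfolding \<Lambda>_def using that by (intro Max_ge) auto
  have "\<Lambda> < c * v j" unfolding \<Lambda>_def using contr by (subst Max_less_iff) auto
  \<comment> \<open>A quarter of the gap between the exponents: two quarters are spent on the growth
    of the entry and the drift of y_j, a third on the entries of the increment, and rate - e
    remains.\<close>
  define e where "e = (c * v j - \<Lambda>) / 4"
  have e: "e > 0" using \<open>\<Lambda> < c * v j\<close> by (simp add: e_def)
  have 1: "exp_bounded (- 2 * e) (\<lambda>m. N (snd (R m) $$ (i, k) * of_nat p powi (fst (R m) $ k - fst (R m) $ j)))"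
    if i: "i < n" and k: "k < j" for i k
  proof -
    have "exp_bounded (\<Lambda> + e + (- c * v j + e)) (\<lambda>m. N (snd (R m) $$ (i, k)) *
        exp (c * of_int (fst (R m) $ k)) * exp (- c * of_int (fst (R m) $ j)))"
    proof (rule exp_bounded_mult)
      show "exp_bounded (\<Lambda> + e) (\<lambda>m. N (snd (R m) $$ (i, k)) * exp (c * of_int (fst (R m) $ k)))"
        unfolding R_def c_def
        by (rule walk_entry_growth [OF p \<omega> less_imp_le [OF j] drift [unfolded R_def] entries _ i k])
          (use \<Lambda> e in \<open>auto simp: c_def\<close>)
      show "exp_bounded (- c * v j + e) (\<lambda>m. exp (- c * of_int (fst (R m) $ j)))"
        by (rule drift [OF j]) (use e in simp)
    qed
    moreover have "\<Lambda> + e + (- c * v j + e) = - 2 * e" by (simp add: e_def field_simps)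
    moreover have "N (snd (R m) $$ (i, k) * of_nat p powi (fst (R m) $ k - fst (R m) $ j)) =
        N (snd (R m) $$ (i, k)) * exp (c * of_int (fst (R m) $ k)) * exp (- c * of_int (fst (R m) $ j))" for m
      using p by (simp add: mult powi_exp c_def algebra_simps flip: exp_add)
    ultimately show ?thesis by (simp only:)
  qed
  have 2: "exp_bounded (- e) (\<lambda>m. N (snd (R (Suc m)) $$ (i, j) - snd (R m) $$ (i, j)))"
    if i: "i < n" for i
  proof (rule exp_bounded_le)
    show "exp_bounded (- e) (\<lambda>m. \<Sum>l<j.
        N (snd (R m) $$ (i, l) * of_nat p powi (fst (R m) $ l - fst (R m) $ j)) * N (snd (\<omega> m) $$ (l, j)))"
    proof (rule exp_bounded_sum)
      fix l assume l: "l \<in> {..<j}"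
      have "exp_bounded (- 2 * e + e) (\<lambda>m.
        N (snd (R m) $$ (i, l) * of_nat p powi (fst (R m) $ l - fst (R m) $ j)) * N (snd (\<omega> m) $$ (l, j)))"
        by (intro exp_bounded_mult 1 entries) (use i j l e in auto)
      thus "exp_bounded (- e) (\<lambda>m.
        N (snd (R m) $$ (i, l) * of_nat p powi (fst (R m) $ l - fst (R m) $ j)) * N (snd (\<omega> m) $$ (l, j)))"
        by simp
    qed simp
    show "N (snd (R (Suc m)) $$ (i, j) - snd (R m) $$ (i, j)) \<le> (\<Sum>l<j.
        N (snd (R m) $$ (i, l) * of_nat p powi (fst (R m) $ l - fst (R m) $ j)) * N (snd (\<omega> m) $$ (l, j)))" for m
      using mult_entry_diff [OF Rm [of m] \<omega> [of m] p i j] sum_le by (simp add: R_def flip: mult)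
  qed auto
  show ?thesis
  proof (intro exI [of _ "- e"] conjI allI impI)
    fix i k assume "i < n" "k < j"
    thus "exp_bounded (- e) (\<lambda>m. N (snd (R m) $$ (i, k) * of_nat p powi (fst (R m) $ k - fst (R m) $ j)))"
      using e by (intro exp_bounded_le [OF 1]) auto
  qed (use e 2 in auto)
qed

end

lemma rat_abs_valued_field: "rat_abs (\<lambda>q. dist (of_rat q) (0 :: 'a::valued_field))"
  by standard (simp_all add: of_rat_mult of_rat_add dist_mult_0 dist_1_0 dist_add_0)

section \<open>Topology and measurability\<close>

lemma tendsto_funI:
  fixes f :: "'a \<Rightarrow> 'b \<Rightarrow> 'c::topological_space"
  assumes "\<And>i. ((\<lambda>x. f x i) \<longlongrightarrow> l i) F"
  shows "(f \<longlongrightarrow> l) F"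
proof -
  have "limitin (product_topology (\<lambda>_. euclidean) UNIV) f l F"
    using assms by (simp add: limitin_componentwise)
  thus ?thesis by (simp add: euclidean_product_topology)
qed

lemma second_countable_euclidean:
  "second_countable (euclidean :: 'a::second_countable_topology topology)"
proof -
  obtain B :: "'a set set" where "countable B" "topological_basis B" using ex_countable_basis by blast
  thus ?thesis
    unfolding second_countable_def
    using topological_basis_open topological_basisE by (metis open_openin)
qed

section \<open>Borel sets of a topology\<close>

lemma space_borel_of [simp]: "space (borel_of T) = topspace T"
  unfolding borel_of_def by (rule space_measure_of) (auto dest: openin_subset)

lemma sets_borel_of: "sets (borel_of T) = sigma_sets (topspace T) {U. openin T U}"
  unfolding borel_of_def by (rule sets_measure_of) (auto dest: openin_subset)

lemma measurable_borel_of: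
  assumes "f \<in> space M \<rightarrow> topspace T" "\<And>U. openin T U \<Longrightarrow> f -` U \<inter> space M \<in> sets M"
  shows "f \<in> M \<rightarrow>\<^sub>M borel_of T"
  unfolding borel_of_def by (rule measurable_measure_of) (use assms in \<open>auto dest: openin_subset\<close>)

lemma continuous_map_measurable_borel_of:
  assumes "continuous_map T T' f"
  shows "f \<in> borel_of T \<rightarrow>\<^sub>M borel_of T'"
proof (rule measurable_borel_of)
  show "f \<in> space (borel_of T) \<rightarrow> topspace T'"
    using continuous_map_image_subset_topspace [OF assms] by auto
  fix U assume "openin T' U"
  hence "openin T {x \<in> topspace T. f x \<in> U}" by (rule openin_continuous_map_preimage [OF assms])
  moreover have "f -` U \<inter> space (borel_of T) = {x \<in> topspace T. f x \<in> U}" by auto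
  ultimately show "f -` U \<inter> space (borel_of T) \<in> sets (borel_of T)"
    by (auto simp: sets_borel_of)
qed

lemma borel_of_euclidean: "borel_of euclidean = borel"
  by (simp add: borel_of_def borel_def)

lemma measurable_borel_of_top_of_set:
  assumes "f \<in> space M \<rightarrow> A" "f \<in> borel_measurable M"
  shows "f \<in> M \<rightarrow>\<^sub>M borel_of (top_of_set A)"
proof (rule measurable_borel_of)
  fix U assume "openin (top_of_set A) U"
  then obtain V where V: "open V" "U = A \<inter> V" by (auto simp: openin_open)
  have "f -` U \<inter> space M = f -` V \<inter> space M" using assms(1) V(2) by auto
  thus "f -` U \<inter> space M \<in> sets M"
    using measurable_sets [OF assms(2), of V] V(1) by simp
qed (use assms in auto)

text \<open>Singletons are open in the discrete factor, so a neighbourhood can be taken inside a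
  single slice.\<close>

lemma continuous_map_prod_discrete:
  assumes "\<And>x. x \<in> A \<Longrightarrow> continuous_map T T' (f x)"
  shows "continuous_map (prod_topology (discrete_topology A) T) T' (\<lambda>(x, y). f x y)"
  unfolding continuous_map_def
proof (intro conjI allI impI)
  show "(\<lambda>(x, y). f x y) \<in> topspace (prod_topology (discrete_topology A) T) \<rightarrow> topspace T'"
    using continuous_map_image_subset_topspace [OF assms] by fastforce
  fix U assume U: "openin T' U"
  show "openin (prod_topology (discrete_topology A) T)
      {z \<in> topspace (prod_topology (discrete_topology A) T). (case z of (x, y) \<Rightarrow> f x y) \<in> U}"
    unfolding openin_prod_topology_alt
  proof (intro allI impI)
    fix x y
    assume xy: "(x, y) \<in> {z \<in> topspace (prod_topology (discrete_topology A) T). (case z of (x, y) \<Rightarrow> f x y) \<in> U}"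
    hence "openin T {y \<in> topspace T. f x y \<in> U}"
      using openin_continuous_map_preimage [OF assms U] by simp
    thus "\<exists>V W. openin (discrete_topology A) V \<and> openin T W \<and> x \<in> V \<and> y \<in> W \<and>
        V \<times> W \<subseteq> {z \<in> topspace (prod_topology (discrete_topology A) T). (case z of (x, y) \<Rightarrow> f x y) \<in> U}"
      using xy by (intro exI [of _ "{x}"] exI [of _ "{y \<in> topspace T. f x y \<in> U}"]) auto
  qed
qed

lemma tendsto_col_act:
  fixes l :: "nat \<Rightarrow> 'a::valued_field"
  assumes "\<And>k. k < n \<Longrightarrow> ((\<lambda>x. c x k) \<longlongrightarrow> l k) F"
  shows "((\<lambda>x. col_act p n g j (c x) i) \<longlongrightarrow> col_act p n g j l i) F"
  unfolding col_act_def by (intro tendsto_sum tendsto_mult_const assms) auto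

lemma continuous_on_col_act:
  fixes c :: "'b::topological_space \<Rightarrow> nat \<Rightarrow> 'a::valued_field"
  assumes "\<And>k. k < n \<Longrightarrow> continuous_on A (\<lambda>x. c x k)"
  shows "continuous_on A (\<lambda>x. col_act p n g j (c x) i)"
  using assms unfolding continuous_on_def by (auto intro: tendsto_col_act)

lemma of_rat_col_act:
  "of_rat (col_act p n g j c i) = (col_act p n g j (\<lambda>k. of_rat (c k)) i :: 'a::field_char_0)"
  by (simp add: col_act_def of_rat_sum of_rat_mult of_rat_of_nat_powi)

section \<open>The action\<close>

lemma mixed_act_Real:
  assumes g: "g \<in> carrier (ZUT p n)" and b: "b \<in> mixed_UT n D" and p: "p \<noteq> 0"
    and ij: "i < j" "j < n" "D i j < 0"
  shows "mixed_act p n D g b i j = Real_Entry (col_act p n g j (\<lambda>k. real_of_entry (b k j)) i)"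
proof -
  have c: "fst g \<in> carrier_vec n" "snd g \<in> carrier_mat n n"
    using g by (auto simp: ZUT_carrier UT_iff)
  have "i < n" using ij by simp
  from col_act_matrix [OF c this ij(2) p, of "\<lambda>(k, l). real_of_entry (b k l)"] show ?thesis
    using b ij by (simp add: mixed_act_def case_prod_unfold)
qed

lemma mixed_act_Padic:
  fixes b :: "nat \<Rightarrow> nat \<Rightarrow> 'p::prime_card entry"
  assumes g: "g \<in> carrier (ZUT p n)" and b: "b \<in> mixed_UT n D" and p: "p \<noteq> 0"
    and ij: "i < j" "j < n" "\<not> D i j < 0"
  shows "mixed_act p n D g b i j = Padic_Entry (col_act p n g j (\<lambda>k. padic_of_entry (b k j)) i)"
proof -
  have c: "fst g \<in> carrier_vec n" "snd g \<in> carrier_mat n n"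
    using g by (auto simp: ZUT_carrier UT_iff)
  have "i < n" using ij by simp
  from col_act_matrix [OF c this ij(2) p, of "\<lambda>(k, l). padic_of_entry (b k l)"] show ?thesis
    using b ij by (simp add: mixed_act_def case_prod_unfold)
qed

lemma mixed_act_other:
  "b \<in> mixed_UT n D \<Longrightarrow> \<not> (i < j \<and> j < n) \<Longrightarrow> mixed_act p n D g b i j = b i j"
  by (auto simp: mixed_act_def case_prod_unfold)

lemma mixed_UT_other:
  "b \<in> mixed_UT n D \<Longrightarrow> \<not> (i < j \<and> j < n) \<Longrightarrow> b i j = Rat_Entry (if i = j \<and> j < n then 1 else 0)"
  by (auto simp: mixed_UT_def)

text \<open>Needed for composing actions: after one action the column is read again in the reals. As
  the whole column is real, no entry is replaced by the default 0, and the diagonal and lower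
  entries agree by \<open>col_act_diag\<close> and \<open>col_act_below\<close>.\<close>

lemma real_column_mixed_act:
  assumes g: "g \<in> carrier (ZUT p n)" and b: "b \<in> mixed_UT n D" and p: "p \<noteq> 0"
    and D: "\<And>i. i < j \<Longrightarrow> D i j < 0" and kj: "k < n" "j < n"
  shows "real_of_entry (mixed_act p n D g b k j) = col_act p n g j (\<lambda>k. real_of_entry (b k j)) k"
proof (cases k j rule: linorder_cases)
  case less
  thus ?thesis using mixed_act_Real [OF g b p less kj(2) D] by simp
next
  case equal
  thus ?thesis using mixed_UT_other [OF b] kj
    by (simp add: mixed_act_other [OF b] col_act_diag [OF g kj(2)])
next
  case greater
  thus ?thesis using mixed_UT_other [OF b] kj
    by (simp add: mixed_act_other [OF b] col_act_below [OF g greater kj(1)])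
qed

lemma padic_column_mixed_act:
  assumes g: "g \<in> carrier (ZUT p n)" and b: "b \<in> mixed_UT n D" and p: "p \<noteq> 0"
    and D: "\<And>i. i < j \<Longrightarrow> \<not> D i j < 0" and kj: "k < n" "j < n"
  shows "padic_of_entry (mixed_act p n D g b k j) = col_act p n g j (\<lambda>k. padic_of_entry (b k j)) k"
proof (cases k j rule: linorder_cases)
  case less
  thus ?thesis using mixed_act_Padic [OF g b p less kj(2) D] by simp
next
  case equal
  thus ?thesis using mixed_UT_other [OF b] kj
    by (simp add: mixed_act_other [OF b] col_act_diag [OF g kj(2)])
next
  case greater
  thus ?thesis using mixed_UT_other [OF b] kj
    by (simp add: mixed_act_other [OF b] col_act_below [OF g greater kj(1)])
qed

text \<open>The parameter \<open>ty\<close> fixes the type variable \<open>'p\<close>, which the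
  other parameters do not mention.\<close>

locale mixed_columns =
  fixes p n :: nat and D :: "nat \<Rightarrow> nat \<Rightarrow> real" and ty :: "'p::prime_card itself"
  assumes p: "p \<noteq> 0" and nonzero: "nonzero_displacement n D" and cc: "column_consistent n D"
begin

abbreviation "G \<equiv> ZUT p n"
abbreviation \<Gamma> :: "(nat \<Rightarrow> nat \<Rightarrow> 'p entry) set" where "\<Gamma> \<equiv> mixed_UT n D"
abbreviation act :: "int vec \<times> rat mat \<Rightarrow> (nat \<Rightarrow> nat \<Rightarrow> 'p entry) \<Rightarrow> (nat \<Rightarrow> nat \<Rightarrow> 'p entry)"
  where "act \<equiv> mixed_act p n D"

text \<open>Column consistency carries the non-zero sign of the topmost entry to the whole column;
  for j = 0 both alternatives hold vacuously.\<close>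

lemma column_cases [consumes 1, case_names real padic]:
  assumes "j < n"
  obtains "\<And>i. i < j \<Longrightarrow> D i j < 0" | "\<And>i. i < j \<Longrightarrow> 0 < D i j"
proof (cases "j = 0")
  case False
  have sgn: "sgn (D i j) = sgn (D 0 j)" if "i < j" for i
    using cc assms that False unfolding column_consistent_def by blast
  have "D 0 j \<noteq> 0" using nonzero assms False unfolding nonzero_displacement_def by simp
  then consider "D 0 j < 0" | "0 < D 0 j" by linarith
  thus ?thesis
  proof cases
    case 1
    have "D i j < 0" if "i < j" for i
      unfolding sgn_less [of "D i j", symmetric] sgn [OF that] using 1 by (simp only: sgn_less)
    thus ?thesis by (rule that(1))
  next
    case 2
    have "0 < D i j" if "i < j" for i
      unfolding sgn_greater [of "D i j", symmetric] sgn [OF that] using 2 by (simp only: sgn_greater)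
    thus ?thesis by (rule that(2))
  qed
qed (use that in simp)

lemma mixed_entry_eqI:
  assumes "\<And>i j. \<lbrakk>i < j; j < n; D i j < 0; \<And>k. k < j \<Longrightarrow> D k j < 0\<rbrakk> \<Longrightarrow> a i j = b i j"
    and "\<And>i j. \<lbrakk>i < j; j < n; \<not> D i j < 0; \<And>k. k < j \<Longrightarrow> \<not> D k j < 0\<rbrakk> \<Longrightarrow> a i j = b i j"
    and "\<And>i j. \<not> (i < j \<and> j < n) \<Longrightarrow> a i j = b i j"
  shows "a = b"
proof (intro ext)
  fix i j
  show "a i j = b i j"
  proof (cases "i < j \<and> j < n")
    case True
    hence "j < n" by simp
    thus ?thesis
    proof (cases j rule: column_cases)
      case real
      show ?thesis by (rule assms(1)) (use True real in simp_all)
    next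
      case padic
      show ?thesis by (rule assms(2)) (use True padic in \<open>simp_all add: less_imp_le not_less\<close>)
    qed
  qed (rule assms(3))
qed

lemma act_closed:
  assumes g: "g \<in> carrier G" and b: "b \<in> \<Gamma>"
  shows "act g b \<in> \<Gamma>"
  unfolding mixed_UT_def
  using mixed_act_Real [OF g b p] mixed_act_Padic [OF g b p] mixed_act_other [OF b] mixed_UT_other [OF b]
    nonzero
  by (auto simp: nonzero_displacement_def)

lemma act_one:
  assumes b: "b \<in> \<Gamma>"
  shows "act \<one>\<^bsub>G\<^esub> b = b"
proof (rule mixed_entry_eqI)
  interpret G: group G by (rule group_ZUT [OF p])
  fix i j
  show "act \<one>\<^bsub>G\<^esub> b i j = b i j" if "i < j" "j < n" "D i j < 0"
  proof -
    have "b i j \<in> range Real_Entry" using b that by (auto simp: mixed_UT_def)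
    thus ?thesis using that by (auto simp: mixed_act_Real [OF _ b p] col_act_one)
  qed
  show "act \<one>\<^bsub>G\<^esub> b i j = b i j" if "i < j" "j < n" "\<not> D i j < 0"
  proof -
    have "D i j \<noteq> 0" using nonzero that by (auto simp: nonzero_displacement_def)
    hence "b i j \<in> range Padic_Entry" using b that by (auto simp: mixed_UT_def)
    thus ?thesis using that by (auto simp: mixed_act_Padic [OF _ b p] col_act_one)
  qed
qed (simp add: mixed_act_other [OF b])

lemma act_mult:
  assumes g: "g \<in> carrier G" and h: "h \<in> carrier G" and b: "b \<in> \<Gamma>"
  shows "act (g \<otimes>\<^bsub>G\<^esub> h) b = act g (act h b)"
proof (rule mixed_entry_eqI)
  note gh = ZUT_mult_closed [OF g h p] and hb = act_closed [OF h b]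
  fix i j
  show "act (g \<otimes>\<^bsub>G\<^esub> h) b i j = act g (act h b) i j"
    if "i < j" "j < n" "D i j < 0" "\<And>k. k < j \<Longrightarrow> D k j < 0"
    using that
    by (auto simp: mixed_act_Real [OF gh b p] mixed_act_Real [OF g hb p] col_act_mult [OF g h p]
      real_column_mixed_act [OF h b p] intro!: col_act_cong)
  show "act (g \<otimes>\<^bsub>G\<^esub> h) b i j = act g (act h b) i j"
    if "i < j" "j < n" "\<not> D i j < 0" "\<And>k. k < j \<Longrightarrow> \<not> D k j < 0"
    using that
    by (auto simp: mixed_act_Padic [OF gh b p] mixed_act_Padic [OF g hb p] col_act_mult [OF g h p]
      padic_column_mixed_act [OF h b p] intro!: col_act_cong)
  show "act (g \<otimes>\<^bsub>G\<^esub> h) b i j = act g (act h b) i j" if "\<not> (i < j \<and> j < n)"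
    using that by (simp add: mixed_act_other [OF b] mixed_act_other [OF hb])
qed

lemma group_action_act: "group_action G \<Gamma> act"
proof -
  interpret G: group G by (rule group_ZUT [OF p])
  have Bij: "act g \<in> Bij \<Gamma>" if g: "g \<in> carrier G" for g
  proof -
    have "bij_betw (act g) \<Gamma> \<Gamma>"
    proof (rule bij_betwI [where g = "act (inv\<^bsub>G\<^esub> g)"])
      show "act (inv\<^bsub>G\<^esub> g) (act g b) = b" if "b \<in> \<Gamma>" for b
        using act_mult [of "inv\<^bsub>G\<^esub> g" g b] g that act_one by simp
      show "act g (act (inv\<^bsub>G\<^esub> g) b) = b" if "b \<in> \<Gamma>" for b
        using act_mult [of g "inv\<^bsub>G\<^esub> g" b] g that act_one by simp
    qed (use g act_closed in auto)
    \<comment> \<open>Members of \<open>Bij\<close> are extensional, which is why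
      \<open>mixed_act\<close> is restricted to the space of matrices.\<close>
    moreover have "act g \<in> extensional \<Gamma>" by (simp add: mixed_act_def case_prod_unfold)
    ultimately show ?thesis by (simp add: Bij_def)
  qed
  have "act \<in> hom G (BijGroup \<Gamma>)"
  proof (rule homI)
    show "act g \<in> carrier (BijGroup \<Gamma>)" if "g \<in> carrier G" for g
      using Bij [OF that] by (simp add: BijGroup_def)
    fix g h assume g: "g \<in> carrier G" and h: "h \<in> carrier G"
    have "act (g \<otimes>\<^bsub>G\<^esub> h) = compose \<Gamma> (act g) (act h)"
    proof
      fix b
      show "act (g \<otimes>\<^bsub>G\<^esub> h) b = compose \<Gamma> (act g) (act h) b"
        using act_mult [OF g h] by (cases "b \<in> \<Gamma>") (auto simp: compose_def mixed_act_def case_prod_unfold)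
    qed
    thus "act (g \<otimes>\<^bsub>G\<^esub> h) = act g \<otimes>\<^bsub>BijGroup \<Gamma>\<^esub> act h"
      using Bij g h by (simp add: BijGroup_def)
  qed
  thus ?thesis
    by (intro group_action.intro group_hom.intro group_hom_axioms.intro G.is_group group_BijGroup)
qed

lemma continuous_map_act:
  assumes g: "g \<in> carrier G"
  shows "continuous_map (top_of_set \<Gamma>) (top_of_set \<Gamma>) (act g)"
proof -
  have entry: "continuous_on A (\<lambda>b. b i j)" for A :: "(nat \<Rightarrow> nat \<Rightarrow> 'p entry) set" and i j
    by (rule continuous_on_product_then_coordinatewise
      [OF continuous_on_product_then_coordinatewise [OF continuous_on_id]])
  have "continuous_on \<Gamma> (\<lambda>b. act g b i j)" for i j
  proof (cases "i < j \<and> j < n")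
    case True
    show ?thesis
    proof (cases "D i j < 0")
      case neg: True
      have "continuous_on \<Gamma> (\<lambda>b. Real_Entry (col_act p n g j (\<lambda>k. real_of_entry (b k j)) i) :: 'p entry)"
        by (intro continuous_on_compose2 [OF continuous_on_Real_Entry [of UNIV]] continuous_on_col_act
          continuous_on_compose2 [OF continuous_on_real_of_entry [of UNIV]] entry) auto
      thus ?thesis
        using True neg by (subst continuous_on_cong [OF refl mixed_act_Real [OF g _ p]]) auto
    next
      case pos: False
      have "continuous_on \<Gamma> (\<lambda>b. Padic_Entry (col_act p n g j (\<lambda>k. padic_of_entry (b k j)) i))"
        by (intro continuous_on_compose2 [OF continuous_on_Padic_Entry [of UNIV]] continuous_on_col_act
          continuous_on_compose2 [OF continuous_on_padic_of_entry [of UNIV]] entry) auto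
      thus ?thesis
        using True pos by (subst continuous_on_cong [OF refl mixed_act_Padic [OF g _ p]]) auto
    qed
  next
    case False
    thus ?thesis
      using entry by (subst continuous_on_cong [OF refl mixed_act_other]) auto
  qed
  hence "continuous_on \<Gamma> (act g)"
    by (intro continuous_on_coordinatewise_then_product)
  thus ?thesis using act_closed [OF g] by auto
qed

lemma G_space_act: "G_space G (top_of_set \<Gamma>) act"
  unfolding G_space_def
  using group_action_act continuous_map_prod_discrete [OF continuous_map_act] by simp

lemma second_countable_mixed_UT: "second_countable (top_of_set \<Gamma>)"
  by (rule second_countable_subtopology [OF second_countable_euclidean])

end

section \<open>The random walk\<close>

lemma padic_abs_prime:
  assumes "prime p" shows "padic_abs p (of_nat p) = inverse (real p)"
proof -
  have "int p \<noteq> 0" using assms by (simp add: prime_gt_0_nat)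
  hence "padic_abs p (of_int (int p) / of_int 1) =
      real p powi (int (multiplicity (int p) 1) - int (multiplicity (int p) (int p)))"
    by (intro padic_abs_frac [OF assms]) auto
  moreover have "multiplicity (int p) (int p) = 1"
    using assms by (intro multiplicity_self) (auto simp: prime_gt_0_nat dest: prime_gt_1_nat)
  ultimately show ?thesis by (simp add: power_int_minus)
qed

text \<open>A new first increment acts on the rest of the walk from the left. The equivariance of
  the limit in \<open>walk_limit_case_nat\<close> rests on this.\<close>

lemma walk_case_nat:
  assumes "group G" "g \<in> carrier G" "\<And>k. \<omega> k \<in> carrier G"
  shows "walk G (case_nat g \<omega>) (Suc m) = g \<otimes>\<^bsub>G\<^esub> walk G \<omega> m"
proof -
  interpret group G by fact
  have "walk G \<omega> m \<in> carrier G" for m using assms(3) by (induction m) auto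
  thus ?thesis using assms by (induction m) (simp_all add: m_assoc)
qed

lemma fst_walk:
  assumes "\<And>k. \<omega> k \<in> carrier (ZUT p n)" "i < n"
  shows "fst (walk (ZUT p n) \<omega> m) $ i = (\<Sum>k<m. fst (\<omega> k) $ i)"
proof (induction m)
  case (Suc m)
  have "fst (\<omega> m) \<in> carrier_vec n" using assms(1) by (simp add: ZUT_carrier)
  thus ?case using Suc assms(2) by (simp add: fst_ZUT_mult)
qed (use assms(2) in \<open>simp add: ZUT_one\<close>)

text \<open>Everything that the convergence arguments need to know about a path. Since t ranges over
  both signs, the drift condition bounds y_i from both sides, with mean speed \<open>v i\<close>;
  the type argument selects the absolute value.\<close>

definition regular_path ::
  "'a::valued_field itself \<Rightarrow> nat \<Rightarrow> nat \<Rightarrow> (nat \<Rightarrow> real) \<Rightarrow> (nat \<Rightarrow> int vec \<times> rat mat) \<Rightarrow> bool" where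
  "regular_path ty p n v \<omega> \<longleftrightarrow>
    (\<forall>m. \<omega> m \<in> carrier (ZUT p n)) \<and>
    (\<forall>i<n. \<forall>t \<beta>. t * v i < \<beta> \<longrightarrow>
      exp_bounded \<beta> (\<lambda>m. exp (t * of_int (fst (walk (ZUT p n) \<omega> m) $ i)))) \<and>
    (\<forall>i<n. \<forall>k<n. \<forall>e>0. exp_bounded e (\<lambda>m. dist (of_rat (snd (\<omega> m) $$ (i, k))) (0::'a)))"

text \<open>In the column formula the term k = j is phi_ij itself, terms below the diagonal vanish,
  and those with k < j are fixed multiples c_k of numbers tending to 0. Hence the limit does not
  depend on the entries of c above the diagonal.\<close>

lemma regular_path_limits:
  fixes p n :: nat and v :: "nat \<Rightarrow> real" and \<omega> :: "nat \<Rightarrow> int vec \<times> rat mat"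
  defines "R \<equiv> walk (ZUT p n) \<omega>"
  assumes p: "p \<noteq> 0" and reg: "regular_path TYPE('a::valued_field) p n v \<omega>" and ij: "i < n" "j < n"
    and contr: "\<And>k. k < j \<Longrightarrow> ln (dist (of_nat p) (0::'a)) * v k < ln (dist (of_nat p) (0::'a)) * v j"
  shows "convergent (\<lambda>m. of_rat (snd (R m) $$ (i, j)) :: 'a)"
    and "c j = 1 \<Longrightarrow> (\<And>k. j < k \<Longrightarrow> k < n \<Longrightarrow> c k = 0) \<Longrightarrow>
      (\<lambda>m. col_act p n (R m) j c i) \<longlonglongrightarrow> lim (\<lambda>m. of_rat (snd (R m) $$ (i, j)) :: 'a)"
proof -
  interpret rat_abs "\<lambda>q. dist (of_rat q) (0::'a)" by (rule rat_abs_valued_field)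
  have \<omega>: "\<omega> m \<in> carrier (ZUT p n)" for m using reg by (simp add: regular_path_def)
  have "\<exists>\<gamma><0. \<forall>i<n. (\<forall>k<j. exp_bounded \<gamma> (\<lambda>m. dist (of_rat
        (snd (R m) $$ (i, k) * of_nat p powi (fst (R m) $ k - fst (R m) $ j))) (0::'a))) \<and>
      exp_bounded \<gamma> (\<lambda>m. dist (of_rat (snd (R (Suc m)) $$ (i, j) - snd (R m) $$ (i, j))) (0::'a))"
    unfolding R_def
    by (rule walk_column_decay [OF p \<omega> ij(2), of v])
      (use reg contr in \<open>auto simp: regular_path_def\<close>)
  then obtain \<gamma> where \<gamma>: "\<gamma> < 0"
    and dec: "\<And>k. k < j \<Longrightarrow> exp_bounded \<gamma> (\<lambda>m. dist (of_rat
        (snd (R m) $$ (i, k) * of_nat p powi (fst (R m) $ k - fst (R m) $ j))) (0::'a))"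
    and incr: "exp_bounded \<gamma> (\<lambda>m. dist (of_rat (snd (R (Suc m)) $$ (i, j) - snd (R m) $$ (i, j))) (0::'a))"
    using ij by blast
  have "Cauchy (\<lambda>m. of_rat (snd (R m) $$ (i, j)) :: 'a)"
    by (rule exp_bounded_Cauchy [OF _ \<gamma>]) (use incr in \<open>simp add: of_rat_diff dist_diff_0\<close>)
  thus conv: "convergent (\<lambda>m. of_rat (snd (R m) $$ (i, j)) :: 'a)"
    by (rule Cauchy_of_rat_convergent)
  assume c: "c j = 1" "\<And>k. j < k \<Longrightarrow> k < n \<Longrightarrow> c k = 0"
  have eq: "col_act p n (R m) j c i = of_rat (snd (R m) $$ (i, j)) +
      (\<Sum>k<j. c k * of_rat (snd (R m) $$ (i, k) * of_nat p powi (fst (R m) $ k - fst (R m) $ j)))" for m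
  proof -
    have "col_act p n (R m) j c i =
        (\<Sum>k<Suc j. of_rat (snd (R m) $$ (i, k)) * of_nat p powi (fst (R m) $ k - fst (R m) $ j) * c k)"
      unfolding col_act_def using ij c by (intro sum.mono_neutral_right) auto
    thus ?thesis using c by (simp add: of_rat_mult of_rat_of_nat_powi mult_ac)
  qed
  have "(\<lambda>m. of_rat (snd (R m) $$ (i, k) * of_nat p powi (fst (R m) $ k - fst (R m) $ j)))
      \<longlonglongrightarrow> (0::'a)" if "k < j" for k
    using exp_bounded_tendsto_0 [OF dec [OF that] \<gamma>] by (simp only: tendsto_dist_iff [of _ "0::'a"])
  hence "(\<lambda>m. \<Sum>k<j. c k * of_rat (snd (R m) $$ (i, k) * of_nat p powi (fst (R m) $ k - fst (R m) $ j)))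
      \<longlonglongrightarrow> (\<Sum>k<j. c k * 0)"
    by (intro tendsto_sum tendsto_mult_const) auto
  hence "(\<lambda>m. of_rat (snd (R m) $$ (i, j)) +
      (\<Sum>k<j. c k * of_rat (snd (R m) $$ (i, k) * of_nat p powi (fst (R m) $ k - fst (R m) $ j))))
      \<longlonglongrightarrow> lim (\<lambda>m. of_rat (snd (R m) $$ (i, j))) + (\<Sum>k<j. c k * 0)"
    by (rule tendsto_add [OF conv [unfolded convergent_LIMSEQ_iff]])
  thus "(\<lambda>m. col_act p n (R m) j c i) \<longlonglongrightarrow> lim (\<lambda>m. of_rat (snd (R m) $$ (i, j)))"
    unfolding eq by simp
qed

section \<open>Almost sure regularity of the paths\<close>

locale ZUT_walk = mixed_columns p n "displacement \<mu>" ty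
  for p n :: nat and \<mu> :: "(int vec \<times> rat mat) measure" and ty :: "'p::prime_card itself" +
  fixes V :: "(int vec \<times> rat mat) set"
  assumes p_prime: "prime p" and p_card: "p = CARD('p)"
    and prob_mu: "prob_space \<mu>" and sets_mu: "sets \<mu> = Pow (carrier (ZUT p n))"
    and V: "finite V" "V \<subseteq> carrier (ZUT p n)" "generate (ZUT p n) V = carrier (ZUT p n)"
    and moment: "integrable \<mu> (\<lambda>g. real (word_length (ZUT p n) V g))"
begin

sublocale G: group G by (rule group_ZUT [OF p])

sublocale seq: sequence_space \<mu>
proof -
  interpret prob_space \<mu> by (rule prob_mu)
  show "sequence_space \<mu>" by unfold_locales
qed

abbreviation "D \<equiv> displacement \<mu>"
abbreviation "v i \<equiv> m1 (coordinate_law \<mu> i)"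
abbreviation \<phi> :: "(nat \<Rightarrow> int vec \<times> rat mat) \<Rightarrow> nat \<Rightarrow> nat \<Rightarrow> 'p entry" where "\<phi> \<equiv> walk_limit p n D"
abbreviation \<B> :: "(nat \<Rightarrow> nat \<Rightarrow> 'p entry) measure" where "\<B> \<equiv> borel_of (top_of_set \<Gamma>)"
abbreviation "\<nu> \<equiv> distr (path_space \<mu>) \<B> \<phi>"

lemma path_space_eq: "path_space \<mu> = seq.S"
  by (simp add: path_space_def)

lemma space_mu: "space \<mu> = carrier G"
  using sets_mu sets.sets_into_space [of _ \<mu>] sets.top [of \<mu>] by auto

lemma sets_mu_count_space: "sets \<mu> = sets (count_space (carrier G))"
  by (simp add: sets_mu)

lemma borel_measurable_mu [measurable]: "f \<in> borel_measurable \<mu>"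
  by (simp add: measurable_cong_sets [OF sets_mu_count_space refl])

lemma v_eq: "v i = (\<integral>g. of_int (fst g $ i) \<partial>\<mu>)"
proof -
  have [measurable]: "f \<in> \<mu> \<rightarrow>\<^sub>M count_space UNIV" for f :: "int vec \<times> rat mat \<Rightarrow> int"
    by (simp add: measurable_cong_sets [OF sets_mu_count_space refl])
  show ?thesis
    unfolding m1_def coordinate_law_def by (subst integral_distr) (auto simp: case_prod_unfold)
qed

lemma AE_path_carrier: "AE \<omega> in seq.S. \<forall>k. \<omega> k \<in> carrier G"
  by (rule AE_I2) (auto simp: space_PiM space_mu PiE_iff)

lemma integrable_coordinate:
  assumes i: "i < n"
  shows "integrable \<mu> (\<lambda>g. of_int (fst g $ i) :: real)"
proof -
  \<comment> \<open>Any absolute value gives access to \<open>word_length_bounds\<close>; the bound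
    on the coordinates does not involve it.\<close>
  interpret rat_abs "\<lambda>q. dist (of_rat q) (0::real)" by (rule rat_abs_valued_field)
  obtain C :: real where C: "\<And>g i. g \<in> carrier G \<Longrightarrow> i < n \<Longrightarrow>
      \<bar>of_int (fst g $ i)\<bar> \<le> C * real (word_length G V g)"
    using word_length_bounds [OF p V] by metis
  show ?thesis
  proof (rule Bochner_Integration.integrable_bound)
    show "integrable \<mu> (\<lambda>g. C * real (word_length G V g))" using moment by simp
    show "AE g in \<mu>. norm (of_int (fst g $ i) :: real) \<le> norm (C * real (word_length G V g))"
    proof (rule AE_I2)
      fix g assume "g \<in> space \<mu>"
      thus "norm (of_int (fst g $ i) :: real) \<le> norm (C * real (word_length G V g))"
        using C [OF _ i, of g] by (simp add: space_mu)
    qed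
  qed measurable
qed

text \<open>The one-sided law is applied to the coordinate and to its negative; the sign of t
  decides which of the two bounds t y_i from above.\<close>

lemma AE_drift:
  assumes i: "i < n"
  shows "AE \<omega> in seq.S. \<forall>t \<beta>. t * v i < \<beta> \<longrightarrow> exp_bounded \<beta> (\<lambda>m. exp (t * of_int (fst (walk G \<omega> m) $ i)))"
proof -
  let ?X = "\<lambda>g. of_int (fst g $ i) :: real"
  note X = integrable_coordinate [OF i]
  have "AE \<omega> in seq.S. \<forall>c>integral\<^sup>L \<mu> (\<lambda>g. - ?X g). \<exists>C. \<forall>m. (\<Sum>k<m. - ?X (\<omega> k)) \<le> C + c * real m"
    by (rule seq.AE_partial_sums_le) (use X in simp)
  with seq.AE_partial_sums_le [OF X] AE_path_carrier show ?thesis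
  proof eventually_elim
    case (elim \<omega>)
    have y: "of_int (fst (walk G \<omega> m) $ i) = (\<Sum>k<m. ?X (\<omega> k))" for m
      using fst_walk [of \<omega> p n i m] elim(2) i by simp
    show ?case
    proof (intro allI impI)
      fix t \<beta> assume t: "t * v i < \<beta>"
      have "\<exists>C. \<forall>m. t * (\<Sum>k<m. ?X (\<omega> k)) \<le> C + \<beta> * real m"
      proof (cases t "0 :: real" rule: linorder_cases)
        case less
        have "integral\<^sup>L \<mu> (\<lambda>g. - ?X g) < \<beta> / (- t)"
          using less t by (simp add: v_eq neg_divide_less_eq mult.commute)
        then obtain C where C: "\<And>m. (\<Sum>k<m. - ?X (\<omega> k)) \<le> C + \<beta> / (- t) * real m"
          using elim(3) by blast
        have "t * (\<Sum>k<m. ?X (\<omega> k)) \<le> (- t) * C + \<beta> * real m" for m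
          using mult_left_mono [OF C, of "- t" m] less by (simp add: sum_negf algebra_simps)
        thus ?thesis by blast
      next
        case equal
        thus ?thesis using t by (intro exI [of _ 0]) simp
      next
        case greater
        have "integral\<^sup>L \<mu> ?X < \<beta> / t"
          using greater t by (simp add: v_eq pos_less_divide_eq mult.commute)
        then obtain C where C: "\<And>m. (\<Sum>k<m. ?X (\<omega> k)) \<le> C + \<beta> / t * real m"
          using elim(1) by blast
        have "t * (\<Sum>k<m. ?X (\<omega> k)) \<le> t * C + \<beta> * real m" for m
          using mult_left_mono [OF C, of t m] greater by (simp add: algebra_simps)
        thus ?thesis by blast
      qed
      then obtain C where C: "\<And>m. t * (\<Sum>k<m. ?X (\<omega> k)) \<le> C + \<beta> * real m" by blast
      show "exp_bounded \<beta> (\<lambda>m. exp (t * of_int (fst (walk G \<omega> m) $ i)))"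
        by (rule exp_boundedI [of _ "exp C"]) (use C in \<open>simp_all add: y flip: exp_add\<close>)
    qed
  qed
qed

text \<open>The word lengths of the increments are integrable, hence grow sublinearly along the
  path, and an entry is at most exponential in the word length. The slope e / K becomes e after
  multiplication by K.\<close>

lemma AE_entries:
  "AE \<omega> in seq.S. \<forall>i<n. \<forall>k<n. \<forall>e>0.
    exp_bounded e (\<lambda>m. dist (of_rat (snd (\<omega> m) $$ (i, k))) (0::'a::valued_field))"
proof -
  interpret rat_abs "\<lambda>q. dist (of_rat q) (0::'a)" by (rule rat_abs_valued_field)
  obtain K :: real where K: "K > 0" "\<And>g i j. g \<in> carrier G \<Longrightarrow> i < n \<Longrightarrow> j < n \<Longrightarrow>
      dist (of_rat (snd g $$ (i, j))) (0::'a) \<le> exp (K * real (word_length G V g))"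
    using word_length_bounds [OF p V] by metis
  from seq.AE_increments_le [OF moment] AE_path_carrier show ?thesis
  proof eventually_elim
    case (elim \<omega>)
    show ?case
    proof (intro allI impI)
      fix i k and e :: real assume ik: "i < n" "k < n" and e: "e > 0"
      have "e / K > 0" using e K by simp
      then obtain C where C: "\<And>m. real (word_length G V (\<omega> m)) \<le> C + e / K * real m"
        using elim(1) by blast
      show "exp_bounded e (\<lambda>m. dist (of_rat (snd (\<omega> m) $$ (i, k))) (0::'a))"
      proof (rule exp_boundedI)
        fix m
        have "dist (of_rat (snd (\<omega> m) $$ (i, k))) (0::'a) \<le> exp (K * real (word_length G V (\<omega> m)))"
          using K elim(2) ik by blast
        also have "K * real (word_length G V (\<omega> m)) \<le> K * (C + e / K * real m)"
          using K C by (intro mult_left_mono) auto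
        also have "exp (K * (C + e / K * real m)) = exp (K * C) * exp (e * real m)"
          using K by (simp add: distrib_left flip: exp_add)
        finally show "dist (of_rat (snd (\<omega> m) $$ (i, k))) (0::'a) \<le> exp (K * C) * exp (e * real m)"
          by simp
      qed simp
    qed
  qed
qed

lemma AE_regular_path: "AE \<omega> in seq.S. regular_path TYPE('a::valued_field) p n v \<omega>"
proof -
  have "AE \<omega> in seq.S. \<forall>i\<in>{..<n}. \<forall>t \<beta>. t * v i < \<beta> \<longrightarrow>
      exp_bounded \<beta> (\<lambda>m. exp (t * of_int (fst (walk G \<omega> m) $ i)))"
    by (intro AE_finite_allI AE_drift) auto
  with AE_path_carrier AE_entries [where 'a = 'a] show ?thesis
    by eventually_elim (auto simp: regular_path_def)
qed

definition good :: "(nat \<Rightarrow> int vec \<times> rat mat) \<Rightarrow> bool" where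
  "good \<omega> \<longleftrightarrow> regular_path TYPE(real) p n v \<omega> \<and> regular_path TYPE('p padic) p n v \<omega>"

lemma AE_good: "AE \<omega> in seq.S. good \<omega>"
  unfolding good_def by (intro AE_conjI AE_regular_path)

lemma good_carrier: "good \<omega> \<Longrightarrow> \<omega> k \<in> carrier G"
  by (simp add: good_def regular_path_def)

lemma good_walk_carrier: "good \<omega> \<Longrightarrow> walk G \<omega> m \<in> carrier G"
  by (rule walk_carrier [OF good_carrier p])

section \<open>Limits along good paths\<close>

text \<open>Here the sign of D selects the field: on the reals ln |p| is positive, so contraction
  means v_k < v_j. For the p-adic absolute value ln |p| = - ln p reverses the inequality, as used in
  \<open>good_padic\<close>.\<close>

lemma good_real:
  assumes good: "good \<omega>" and D: "\<And>k. k < j \<Longrightarrow> D k j < 0" and ij: "i < n" "j < n"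
  shows "convergent (\<lambda>m. of_rat (snd (walk G \<omega> m) $$ (i, j)) :: real)"
    and "c j = 1 \<Longrightarrow> (\<And>k. j < k \<Longrightarrow> k < n \<Longrightarrow> c k = 0) \<Longrightarrow>
      (\<lambda>m. col_act p n (walk G \<omega> m) j c i) \<longlonglongrightarrow> lim (\<lambda>m. of_rat (snd (walk G \<omega> m) $$ (i, j)) :: real)"
proof -
  have "0 < ln (dist (of_nat p) (0::real))" using prime_gt_1_nat [OF p_prime] by simp
  hence contr: "ln (dist (of_nat p) (0::real)) * v k < ln (dist (of_nat p) (0::real)) * v j" if "k < j" for k
    using D [OF that] by (intro mult_strict_left_mono) (simp_all add: displacement_def)
  have reg: "regular_path TYPE(real) p n v \<omega>" using good by (simp add: good_def)
  show "convergent (\<lambda>m. of_rat (snd (walk G \<omega> m) $$ (i, j)) :: real)"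
    by (rule regular_path_limits(1) [OF p reg ij contr])
  show "(\<lambda>m. col_act p n (walk G \<omega> m) j c i) \<longlonglongrightarrow> lim (\<lambda>m. of_rat (snd (walk G \<omega> m) $$ (i, j)) :: real)"
    if "c j = 1" "\<And>k. j < k \<Longrightarrow> k < n \<Longrightarrow> c k = 0"
    by (rule regular_path_limits(2) [OF p reg ij]) (fact contr that)+
qed

lemma good_padic:
  assumes good: "good \<omega>" and D: "\<And>k. k < j \<Longrightarrow> 0 < D k j" and ij: "i < n" "j < n"
  shows "convergent (\<lambda>m. of_rat (snd (walk G \<omega> m) $$ (i, j)) :: 'p padic)"
    and "c j = 1 \<Longrightarrow> (\<And>k. j < k \<Longrightarrow> k < n \<Longrightarrow> c k = 0) \<Longrightarrow>
      (\<lambda>m. col_act p n (walk G \<omega> m) j c i) \<longlonglongrightarrow> lim (\<lambda>m. of_rat (snd (walk G \<omega> m) $$ (i, j)) :: 'p padic)"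
proof -
  have "dist (of_nat p) (0 :: 'p padic) = inverse (real p)"
    using dist_of_rat_padic [of "of_nat p" 0, where 'p = 'p] padic_abs_prime [OF p_prime]
    by (simp flip: p_card)
  hence "ln (dist (of_nat p) (0::'p padic)) < 0"
    using prime_gt_1_nat [OF p_prime] by (simp add: ln_inverse)
  hence contr: "ln (dist (of_nat p) (0::'p padic)) * v k < ln (dist (of_nat p) (0::'p padic)) * v j" if "k < j" for k
    using D [OF that] by (intro mult_strict_left_mono_neg) (simp_all add: displacement_def)
  have reg: "regular_path TYPE('p padic) p n v \<omega>" using good by (simp add: good_def)
  show "convergent (\<lambda>m. of_rat (snd (walk G \<omega> m) $$ (i, j)) :: 'p padic)"
    by (rule regular_path_limits(1) [OF p reg ij contr])
  show "(\<lambda>m. col_act p n (walk G \<omega> m) j c i) \<longlonglongrightarrow> lim (\<lambda>m. of_rat (snd (walk G \<omega> m) $$ (i, j)) :: 'p padic)"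
    if "c j = 1" "\<And>k. j < k \<Longrightarrow> k < n \<Longrightarrow> c k = 0"
    by (rule regular_path_limits(2) [OF p reg ij]) (fact contr that)+
qed

text \<open>Holds on every path: the constructor is chosen by the sign of D, and \<open>lim\<close>
  of a divergent sequence is still an element of the field.\<close>

lemma walk_limit_in_mixed_UT: "\<phi> \<omega> \<in> \<Gamma>"
  using nonzero by (auto simp: mixed_UT_def walk_limit_def nonzero_displacement_def)

lemma good_convergent:
  assumes good: "good \<omega>" and ij: "i < j" "j < n"
  shows "D i j < 0 \<Longrightarrow> convergent (\<lambda>m. of_rat (snd (walk G \<omega> m) $$ (i, j)) :: real)"
    and "D i j > 0 \<Longrightarrow> convergent (\<lambda>m. of_rat (snd (walk G \<omega> m) $$ (i, j)) :: 'p padic)"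
proof -
  have i: "i < n" using ij by simp
  show "convergent (\<lambda>m. of_rat (snd (walk G \<omega> m) $$ (i, j)) :: real)" if "D i j < 0"
    using ij(2)
  proof (cases j rule: column_cases)
    case real
    thus ?thesis by (rule good_real(1) [OF good _ i ij(2)])
  next
    case padic
    thus ?thesis using that ij(1) by force
  qed
  show "convergent (\<lambda>m. of_rat (snd (walk G \<omega> m) $$ (i, j)) :: 'p padic)" if "D i j > 0"
    using ij(2)
  proof (cases j rule: column_cases)
    case real
    thus ?thesis using that ij(1) by force
  next
    case padic
    thus ?thesis by (rule good_padic(1) [OF good _ i ij(2)])
  qed
qed

lemma AE_convergent:
  "AE \<omega> in path_space \<mu>. \<forall>i j. i < j \<and> j < n \<longrightarrow>
    (D i j < 0 \<longrightarrow> convergent (\<lambda>m. of_rat (snd (walk G \<omega> m) $$ (i, j)) :: real)) \<and>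
    (D i j > 0 \<longrightarrow> convergent (\<lambda>m. of_rat (snd (walk G \<omega> m) $$ (i, j)) :: 'p padic))"
  unfolding path_space_eq using AE_good by eventually_elim (simp add: good_convergent)

lemma act_walk_tendsto:
  assumes good: "good \<omega>" and b: "b \<in> \<Gamma>"
  shows "(\<lambda>m. act (walk G \<omega> m) b) \<longlonglongrightarrow> \<phi> \<omega>"
proof (intro tendsto_funI)
  fix i j
  note R = good_walk_carrier [OF good]
  show "(\<lambda>m. act (walk G \<omega> m) b i j) \<longlonglongrightarrow> \<phi> \<omega> i j"
  proof (cases "i < j \<and> j < n")
    case True
    hence ij: "i < j" "i < n" "j < n" by auto
    from ij(3) show ?thesis
    proof (cases j rule: column_cases)
      case real
      have "(\<lambda>m. Real_Entry (col_act p n (walk G \<omega> m) j (\<lambda>k. real_of_entry (b k j)) i) :: 'p entry)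
          \<longlonglongrightarrow> Real_Entry (lim (\<lambda>m. of_rat (snd (walk G \<omega> m) $$ (i, j))))"
        by (intro continuous_on_tendsto_compose [OF continuous_on_Real_Entry [of UNIV]]
            good_real(2) [OF good real ij(2,3)])
          (use ij in \<open>simp_all add: mixed_UT_other [OF b]\<close>)
      thus ?thesis using ij real by (simp add: mixed_act_Real [OF R b p] walk_limit_def)
    next
      case padic
      have "(\<lambda>m. Padic_Entry (col_act p n (walk G \<omega> m) j (\<lambda>k. padic_of_entry (b k j)) i))
          \<longlonglongrightarrow> Padic_Entry (lim (\<lambda>m. of_rat (snd (walk G \<omega> m) $$ (i, j))))"
        by (intro continuous_on_tendsto_compose [OF continuous_on_Padic_Entry [of UNIV]]
            good_padic(2) [OF good padic ij(2,3)])
          (use ij in \<open>simp_all add: mixed_UT_other [OF b]\<close>)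
      moreover have "\<not> D i j < 0" using padic [OF ij(1)] by simp
      ultimately show ?thesis using ij by (simp add: mixed_act_Padic [OF R b p] walk_limit_def)
    qed
  next
    case False
    thus ?thesis
      using mixed_UT_other [OF b False] mixed_UT_other [OF walk_limit_in_mixed_UT False]
      by (simp add: mixed_act_other [OF b False])
  qed
qed

lemma tendsto_real_of_walk_limit:
  assumes good: "good \<omega>" and D: "\<And>k. k < j \<Longrightarrow> D k j < 0" and kj: "k < n" "j < n"
  shows "(\<lambda>m. of_rat (snd (walk G \<omega> m) $$ (k, j))) \<longlonglongrightarrow> real_of_entry (\<phi> \<omega> k j)"
proof (cases k j rule: linorder_cases)
  case less
  thus ?thesis
    using good_real(1) [OF good D kj] D kj by (simp add: walk_limit_def convergent_LIMSEQ_iff)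
qed (use ZUT_entries [OF good_walk_carrier [OF good]] kj in \<open>simp_all add: walk_limit_def\<close>)

lemma tendsto_padic_of_walk_limit:
  assumes good: "good \<omega>" and D: "\<And>k. k < j \<Longrightarrow> 0 < D k j" and kj: "k < n" "j < n"
  shows "(\<lambda>m. of_rat (snd (walk G \<omega> m) $$ (k, j))) \<longlonglongrightarrow> padic_of_entry (\<phi> \<omega> k j)"
proof (cases k j rule: linorder_cases)
  case less
  moreover have "\<not> D k j < 0" using D [OF less] by simp
  ultimately show ?thesis
    using good_padic(1) [OF good D kj] kj by (simp add: walk_limit_def convergent_LIMSEQ_iff)
qed (use ZUT_entries [OF good_walk_carrier [OF good]] kj in \<open>simp_all add: walk_limit_def\<close>)

text \<open>At time m + 1 the extended walk is g times the original walk at time m, and the column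
  action of the fixed g is continuous. Only \<omega> is assumed good; the limit along the extended
  path comes out of the argument.\<close>

lemma walk_limit_case_nat:
  assumes good: "good \<omega>" and g: "g \<in> carrier G"
  shows "\<phi> (case_nat g \<omega>) = act g (\<phi> \<omega>)"
proof (intro ext)
  fix i j
  note b = walk_limit_in_mixed_UT
  show "\<phi> (case_nat g \<omega>) i j = act g (\<phi> \<omega>) i j"
  proof (cases "i < j \<and> j < n")
    case True
    hence ij: "i < j" "i < n" "j < n" by auto
    have walk: "of_rat (snd (walk G (case_nat g \<omega>) (Suc m)) $$ (i, j)) =
        (col_act p n g j (\<lambda>k. of_rat (snd (walk G \<omega> m) $$ (k, j))) i :: 'a::field_char_0)" for m
    proof -
      have "snd (walk G \<omega> m) \<in> carrier_mat n n"
        using good_walk_carrier [OF good] by (simp add: ZUT_carrier UT_iff)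
      thus ?thesis
        using walk_case_nat [OF G.is_group g good_carrier [OF good]]
        by (simp add: snd_ZUT_mult [OF g _ ij(2,3) p] of_rat_col_act)
    qed
    from ij(3) show ?thesis
    proof (cases j rule: column_cases)
      case real
      have "(\<lambda>m. of_rat (snd (walk G (case_nat g \<omega>) (Suc m)) $$ (i, j))) \<longlonglongrightarrow>
          col_act p n g j (\<lambda>k. real_of_entry (\<phi> \<omega> k j)) i"
        unfolding walk by (intro tendsto_col_act tendsto_real_of_walk_limit [OF good real _ ij(3)])
      \<comment> \<open>\<open>LIMSEQ_imp_Suc\<close> undoes the time shift caused by the added
        increment.\<close>
      hence "lim (\<lambda>m. of_rat (snd (walk G (case_nat g \<omega>) m) $$ (i, j))) =
          col_act p n g j (\<lambda>k. real_of_entry (\<phi> \<omega> k j)) i"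
        by (intro limI) (rule LIMSEQ_imp_Suc)
      thus ?thesis
        using ij real by (simp add: mixed_act_Real [OF g b p] walk_limit_def [of _ _ _ "case_nat g \<omega>"])
    next
      case padic
      have "(\<lambda>m. of_rat (snd (walk G (case_nat g \<omega>) (Suc m)) $$ (i, j))) \<longlonglongrightarrow>
          col_act p n g j (\<lambda>k. padic_of_entry (\<phi> \<omega> k j)) i"
        unfolding walk by (intro tendsto_col_act tendsto_padic_of_walk_limit [OF good padic _ ij(3)])
      hence "lim (\<lambda>m. of_rat (snd (walk G (case_nat g \<omega>) m) $$ (i, j))) =
          col_act p n g j (\<lambda>k. padic_of_entry (\<phi> \<omega> k j)) i"
        by (intro limI) (rule LIMSEQ_imp_Suc)
      moreover have "\<not> D i j < 0" using padic [OF ij(1)] by simp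
      ultimately show ?thesis
        using ij by (simp add: mixed_act_Padic [OF g b p] walk_limit_def [of _ _ _ "case_nat g \<omega>"])
    qed
  next
    case False
    thus ?thesis by (simp add: mixed_act_other [OF b False] mixed_UT_other [OF b False])
  qed
qed

section \<open>Measurability of the walk, of its limit and of the action\<close>

lemma measurable_increment: "(\<lambda>\<omega>. \<omega> k) \<in> seq.S \<rightarrow>\<^sub>M count_space (carrier G)"
  using measurable_component_singleton [of k UNIV "\<lambda>_. \<mu>"]
  by (simp add: measurable_cong_sets [OF refl sets_mu_count_space])

lemma measurable_walk: "(\<lambda>\<omega>. walk G \<omega> m) \<in> seq.S \<rightarrow>\<^sub>M count_space (carrier G)"
proof (induction m)
  case (Suc m)
  have "(\<lambda>\<omega>. walk G \<omega> m \<otimes>\<^bsub>G\<^esub> \<omega> m) \<in> seq.S \<rightarrow>\<^sub>M count_space (carrier G)"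
  \<comment> \<open>The first factor takes countably many values, so it may be held fixed.\<close>
  proof (rule measurable_compose_countable' [OF _ Suc])
    show "(\<lambda>\<omega>. g \<otimes>\<^bsub>G\<^esub> \<omega> m) \<in> seq.S \<rightarrow>\<^sub>M count_space (carrier G)" if "g \<in> carrier G" for g
      by (rule measurable_compose [OF measurable_increment]) (use that in simp)
    show "countable (carrier G)"
      using G.countable_carrier [OF V(2,3) countable_finite [OF V(1)]] .
  qed
  thus ?case by simp
qed simp

lemma measurable_walk_limit: "\<phi> \<in> path_space \<mu> \<rightarrow>\<^sub>M \<B>"
proof (rule measurable_borel_of_top_of_set)
  show "\<phi> \<in> space (path_space \<mu>) \<rightarrow> \<Gamma>" using walk_limit_in_mixed_UT by auto
  have q: "(\<lambda>\<omega>. snd (walk G \<omega> m) $$ (i, j)) \<in> seq.S \<rightarrow>\<^sub>M count_space UNIV" for m i j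
    by (rule measurable_compose [OF measurable_walk]) simp
  show "\<phi> \<in> borel_measurable (path_space \<mu>)"
    unfolding path_space_eq
  proof (intro measurable_coordinatewise_then_product)
    fix i j
    have 1: "(\<lambda>\<omega>. Real_Entry (lim (\<lambda>m. of_rat (snd (walk G \<omega> m) $$ (i, j)))) :: 'p entry)
        \<in> borel_measurable seq.S"
      by (rule measurable_compose [OF borel_measurable_lim_of_rat [OF q]])
        (intro borel_measurable_continuous_onI continuous_on_Real_Entry)
    have 2: "(\<lambda>\<omega>. Padic_Entry (lim (\<lambda>m. of_rat (snd (walk G \<omega> m) $$ (i, j)))) :: 'p entry)
        \<in> borel_measurable seq.S"
      by (rule measurable_compose [OF borel_measurable_lim_of_rat [OF q]])
        (intro borel_measurable_continuous_onI continuous_on_Padic_Entry)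
    show "(\<lambda>\<omega>. \<phi> \<omega> i j) \<in> borel_measurable seq.S"
      using 1 2 by (cases "i < j \<and> j < n"; cases "D i j < 0") (simp_all add: walk_limit_def)
  qed
qed

lemma measurable_act: "g \<in> carrier G \<Longrightarrow> act g \<in> \<B> \<rightarrow>\<^sub>M \<B>"
  by (rule continuous_map_measurable_borel_of [OF continuous_map_act])

lemma measurable_act_pair: "(\<lambda>(g, b). act g b) \<in> \<mu> \<Otimes>\<^sub>M \<B> \<rightarrow>\<^sub>M \<B>"
proof -
  have "fst \<in> \<mu> \<Otimes>\<^sub>M \<B> \<rightarrow>\<^sub>M count_space (carrier G)"
    using measurable_fst [of \<mu> \<B>] by (simp add: measurable_cong_sets [OF refl sets_mu_count_space])
  hence "(\<lambda>z. act (fst z) (snd z)) \<in> \<mu> \<Otimes>\<^sub>M \<B> \<rightarrow>\<^sub>M \<B>"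
    by (rule measurable_compose_countable' [rotated])
      (auto intro: measurable_compose [OF measurable_snd measurable_act]
        G.countable_carrier [OF V(2,3) countable_finite [OF V(1)]])
  thus ?thesis by (simp add: case_prod_unfold)
qed

section \<open>Stationarity and weak convergence\<close>

lemma prob_space_nu: "prob_space \<nu>"
  using seq.P.prob_space_distr measurable_walk_limit by (simp add: path_space_eq)

text \<open>The convolution is the law of g \<phi>(\<omega>) for g and \<omega> independent. This
  agrees almost surely with the limit \<phi> of the path extended by g, and putting an independent
  increment in front preserves the path measure.\<close>

lemma stationary_nu: "stationary \<mu> act \<nu>"
proof -
  interpret nu: prob_space \<nu> by (rule prob_space_nu)
  have phi: "\<phi> \<in> seq.S \<rightarrow>\<^sub>M \<B>" using measurable_walk_limit by (simp add: path_space_eq)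
  have pair: "(\<lambda>(g, \<omega>). (g, \<phi> \<omega>)) \<in> \<mu> \<Otimes>\<^sub>M seq.S \<rightarrow>\<^sub>M \<mu> \<Otimes>\<^sub>M \<B>"
    using phi by measurable
  have cons: "(\<lambda>(g, \<omega>). case_nat g \<omega>) \<in> \<mu> \<Otimes>\<^sub>M seq.S \<rightarrow>\<^sub>M seq.S"
    by measurable
  \<comment> \<open>Written as an image under the identity, \<mu> fits the rule for products of two
    image measures.\<close>
  have "\<mu> \<Otimes>\<^sub>M \<nu> = distr \<mu> \<mu> (\<lambda>g. g) \<Otimes>\<^sub>M \<nu>" by (simp add: distr_id)
  also have "\<dots> = distr (\<mu> \<Otimes>\<^sub>M seq.S) (\<mu> \<Otimes>\<^sub>M \<B>) (\<lambda>(g, \<omega>). (g, \<phi> \<omega>))"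
    unfolding path_space_eq
    by (rule pair_measure_distr [OF measurable_ident_sets [OF refl] phi])
      (use nu.sigma_finite_measure_axioms in \<open>simp add: path_space_eq\<close>)
  finally have prod: "\<mu> \<Otimes>\<^sub>M \<nu> = distr (\<mu> \<Otimes>\<^sub>M seq.S) (\<mu> \<Otimes>\<^sub>M \<B>) (\<lambda>(g, \<omega>). (g, \<phi> \<omega>))" .
  have "convolution \<mu> act \<nu> = distr (\<mu> \<Otimes>\<^sub>M \<nu>) \<B> (\<lambda>(g, b). act g b)"
    unfolding convolution_def by (rule distr_cong) auto
  also have "\<dots> = distr (\<mu> \<Otimes>\<^sub>M seq.S) \<B> ((\<lambda>(g, b). act g b) \<circ> (\<lambda>(g, \<omega>). (g, \<phi> \<omega>)))"
    unfolding prod by (rule distr_distr [OF measurable_act_pair pair])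
  also have "\<dots> = distr (\<mu> \<Otimes>\<^sub>M seq.S) \<B> (\<phi> \<circ> (\<lambda>(g, \<omega>). case_nat g \<omega>))"
  proof (rule distr_cong_AE)
    have "AE z in \<mu> \<Otimes>\<^sub>M seq.S. good (snd z)"
      by (rule AE_distrD [OF measurable_snd], subst seq.distr_pair_snd) (rule AE_good)
    moreover have "AE z in \<mu> \<Otimes>\<^sub>M seq.S. fst z \<in> carrier G"
      by (rule AE_I2) (auto simp: space_pair_measure space_mu)
    ultimately show "AE z in \<mu> \<Otimes>\<^sub>M seq.S. ((\<lambda>(g, b). act g b) \<circ> (\<lambda>(g, \<omega>). (g, \<phi> \<omega>))) z =
        (\<phi> \<circ> (\<lambda>(g, \<omega>). case_nat g \<omega>)) z"
      by eventually_elim (simp add: case_prod_unfold walk_limit_case_nat)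
  qed (use measurable_comp [OF pair measurable_act_pair] measurable_comp [OF cons phi] in simp_all)
  also have "\<dots> = distr (distr (\<mu> \<Otimes>\<^sub>M seq.S) seq.S (\<lambda>(g, \<omega>). case_nat g \<omega>)) \<B> \<phi>"
    by (rule distr_distr [symmetric, OF phi cons])
  also have "\<dots> = \<nu>" by (simp add: seq.PiM_iter path_space_eq)
  finally show ?thesis by (simp add: stationary_def)
qed

lemma weak_star_limit_walk:
  assumes good: "good \<omega>"
  shows "weak_star_limit (top_of_set \<Gamma>) (\<lambda>m. distr \<nu> \<B> (act (walk G \<omega> m))) (return \<B> (\<phi> \<omega>))"
  unfolding weak_star_limit_def
proof (intro allI impI)
  interpret nu: prob_space \<nu> by (rule prob_space_nu)
  fix h :: "(nat \<Rightarrow> nat \<Rightarrow> 'p entry) \<Rightarrow> real"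
  assume h: "continuous_map (top_of_set \<Gamma>) euclideanreal h \<and> bounded (h ` topspace (top_of_set \<Gamma>))"
  have h_meas: "h \<in> borel_measurable \<B>"
    using continuous_map_measurable_borel_of [of "top_of_set \<Gamma>" euclideanreal h] h
    by (simp add: borel_of_euclidean)
  have h_cont: "continuous_on \<Gamma> h" using h by simp
  obtain K where K: "\<And>b. b \<in> \<Gamma> \<Longrightarrow> norm (h b) \<le> K" using h by (auto simp: bounded_iff)
  note R = good_walk_carrier [OF good]
  have act_meas: "act (walk G \<omega> m) \<in> \<nu> \<rightarrow>\<^sub>M \<B>" for m using measurable_act [OF R] by simp
  have "(\<lambda>m. \<integral>b. h (act (walk G \<omega> m) b) \<partial>\<nu>) \<longlonglongrightarrow> (\<integral>b. h (\<phi> \<omega>) \<partial>\<nu>)"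
  proof (rule integral_dominated_convergence [where w = "\<lambda>_. K"])
    show "(\<lambda>b. h (act (walk G \<omega> m) b)) \<in> borel_measurable \<nu>" for m
      by (rule measurable_compose [OF act_meas h_meas])
    show "AE b in \<nu>. (\<lambda>m. h (act (walk G \<omega> m) b)) \<longlonglongrightarrow> h (\<phi> \<omega>)"
    proof (rule AE_I2)
      fix b assume "b \<in> space \<nu>"
      hence b: "b \<in> \<Gamma>" by simp
      show "(\<lambda>m. h (act (walk G \<omega> m) b)) \<longlonglongrightarrow> h (\<phi> \<omega>)"
        by (rule continuous_on_tendsto_compose [OF h_cont act_walk_tendsto [OF good b] walk_limit_in_mixed_UT])
          (simp add: act_closed [OF R b])
    qed
    show "AE b in \<nu>. norm (h (act (walk G \<omega> m) b)) \<le> K" for m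
      by (rule AE_I2, rule K, rule act_closed [OF R]) simp
  qed simp_all
  moreover have "(\<integral>b. h b \<partial>distr \<nu> \<B> (act (walk G \<omega> m))) = (\<integral>b. h (act (walk G \<omega> m) b) \<partial>\<nu>)" for m
    by (rule integral_distr [OF act_meas h_meas])
  moreover have "(\<integral>b. h b \<partial>return \<B> (\<phi> \<omega>)) = h (\<phi> \<omega>)"
    by (rule integral_return [OF _ h_meas]) (simp add: walk_limit_in_mixed_UT)
  \<comment> \<open>Evaluates the integral of the constant \<open>h (\<phi> \<omega>)\<close>, which
    is this constant times the mass of \<Gamma>.\<close>
  moreover have "nu.prob \<Gamma> = 1" using nu.prob_space by simp
  ultimately show "(\<lambda>m. \<integral>b. h b \<partial>distr \<nu> \<B> (act (walk G \<omega> m))) \<longlonglongrightarrow> (\<integral>b. h b \<partial>return \<B> (\<phi> \<omega>))"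
    by simp
qed

lemma is_boundary_nu: "is_boundary G \<mu> (top_of_set \<Gamma>) act \<nu> \<phi>"
proof -
  have "AE \<omega> in path_space \<mu>.
      weak_star_limit (top_of_set \<Gamma>) (\<lambda>m. distr \<nu> \<B> (act (walk G \<omega> m))) (return \<B> (\<phi> \<omega>))"
    using AE_good unfolding path_space_eq [symmetric]
    by eventually_elim (rule weak_star_limit_walk)
  thus ?thesis
    unfolding is_boundary_def sets_distr
    by (intro conjI second_countable_mixed_UT G_space_act prob_space_nu stationary_nu
      measurable_walk_limit refl)
qed

end

text \<open>The first conjunct secures that the limits entering \<open>walk_limit\<close> exist
  almost surely, so that \<phi> is the limit of the walk and not merely the value of
  \<open>lim\<close> on a divergent sequence.\<close>

theorem mainTheorem6:
  fixes p n :: nat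
    and \<mu> :: "(int vec \<times> rat mat) measure"
    and S :: "(int vec \<times> rat mat) set"
  defines "G \<equiv> ZUT p n"
    and "D \<equiv> displacement \<mu>"
  defines "\<Gamma> \<equiv> (mixed_UT n D :: (nat \<Rightarrow> nat \<Rightarrow> 'p::prime_card entry) set)"
    and "act \<equiv> (mixed_act p n D ::
           int vec \<times> rat mat \<Rightarrow> (nat \<Rightarrow> nat \<Rightarrow> 'p entry) \<Rightarrow> (nat \<Rightarrow> nat \<Rightarrow> 'p entry))"
    and "\<phi> \<equiv> (walk_limit p n D :: (nat \<Rightarrow> int vec \<times> rat mat) \<Rightarrow> (nat \<Rightarrow> nat \<Rightarrow> 'p entry))"
  defines "\<nu> \<equiv> distr (path_space \<mu>) (borel_of (top_of_set \<Gamma>)) \<phi>"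
  assumes "prime p" and "p = CARD('p)"
    and "prob_space \<mu>" and "sets \<mu> = Pow (carrier G)"
    and "finite S" and "S \<subseteq> carrier G" and "generate G S = carrier G"
    and "integrable \<mu> (\<lambda>g. real (word_length G S g))"
    and "\<not> comm_group (G\<lparr>carrier := generate G (supp \<mu>)\<rparr>)"
    and "nonzero_displacement n D" and "column_consistent n D"
  shows "(AE \<omega> in path_space \<mu>. \<forall>i j. i < j \<and> j < n \<longrightarrow>
           (D i j < 0 \<longrightarrow> convergent (\<lambda>m. of_rat (snd (walk G \<omega> m) $$ (i, j)) :: real)) \<and>
           (D i j > 0 \<longrightarrow> convergent (\<lambda>m. of_rat (snd (walk G \<omega> m) $$ (i, j)) :: 'p padic))) \<and>
         second_countable (top_of_set \<Gamma>) \<and>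
         G_space G (top_of_set \<Gamma>) act \<and>
         stationary \<mu> act \<nu> \<and>
         is_boundary G \<mu> (top_of_set \<Gamma>) act \<nu> \<phi>"
proof -
  have "p \<noteq> 0" using \<open>prime p\<close> prime_gt_0_nat by blast
  note assms = assms [unfolded G_def D_def] this
  interpret W: ZUT_walk p n \<mu> "TYPE('p)" S
    by (intro ZUT_walk.intro mixed_columns.intro ZUT_walk_axioms.intro) (fact assms)+
  show ?thesis
    unfolding \<Gamma>_def act_def \<phi>_def \<nu>_def G_def D_def
    by (intro conjI W.AE_convergent W.second_countable_mixed_UT W.G_space_act W.stationary_nu
      W.is_boundary_nu)
qed

end
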